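(* Let $d \geq 1$ be an integer, let $\gamma \geq 1$ be real, and let $V_0 \in L^{\gamma+d/2}(\mathbb{R}^d,\mathbb{R})$ satisfy $\int_{\mathbb{R}^d} |V_0|^{\gamma+d/2} = 1$. Let $(V_n)_{n\geq 0}$ be a sequence of potentials generated from $V_0$ by the maximization algorithm with parameters $\gamma, d$ (described in the context). Then $E(V_{n+1})^{1/\gamma} \geq E(V_n)^{1/\gamma}$ for every $n \geq 0$, where $E(V) = \mathrm{tr}\left((-\Delta+V)_-^{\gamma}\right)$. Therefore the sequence $(E(V_n))_{n \geq 0}$ is non-decreasing and, since it is bounded from above, it converges.
   Context: For $V \in L^{\gamma + d/2}(\mathbb{R}^d,\mathbb{R})$ with $\gamma\ge 1$, $-\Delta + V$ denotes the Schrödinger operator on $L^2(\mathbb{R}^d)$. $(-\Delta+V)_-$ denotes its negative part, defined by functional calculus with $t_- = \max(-t,0)$, and $E(V) = \mathrm{tr}\left((-\Delta+V)_-^{\gamma}\right) = \sum_i |\lambda_i|^{\gamma}$, where the $\lambda_i$ are the negative eigenvalues of $-\Delta+V$ counted with multiplicity. Known fact (Lieb-Thirring inequality): for $\gamma \geq 1$ and $d \geq 1$ there is a finite constant $L_{\gamma,d}$ such that $E(V) \leq L_{\gamma,d} \int_{\mathbb{R}^d} V_-^{\gamma + d/2}$ for all $V \in L^{\gamma+d/2}(\mathbb{R}^d,\mathbb{R})$, where $V_- = \max(-V,0)$. Maximization algorithm. Given $V_n$, the potential $V_{n+1}$ is obtained as follows. (1) Compute the negative eigenvalues $\lambda_i$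 (counted with multiplicity) of $-\Delta+V_n$, and corresponding real-valued orthonormal eigenfunctions $\psi_i$ in $L^2(\mathbb{R}^d)$. (2) Set $\rho_n = \sum_i (-\lambda_i)^{\gamma-1}\psi_i^2$. (3) Set $K_n = \left( \int_{\mathbb{R}^d} \rho_n^{\frac{\gamma+d/2}{\gamma+d/2-1}} \right)^{-\frac{1}{\gamma+d/2}}$. (4) Set $V_{n+1} = -K_n\, \rho_n^{\frac{1}{\gamma+d/2-1}}$ (so that $\int_{\mathbb{R}^d} |V_{n+1}|^{\gamma+d/2} = 1$). *)

theory Defs
  imports "HOL-Analysis.Analysis"
begin

section \<open>Lebesgue spaces on \<open>\<real>\<^sup>d\<close>\<close>

text \<open>Elements of the Lebesgue spaces are represented by measurable functions; equality in the
  space is equality almost everywhere. The exponents used are finite and at least 1.\<close>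

definition Lp :: "real \<Rightarrow> (real^'d \<Rightarrow> 'b::{real_normed_vector, second_countable_topology}) set" where
  "Lp p = {f. f \<in> borel_measurable lborel \<and> integrable lborel (\<lambda>x. norm (f x) powr p)}"

definition L2_inner :: "(real^'d \<Rightarrow> complex) \<Rightarrow> (real^'d \<Rightarrow> complex) \<Rightarrow> complex" where
  "L2_inner f g = (LINT x|lborel. cnj (f x) * g x)"

section \<open>Test functions, weak derivatives and the Sobolev space \<open>H\<^sup>1\<close>\<close>

definition partial :: "'d \<Rightarrow> (real^'d \<Rightarrow> real) \<Rightarrow> real^'d \<Rightarrow> real" where
  "partial i \<phi> = (\<lambda>x. deriv (\<lambda>t. \<phi> (x + t *\<^sub>R axis i 1)) 0)"

primrec Ck :: "nat \<Rightarrow> (real^'d \<Rightarrow> real) \<Rightarrow> bool" where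
  "Ck 0 \<phi> \<longleftrightarrow> continuous_on UNIV \<phi>"
| "Ck (Suc k) \<phi> \<longleftrightarrow>
     (\<forall>i x. (\<lambda>t. \<phi> (x + t *\<^sub>R axis i 1)) field_differentiable at 0) \<and> (\<forall>i. Ck k (partial i \<phi>))"

definition test_function :: "(real^'d \<Rightarrow> real) \<Rightarrow> bool" where
  "test_function \<phi> \<longleftrightarrow> (\<forall>k. Ck k \<phi>) \<and> compact (closure {x. \<phi> x \<noteq> 0})"

definition has_weak_partial :: "'d \<Rightarrow> (real^'d \<Rightarrow> complex) \<Rightarrow> (real^'d \<Rightarrow> complex) \<Rightarrow> bool" where
  "has_weak_partial i u g \<longleftrightarrow> g \<in> Lp 2 \<and>
     (\<forall>\<phi>. test_function \<phi> \<longrightarrow>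
        (LINT x|lborel. u x * complex_of_real (partial i \<phi> x)) =
        - (LINT x|lborel. g x * complex_of_real (\<phi> x)))"

definition H1 :: "(real^'d \<Rightarrow> complex) set" where
  "H1 = {u. u \<in> Lp 2 \<and> (\<forall>i. \<exists>g. has_weak_partial i u g)}"

text \<open>The choice is harmless: weak derivatives are unique up to null sets.\<close>

definition weak_partial :: "'d \<Rightarrow> (real^'d \<Rightarrow> complex) \<Rightarrow> real^'d \<Rightarrow> complex" where
  "weak_partial i u = (SOME g. has_weak_partial i u g)"

section \<open>The Schroedinger operator\<close>

definition schroedinger_form ::
    "(real^'d \<Rightarrow> real) \<Rightarrow> (real^'d \<Rightarrow> complex) \<Rightarrow> (real^'d \<Rightarrow> complex) \<Rightarrow> complex" where
  "schroedinger_form V u v =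
     (\<Sum>i\<in>UNIV. L2_inner (weak_partial i u) (weak_partial i v)) +
     (LINT x|lborel. complex_of_real (V x) * cnj (u x) * v x)"

text \<open>The graph of \<open>- \<Delta> + V\<close>, realised as the self-adjoint operator associated with its quadratic
  form on \<open>H\<^sup>1\<close>. For \<open>V\<close> in the Lebesgue space of exponent \<open>\<gamma> + d/2\<close>, \<open>\<gamma> \<ge> 1\<close>, the potential is
  infinitesimally form bounded with respect to \<open>- \<Delta>\<close>, so the form is closed and bounded below.
  The operator sum on \<open>H\<^sup>2\<close> is not available in general: for \<open>d = \<gamma> = 1\<close> the exponent is 3/2
  and \<open>V u\<close> need not be square integrable for \<open>u\<close> in \<open>H\<^sup>2\<close>.\<close>

definition schroedinger_op ::
    "(real^'d \<Rightarrow> real) \<Rightarrow> (real^'d \<Rightarrow> complex) \<Rightarrow> (real^'d \<Rightarrow> complex) \<Rightarrow> bool" where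
  "schroedinger_op V u f \<longleftrightarrow> u \<in> H1 \<and> f \<in> Lp 2 \<and>
     (\<forall>v\<in>H1. schroedinger_form V u v = L2_inner f v)"

definition eigenspace :: "(real^'d \<Rightarrow> real) \<Rightarrow> real \<Rightarrow> (real^'d \<Rightarrow> complex) set" where
  "eigenspace V \<mu> = {u. schroedinger_op V u (\<lambda>x. complex_of_real \<mu> * u x)}"

text \<open>Linear independence in the space of functions modulo null sets.\<close>

definition ae_independent :: "nat \<Rightarrow> (nat \<Rightarrow> real^'d \<Rightarrow> complex) \<Rightarrow> bool" where
  "ae_independent n u \<longleftrightarrow>
     (\<forall>c :: nat \<Rightarrow> complex. (AE x in lborel. (\<Sum>k<n. c k * u k x) = 0) \<longrightarrow> (\<forall>k<n. c k = 0))"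

text \<open>The dimension of the eigenspace over the complex numbers; it is 0 if \<open>\<mu>\<close> is not an
  eigenvalue.\<close>

definition eigen_mult :: "(real^'d \<Rightarrow> real) \<Rightarrow> real \<Rightarrow> enat" where
  "eigen_mult V \<mu> =
     Sup {enat n |n. \<exists>u. (\<forall>k<n. u k \<in> eigenspace V \<mu>) \<and> ae_independent n u}"

text \<open>\<open>tr ((- \<Delta> + V)\<^sub>-\<^sup>\<gamma>)\<close>, as the sum of \<open>\<bar>\<mu>\<bar>\<^sup>\<gamma>\<close> over the negative eigenvalues \<open>\<mu>\<close>, each taken as often
  as its multiplicity. Extended nonnegative values avoid the convention that a divergent real sum
  is 0.\<close>

definition energy :: "real \<Rightarrow> (real^'d \<Rightarrow> real) \<Rightarrow> ennreal" where
  "energy \<gamma> V =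
     (\<Sum>\<^sub>\<infinity>\<mu>\<in>{..<0}. ennreal_of_enat (eigen_mult V \<mu>) * ennreal (\<bar>\<mu>\<bar> powr \<gamma>))"

section \<open>The maximization algorithm\<close>

text \<open>The family \<open>(\<lambda>\<^sub>i, \<psi>\<^sub>i)\<close>, \<open>i \<in> I\<close>, lists the negative eigenvalues with multiplicity, together
  with real-valued orthonormal eigenfunctions. The index set may be empty, finite or infinite.\<close>

definition neg_eigensystem ::
    "(real^'d \<Rightarrow> real) \<Rightarrow> nat set \<Rightarrow> (nat \<Rightarrow> real) \<Rightarrow> (nat \<Rightarrow> real^'d \<Rightarrow> real) \<Rightarrow> bool" where
  "neg_eigensystem V I l \<psi> \<longleftrightarrow>
     (\<forall>i\<in>I. l i < 0 \<and> (\<lambda>x. complex_of_real (\<psi> i x)) \<in> eigenspace V (l i)) \<and>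
     (\<forall>i\<in>I. \<forall>j\<in>I. L2_inner (\<lambda>x. complex_of_real (\<psi> i x)) (\<lambda>x. complex_of_real (\<psi> j x))
        = (if i = j then 1 else 0)) \<and>
     (\<forall>\<mu><0. eigen_mult V \<mu> =
        (if finite {i\<in>I. l i = \<mu>} then enat (card {i\<in>I. l i = \<mu>}) else \<infinity>))"

text \<open>For an eigensystem of an admissible potential the series converges almost everywhere and its
  power in \<open>algorithm_step\<close> is integrable, by the dual Lieb-Thirring inequality; so the default
  values for divergent sums and integrals play no role.\<close>

definition weighted_density ::
    "real \<Rightarrow> nat set \<Rightarrow> (nat \<Rightarrow> real) \<Rightarrow> (nat \<Rightarrow> real^'d \<Rightarrow> real) \<Rightarrow> real^'d \<Rightarrow> real" where
  "weighted_density \<gamma> I l \<psi> x = (\<Sum>\<^sub>\<infinity>i\<in>I. (- l i) powr (\<gamma> - 1) * (\<psi> i x)\<^sup>2)"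

text \<open>One step of the algorithm. It is a relation, since the eigenfunctions are not unique and the
  new potential is determined only almost everywhere. If there are no negative eigenvalues, then
  \<open>\<rho> = 0\<close>, and the normalisation \<open>K\<close> is undefined in the usual reading; here
  \<open>0 powr a = 0\<close> makes the new potential vanish, so that this case is included rather than
  excluded by a hypothesis.\<close>

definition algorithm_step :: "real \<Rightarrow> (real^'d \<Rightarrow> real) \<Rightarrow> (real^'d \<Rightarrow> real) \<Rightarrow> bool" where
  "algorithm_step \<gamma> V V' \<longleftrightarrow>
     (\<exists>I l \<psi>. neg_eigensystem V I l \<psi> \<and>
        (let p = \<gamma> + real CARD('d) / 2;
             \<rho> = weighted_density \<gamma> I l \<psi>;
             K = (LINT x|lborel. \<rho> x powr (p / (p - 1))) powr (- 1 / p)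
         in V' \<in> borel_measurable lborel \<and>
            (AE x in lborel. V' x = - K * \<rho> x powr (1 / (p - 1)))))"

end

(*
  Kinetic energy is compared with the heat semigroup P_t. For g(t) = (u, u - P_t u) one has
  |u - P_t u|^2 = 2 g(t) - g(2 t), so the sum of |u - P_t u|^2 / t over dyadic t telescopes and is at most
  a constant times |grad u|^2. Together with Bessel's inequality for the low frequencies P_t u_i of an
  orthonormal family, this gives a pointwise Rumin-type estimate of the weighted density
  rho = sum_i kappa_i^(gamma-1) u_i^2, hence a bound of the integral of rho^(p/(p-1)), p = gamma + d/2, by
  sum_i kappa_i^(gamma-1) |grad u_i|^2 + sum_i kappa_i^gamma. For eigenfunctions with eigenvalues -kappa_i the
  latter equals -(integral of V rho), so Young's inequality yields the Lieb-Thirring inequality.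

  For monotonicity write E_n = -sum_i kappa_i^(gamma-1) (psi_i, (-Delta) psi_i) - (integral of V_n rho_n). By
  Hoelder, with equality for V_(n+1), replacing V_n by V_(n+1) does not decrease the right-hand side. The form of
  -Delta + V_(n+1) is bounded below by its negative eigenvalues, because a compactness argument produces an
  eigenfunction wherever the form is negative. The Young and Bessel inequalities then bound
  the right-hand side by (1 - 1/gamma) E_n + (1/gamma) E_(n+1).
*)

theory Submission
  imports Defs "HOL-Complex_Analysis.Great_Picard" "HOL-Library.Diagonal_Subsequence"
begin

section \<open>Real square integrable functions\<close>

text \<open>The heat estimates see kinetic energy through one inequality: a shift by z moves u in L2
  by at most |z| times the norm of its gradient. It is proved by duality with test functions, so
  neither the Fourier transform nor density of smooth functions is involved. The dual inequality
  calls, at each point x, for a time adapted to the density there; summing over all dyadic times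
  removes this dependence at the cost of constant factors.

  The index set may be infinite and the eigenvalues may accumulate at 0. Estimates are therefore
  proved for finite orthonormal families with constants independent of their size, and levels above
  -eps are given up first and recovered as eps tends to 0. The Lieb-Thirring bound is proved rather
  than assumed since it also yields finite multiplicities, almost everywhere convergence of the
  density and dominating functions for the limits. All analysis is done for real functions: V and
  the eigenfunctions of the algorithm are real, so complex test functions split into real and
  imaginary parts.\<close>

definition L2 :: "('a::euclidean_space \<Rightarrow> real) set" where
  "L2 = {u. u \<in> borel_measurable borel \<and> integrable lborel (\<lambda>x. (u x)\<^sup>2)}"

definition ip :: "('a::euclidean_space \<Rightarrow> real) \<Rightarrow> ('a \<Rightarrow> real) \<Rightarrow> real" where
  "ip u v = (LINT x|lborel. u x * v x)"

lemma L2_measurable[measurable_dest]: "u \<in> L2 \<Longrightarrow> u \<in> borel_measurable borel"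
  by (simp add: L2_def)

lemma L2_sq: "u \<in> L2 \<Longrightarrow> integrable lborel (\<lambda>x. (u x)\<^sup>2)"
  by (simp add: L2_def)

lemma abs_mult_le_sum_squares: "\<bar>y * z\<bar> \<le> y\<^sup>2 + z\<^sup>2" for y z :: real
proof -
  have "0 \<le> (\<bar>y\<bar> - \<bar>z\<bar>)\<^sup>2" by simp
  then have "2 * (\<bar>y\<bar> * \<bar>z\<bar>) \<le> y\<^sup>2 + z\<^sup>2" by (simp add: power2_diff)
  moreover have "0 \<le> \<bar>y\<bar> * \<bar>z\<bar>" by simp
  ultimately show ?thesis unfolding abs_mult by linarith
qed

lemma L2_mult_integrable:
  assumes [measurable]: "u \<in> L2" "v \<in> L2" shows "integrable lborel (\<lambda>x. u x * v x)"
proof (rule Bochner_Integration.integrable_bound)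
  show "integrable lborel (\<lambda>x. (u x)\<^sup>2 + (v x)\<^sup>2)"
    using assms by (auto intro!: L2_sq)
  show "AE x in lborel. norm (u x * v x) \<le> norm ((u x)\<^sup>2 + (v x)\<^sup>2)"
    using abs_mult_le_sum_squares[of "u _" "v _"] by (intro AE_I2) auto
qed (use assms in measurable)

lemma L2_add: assumes [measurable]: "u \<in> L2" "v \<in> L2" shows "(\<lambda>x. u x + v x) \<in> L2"
proof -
  have "integrable lborel (\<lambda>x. (u x)\<^sup>2 + (v x)\<^sup>2 + 2 * (u x * v x))"
    using assms by (intro Bochner_Integration.integrable_add integrable_mult_right L2_sq L2_mult_integrable)
  then show ?thesis unfolding L2_def by (auto simp: power2_sum algebra_simps)
qed

lemma L2_cmult: assumes "u \<in> L2" shows "(\<lambda>x. c * u x) \<in> L2"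
  using assms by (auto simp: L2_def power_mult_distrib)

lemma L2_minus: assumes "u \<in> L2" shows "(\<lambda>x. - u x) \<in> L2"
  using L2_cmult[OF assms, of "-1"] by simp

lemma L2_diff: assumes "u \<in> L2" "v \<in> L2" shows "(\<lambda>x. u x - v x) \<in> L2"
  using L2_add[OF assms(1) L2_minus[OF assms(2)]] by simp

lemma L2_zero: "(\<lambda>x. 0) \<in> L2" by (simp add: L2_def)

lemma L2_sum: "(\<And>i. i \<in> F \<Longrightarrow> u i \<in> L2) \<Longrightarrow> (\<lambda>x. \<Sum>i\<in>F. u i x) \<in> L2"
proof (induction F rule: infinite_finite_induct)
  case (insert i F) then show ?case using L2_add[of "u i" "\<lambda>x. \<Sum>i\<in>F. u i x"] by simp
qed (simp_all add: L2_zero)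

lemma L2_bound:
  assumes "u \<in> L2" "v \<in> borel_measurable borel" "\<And>x. \<bar>v x\<bar> \<le> C * \<bar>u x\<bar>"
  shows "v \<in> L2"
proof -
  have "integrable lborel (\<lambda>x. C\<^sup>2 * (u x)\<^sup>2)" using L2_sq[OF assms(1)] by simp
  then have "integrable lborel (\<lambda>x. (v x)\<^sup>2)"
  proof (rule Bochner_Integration.integrable_bound)
    show "AE x in lborel. norm ((v x)\<^sup>2) \<le> norm (C\<^sup>2 * (u x)\<^sup>2)"
    proof (intro AE_I2)
      fix x have "\<bar>v x\<bar>\<^sup>2 \<le> (C * \<bar>u x\<bar>)\<^sup>2" using assms(3)[of x] by (intro power_mono) auto
      then show "norm ((v x)\<^sup>2) \<le> norm (C\<^sup>2 * (u x)\<^sup>2)" by (simp add: power_mult_distrib)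
    qed
  qed (use assms in measurable)
  then show ?thesis using assms by (simp add: L2_def)
qed

lemma ip_self: "ip u u = (LINT x|lborel. (u x)\<^sup>2)"
  by (simp add: ip_def power2_eq_square)

lemma ip_self_nonneg: "0 \<le> ip u u"
  by (simp add: ip_self)

lemma ip_commute: "ip u v = ip v u"
  by (simp add: ip_def mult.commute)

lemma ip_add_left: "u \<in> L2 \<Longrightarrow> v \<in> L2 \<Longrightarrow> w \<in> L2 \<Longrightarrow> ip (\<lambda>x. u x + v x) w = ip u w + ip v w"
  unfolding ip_def by (simp add: distrib_right L2_mult_integrable)

lemma ip_add_right: "u \<in> L2 \<Longrightarrow> v \<in> L2 \<Longrightarrow> w \<in> L2 \<Longrightarrow> ip w (\<lambda>x. u x + v x) = ip w u + ip w v"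
  unfolding ip_def by (simp add: distrib_left L2_mult_integrable)

lemma ip_cmult_left: "ip (\<lambda>x. c * u x) w = c * ip u w"
  unfolding ip_def by (simp add: mult.assoc)

lemma ip_cmult_right: "ip w (\<lambda>x. c * u x) = c * ip w u"
  by (subst (1 2) ip_commute) (rule ip_cmult_left)

lemma ip_diff_left: "u \<in> L2 \<Longrightarrow> v \<in> L2 \<Longrightarrow> w \<in> L2 \<Longrightarrow> ip (\<lambda>x. u x - v x) w = ip u w - ip v w"
  unfolding ip_def by (simp add: left_diff_distrib L2_mult_integrable)

lemma ip_diff_right: "u \<in> L2 \<Longrightarrow> v \<in> L2 \<Longrightarrow> w \<in> L2 \<Longrightarrow> ip w (\<lambda>x. u x - v x) = ip w u - ip w v"
  unfolding ip_def by (simp add: right_diff_distrib L2_mult_integrable)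

lemma ip_zero_left[simp]: "ip (\<lambda>x. 0) w = 0" by (simp add: ip_def)
lemma ip_zero_right[simp]: "ip w (\<lambda>x. 0) = 0" by (simp add: ip_def)

lemma ip_sum_left:
  "(\<And>i. i \<in> F \<Longrightarrow> u i \<in> L2) \<Longrightarrow> w \<in> L2 \<Longrightarrow> ip (\<lambda>x. \<Sum>i\<in>F. u i x) w = (\<Sum>i\<in>F. ip (u i) w)"
  by (induction F rule: infinite_finite_induct) (simp_all add: ip_add_left L2_sum)

lemma ip_sum_right:
  "(\<And>i. i \<in> F \<Longrightarrow> u i \<in> L2) \<Longrightarrow> w \<in> L2 \<Longrightarrow> ip w (\<lambda>x. \<Sum>i\<in>F. u i x) = (\<Sum>i\<in>F. ip w (u i))"
  using ip_sum_left[of F u w] by (simp add: ip_commute[of w])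

lemma ip_cong_AE:
  assumes "u \<in> borel_measurable borel" "u' \<in> borel_measurable borel" "v \<in> borel_measurable borel"
    "v' \<in> borel_measurable borel"
    "AE x in lborel. u x = u' x" "AE x in lborel. v x = v' x"
  shows "ip u v = ip u' v'"
  unfolding ip_def by (rule integral_cong_AE) (use assms in auto)

lemma ip_add_self:
  "u \<in> L2 \<Longrightarrow> v \<in> L2 \<Longrightarrow> ip (\<lambda>x. u x + v x) (\<lambda>x. u x + v x) = ip u u + 2 * ip u v + ip v v"
  by (simp add: ip_add_left ip_add_right L2_add ip_commute[of v u])

lemma ip_diff_self:
  "u \<in> L2 \<Longrightarrow> v \<in> L2 \<Longrightarrow> ip (\<lambda>x. u x - v x) (\<lambda>x. u x - v x) = ip u u - 2 * ip u v + ip v v"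
  by (simp add: ip_diff_left ip_diff_right L2_diff ip_commute[of v u])

lemma ip_eq_0_AE:
  assumes "u \<in> L2" shows "ip u u = 0 \<longleftrightarrow> (AE x in lborel. u x = 0)"
  unfolding ip_self using integral_nonneg_eq_0_iff_AE[OF L2_sq[OF assms]] by simp

lemma ip_Cauchy_Schwarz:
  assumes "u \<in> L2" "v \<in> L2" shows "(ip u v)\<^sup>2 \<le> ip u u * ip v v"
proof (cases "ip v v = 0")
  case True
  then have "AE x in lborel. v x = 0" using ip_eq_0_AE assms by blast
  then have "ip u v = ip u (\<lambda>x. 0)"
    by (intro ip_cong_AE) (use assms in \<open>auto simp: L2_def\<close>)
  then show ?thesis using True by simp
next
  case False
  then have pos: "ip v v > 0" using ip_self_nonneg[of v] by simp
  define c where "c = ip u v / ip v v"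
  have "0 \<le> ip (\<lambda>x. u x - c * v x) (\<lambda>x. u x - c * v x)" by (rule ip_self_nonneg)
  also have "\<dots> = ip u u - 2 * (c * ip u v) + c * (c * ip v v)"
    using assms by (simp add: ip_diff_self L2_cmult ip_cmult_left ip_cmult_right)
  also have "c * ip v v = ip u v" using pos by (simp add: c_def)
  finally have "c * ip u v \<le> ip u u" by simp
  then show ?thesis using pos by (simp add: c_def power2_eq_square divide_le_eq)
qed

lemma ip_abs_le:
  assumes "u \<in> L2" "v \<in> L2" shows "\<bar>ip u v\<bar> \<le> sqrt (ip u u) * sqrt (ip v v)"
  using real_sqrt_le_mono[OF ip_Cauchy_Schwarz[OF assms]] by (simp add: real_sqrt_mult)

section \<open>Orthonormal families and Bessel's inequality\<close>

definition orthonormal_on :: "'i set \<Rightarrow> ('i \<Rightarrow> 'a::euclidean_space \<Rightarrow> real) \<Rightarrow> bool" where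
  "orthonormal_on F u \<longleftrightarrow> (\<forall>i\<in>F. u i \<in> L2) \<and> (\<forall>i\<in>F. \<forall>j\<in>F. ip (u i) (u j) = (if i = j then 1 else 0))"

lemma orthonormal_on_subset: "orthonormal_on F u \<Longrightarrow> G \<subseteq> F \<Longrightarrow> orthonormal_on G u"
  unfolding orthonormal_on_def by (meson subsetD)

lemma orthonormal_onD: "orthonormal_on F u \<Longrightarrow> i \<in> F \<Longrightarrow> u i \<in> L2"
  by (auto simp: orthonormal_on_def)

lemma ip_sum_orthonormal:
  assumes "orthonormal_on F u" "finite F" "j \<in> F"
  shows "ip (\<lambda>x. \<Sum>i\<in>F. c i * u i x) (u j) = c j"
proof -
  have "ip (\<lambda>x. \<Sum>i\<in>F. c i * u i x) (u j) = (\<Sum>i\<in>F. ip (\<lambda>x. c i * u i x) (u j))"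
    using assms by (intro ip_sum_left L2_cmult) (auto simp: orthonormal_on_def)
  also have "\<dots> = (\<Sum>i\<in>F. if i = j then c j else 0)"
    using assms by (intro sum.cong) (auto simp: orthonormal_on_def ip_cmult_left)
  finally show ?thesis using assms by simp
qed

lemma Bessel_inequality:
  assumes "orthonormal_on F u" "finite F" "f \<in> L2"
  shows "(\<Sum>i\<in>F. (ip f (u i))\<^sup>2) \<le> ip f f"
proof -
  define g where "g = (\<lambda>x. \<Sum>i\<in>F. ip f (u i) * u i x)"
  have g: "g \<in> L2" unfolding g_def using assms by (intro L2_sum L2_cmult) (auto simp: orthonormal_on_def)
  have *: "ip h g = (\<Sum>i\<in>F. ip f (u i) * ip h (u i))" if "h \<in> L2" for h
    unfolding g_def using assms that
    by (subst ip_sum_right) (auto intro!: L2_cmult simp: orthonormal_on_def ip_cmult_right)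
  have "ip g g = (\<Sum>i\<in>F. ip f (u i) * ip g (u i))" by (rule *[OF g])
  also have "\<dots> = (\<Sum>i\<in>F. (ip f (u i))\<^sup>2)"
    unfolding g_def by (intro sum.cong) (simp_all add: ip_sum_orthonormal[OF assms(1,2)] power2_eq_square)
  finally have gg: "ip g g = (\<Sum>i\<in>F. (ip f (u i))\<^sup>2)" .
  have fg: "ip f g = (\<Sum>i\<in>F. (ip f (u i))\<^sup>2)" using *[OF assms(3)] by (simp add: power2_eq_square)
  have "0 \<le> ip (\<lambda>x. f x - g x) (\<lambda>x. f x - g x)" by (rule ip_self_nonneg)
  also have "\<dots> = ip f f - (\<Sum>i\<in>F. (ip f (u i))\<^sup>2)" using assms g gg fg by (simp add: ip_diff_self)
  finally show ?thesis by simp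
qed

section \<open>Test functions\<close>

text \<open>An existentially quantified derivative, rather than \<open>deriv\<close>, makes the
  closure properties below plain inductions; \<open>Ck_tensor\<close> converts the result into
  \<open>Ck\<close>.\<close>

primrec diffn :: "nat \<Rightarrow> (real \<Rightarrow> real) \<Rightarrow> bool" where
  "diffn 0 f \<longleftrightarrow> continuous_on UNIV f"
| "diffn (Suc k) f \<longleftrightarrow> (\<exists>f'. (\<forall>x. (f has_real_derivative f' x) (at x)) \<and> diffn k f')"

lemma diffn_Suc_imp: "diffn (Suc k) f \<Longrightarrow> diffn k f"
proof (induction k arbitrary: f)
  case 0 then show ?case
    by (auto intro!: continuous_at_imp_continuous_on dest: DERIV_isCont)
next
  case (Suc k) then show ?case by (metis diffn.simps(2))
qed

lemma diffn_add: "diffn k f \<Longrightarrow> diffn k g \<Longrightarrow> diffn k (\<lambda>x. f x + g x)"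
proof (induction k arbitrary: f g)
  case 0 then show ?case by (auto intro: continuous_intros)
next
  case (Suc k)
  then obtain f' g' where "\<forall>x. (f has_real_derivative f' x) (at x)" "diffn k f'"
    "\<forall>x. (g has_real_derivative g' x) (at x)" "diffn k g'" by auto
  then show ?case using Suc.IH[of f' g'] by (auto intro!: exI[of _ "\<lambda>x. f' x + g' x"] derivative_intros)
qed

lemma diffn_mult: "diffn k f \<Longrightarrow> diffn k g \<Longrightarrow> diffn k (\<lambda>x. f x * g x)"
proof (induction k arbitrary: f g)
  case 0 then show ?case by (auto intro: continuous_intros)
next
  case (Suc k)
  then obtain f' g' where d: "\<forall>x. (f has_real_derivative f' x) (at x)" "diffn k f'"
    "\<forall>x. (g has_real_derivative g' x) (at x)" "diffn k g'" by auto
  have "diffn k f" "diffn k g" using Suc.prems diffn_Suc_imp by blast+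
  then have "diffn k (\<lambda>x. f' x * g x + g' x * f x)"
    using d Suc.IH by (intro diffn_add) auto
  moreover have "\<forall>x. ((\<lambda>x. f x * g x) has_real_derivative f' x * g x + g' x * f x) (at x)"
    using d by (auto intro!: derivative_eq_intros simp: algebra_simps)
  ultimately show ?case by auto
qed

lemma diffn_const: "diffn k (\<lambda>x. c)"
proof (induction k arbitrary: c)
  case (Suc k) then show ?case by (auto intro!: exI[of _ "\<lambda>x. 0"] derivative_intros)
qed simp

lemma diffn_affine: "diffn k f \<Longrightarrow> diffn k (\<lambda>x. f (c * x + b))"
proof (induction k arbitrary: f)
  case 0 then show ?case by (auto intro!: continuous_intros continuous_on_compose2[of UNIV f])
next
  case (Suc k)
  then obtain f' where d: "\<forall>x. (f has_real_derivative f' x) (at x)" "diffn k f'" by auto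
  have "((\<lambda>x. f (c * x + b)) has_real_derivative f' (c * x + b) * c) (at x)" for x
    by (rule DERIV_chain2[of f]) (use d in \<open>auto intro!: derivative_eq_intros\<close>)
  moreover have "diffn k (\<lambda>x. f' (c * x + b) * c)"
    by (intro diffn_mult diffn_const Suc.IH d)
  ultimately show ?case by (auto intro!: exI[of _ "\<lambda>x. f' (c * x + b) * c"])
qed

text \<open>The function exp(-1/x) alone does not reproduce itself under differentiation. With y =
  1/x the derivative has the polynomial y^2 (q - q') in place of q, so admitting all polynomials
  reduces smoothness to one short induction.\<close>

definition flat_exp :: "real poly \<Rightarrow> real \<Rightarrow> real" where
  "flat_exp q x = (if x > 0 then poly q (1 / x) * exp (- (1 / x)) else 0)"

lemma poly_times_exp_neg_tendsto_0:
  fixes q :: "real poly" shows "((\<lambda>y. poly q y * exp (- y)) \<longlongrightarrow> 0) at_top"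
proof -
  have "((\<lambda>y. \<Sum>i\<le>degree q. coeff q i * (y ^ i / exp y)) \<longlongrightarrow> (\<Sum>i\<le>degree q. coeff q i * 0)) at_top"
    by (intro tendsto_sum tendsto_mult tendsto_const tendsto_power_div_exp_0)
  then show ?thesis
    by (simp add: poly_altdef exp_minus divide_inverse sum_distrib_right mult.assoc)
qed

lemma flat_exp_deriv:
  "(flat_exp q has_real_derivative flat_exp (monom 1 2 * (q - pderiv q)) x) (at x)"
proof -
  consider "x > 0" | "x < 0" | "x = 0" by linarith
  then show ?thesis
  proof cases
    case 1
    have "((\<lambda>x. poly q (1 / x) * exp (- (1 / x))) has_real_derivative
       flat_exp (monom 1 2 * (q - pderiv q)) x) (at x)"
      using 1 by (auto intro!: derivative_eq_intros DERIV_chain2[OF poly_DERIV]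
        simp: flat_exp_def poly_monom field_simps power2_eq_square)
    then show ?thesis
      by (rule has_field_derivative_transform_within_open[where S="{0<..}"])
         (use 1 in \<open>auto simp: flat_exp_def\<close>)
  next
    case 2
    have "((\<lambda>x. 0) has_real_derivative flat_exp (monom 1 2 * (q - pderiv q)) x) (at x)"
      using 2 by (auto simp: flat_exp_def)
    then show ?thesis
      by (rule has_field_derivative_transform_within_open[where S="{..<0}"])
         (use 2 in \<open>auto simp: flat_exp_def\<close>)
  next
    case 3
    \<comment> \<open>The 1/h of the difference quotient is absorbed by \<open>pCons 0 q\<close>,
      which multiplies the polynomial by its argument.\<close>
    have "((\<lambda>y. poly (pCons 0 q) y * exp (- y)) \<longlongrightarrow> 0) at_top"
      by (rule poly_times_exp_neg_tendsto_0)
    then have "((\<lambda>h. poly (pCons 0 q) (inverse h) * exp (- inverse h)) \<longlongrightarrow> 0) (at_right 0)"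
      by (rule filterlim_compose) (rule filterlim_inverse_at_top_right)
    moreover have "\<forall>\<^sub>F h in at_right 0. poly (pCons 0 q) (inverse h) * exp (- inverse h) =
       (flat_exp q (0 + h) - flat_exp q 0) / h"
      unfolding eventually_at_right_field by (auto simp: flat_exp_def field_simps intro!: exI[of _ 1])
    ultimately have r: "((\<lambda>h. (flat_exp q (0 + h) - flat_exp q 0) / h) \<longlongrightarrow> 0) (at_right 0)"
      by (rule Lim_transform_eventually)
    have "\<forall>\<^sub>F h in at_left 0. 0 = (flat_exp q (0 + h) - flat_exp q 0) / h"
      unfolding eventually_at_left_field by (auto simp: flat_exp_def intro!: exI[of _ "-1"])
    then have l: "((\<lambda>h. (flat_exp q (0 + h) - flat_exp q 0) / h) \<longlongrightarrow> 0) (at_left 0)"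
      by (rule Lim_transform_eventually[OF tendsto_const])
    have "((\<lambda>h. (flat_exp q (0 + h) - flat_exp q 0) / h) \<longlongrightarrow> 0) (at 0)"
      using l r by (simp add: filterlim_split_at)
    then show ?thesis using 3 by (simp add: DERIV_def flat_exp_def)
  qed
qed

lemma diffn_flat_exp: "diffn k (flat_exp q)"
proof (induction k arbitrary: q)
  case 0
  show ?case by (auto intro!: continuous_at_imp_continuous_on DERIV_isCont flat_exp_deriv)
next
  case (Suc k) then show ?case using flat_exp_deriv by auto
qed

text \<open>The factor n + 1 steepens both flanks without moving the support, so the bumps approach
  the indicator of the open interval from below.\<close>

definition bump :: "real \<Rightarrow> real \<Rightarrow> nat \<Rightarrow> real \<Rightarrow> real" where
  "bump a b n x = flat_exp 1 (real (Suc n) * (x - a)) * flat_exp 1 (real (Suc n) * (b - x))"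

lemma diffn_bump: "diffn k (bump a b n)"
proof -
  have "diffn k (\<lambda>x. flat_exp 1 (real (Suc n) * x + - real (Suc n) * a) *
     flat_exp 1 (- real (Suc n) * x + real (Suc n) * b))"
    by (intro diffn_mult diffn_affine diffn_flat_exp)
  then show ?thesis by (simp add: bump_def[abs_def] algebra_simps)
qed

lemma flat_exp_1_bounds: "0 \<le> flat_exp 1 x" "flat_exp 1 x \<le> 1"
  by (auto simp: flat_exp_def)

lemma bump_nonneg: "0 \<le> bump a b n x"
  by (simp add: bump_def flat_exp_1_bounds)

lemma bump_le_indicator: "bump a b n x \<le> indicator {a<..<b} x"
proof (cases "a < x \<and> x < b")
  case True then show ?thesis by (auto simp: bump_def flat_exp_1_bounds mult_le_one)
next
  case False
  then have "real (Suc n) * (x - a) \<le> 0 \<or> real (Suc n) * (b - x) \<le> 0"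
    by (auto simp: mult_le_0_iff)
  then have "bump a b n x = 0" by (auto simp: bump_def flat_exp_def)
  then show ?thesis by simp
qed

lemma flat_exp_scaled_tendsto: "0 < y \<Longrightarrow> (\<lambda>n. flat_exp 1 (real (Suc n) * y)) \<longlonglongrightarrow> 1"
proof -
  assume y: "0 < y"
  have "(\<lambda>n. exp (- (inverse (real (Suc n)) * (1 / y)))) \<longlonglongrightarrow> exp (- (0 * (1 / y)))"
    by (intro tendsto_intros LIMSEQ_inverse_real_of_nat)
  moreover have "flat_exp 1 (real (Suc n) * y) = exp (- (inverse (real (Suc n)) * (1 / y)))" for n
    using y by (simp add: flat_exp_def field_simps del: of_nat_Suc)
  ultimately show ?thesis by simp
qed

lemma bump_tendsto: "(\<lambda>n. bump a b n x) \<longlonglongrightarrow> indicator {a<..<b} x"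
proof (cases "a < x \<and> x < b")
  case True
  then have "(\<lambda>n. bump a b n x) \<longlonglongrightarrow> 1 * 1"
    unfolding bump_def by (intro tendsto_mult flat_exp_scaled_tendsto) auto
  then show ?thesis using True by simp
next
  case False
  then have "bump a b n x = 0" for n
    using bump_le_indicator[of a b n x] bump_nonneg[of a b n x] by auto
  then show ?thesis using False by simp
qed

text \<open>Along an axis only one factor varies, so a partial derivative of a product of
  one-dimensional functions is again such a product; the induction in \<open>Ck_tensor\<close> runs
  on this.\<close>

lemma tensor_line_deriv:
  fixes f :: "'d::finite \<Rightarrow> real \<Rightarrow> real"
  assumes "\<And>x. (f i has_real_derivative f' x) (at x)"
  shows "((\<lambda>t. \<Prod>j\<in>UNIV. f j ((x + t *\<^sub>R axis i 1) $ j)) has_real_derivative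
     (\<Prod>j\<in>UNIV. (f(i := f')) j (x $ j))) (at 0)"
proof -
  have eq: "(\<Prod>j\<in>UNIV. f j ((x + t *\<^sub>R axis i 1) $ j)) =
      f i (x $ i + t) * (\<Prod>j\<in>UNIV - {i}. f j (x $ j))" for t
    by (subst prod.remove[of _ i]) (auto simp: axis_def intro!: prod.cong)
  have eq2: "(\<Prod>j\<in>UNIV. (f(i := f')) j (x $ j)) = f' (x $ i) * (\<Prod>j\<in>UNIV - {i}. f j (x $ j))"
    by (subst prod.remove[of _ i]) (auto intro!: prod.cong)
  have "((\<lambda>t. f i (x $ i + t)) has_real_derivative f' (x $ i)) (at 0)"
    using assms[of "x $ i"] DERIV_shift[of "f i" "f' (x $ i)" 0 "x $ i"] by (simp add: add.commute)
  then show ?thesis unfolding eq eq2 by (rule DERIV_cmult_right)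
qed

lemma Ck_tensor:
  "(\<And>i. diffn k (f i)) \<Longrightarrow> Ck k (\<lambda>x::real^'d. \<Prod>i\<in>UNIV. f i (x $ i))"
proof (induction k arbitrary: f)
  case 0
  have "continuous_on UNIV (\<lambda>x::real^'d. f i (x $ i))" for i
    by (rule continuous_on_compose2[of UNIV "f i"])
       (use 0[of i] in \<open>simp_all add: continuous_on_component\<close>)
  then show ?case by (simp add: continuous_on_prod)
next
  case (Suc k)
  have "\<forall>i. \<exists>f'. (\<forall>x. (f i has_real_derivative f' x) (at x)) \<and> diffn k f'"
    using Suc.prems by simp
  then obtain f' where f': "\<And>i x. (f i has_real_derivative f' i x) (at x)" "\<And>i. diffn k (f' i)"
    by metis
  have D: "((\<lambda>t. \<Prod>j\<in>UNIV. f j ((x + t *\<^sub>R axis i 1) $ j)) has_real_derivative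
     (\<Prod>j\<in>UNIV. (f(i := f' i)) j (x $ j))) (at 0)" for i and x :: "real^'d"
    by (rule tensor_line_deriv) (rule f')
  have "partial i (\<lambda>x::real^'d. \<Prod>i\<in>UNIV. f i (x $ i)) =
      (\<lambda>x. \<Prod>j\<in>UNIV. (f(i := f' i)) j (x $ j))" for i
    unfolding partial_def using D[THEN DERIV_imp_deriv] by (intro ext)
  moreover have "Ck k (\<lambda>x::real^'d. \<Prod>j\<in>UNIV. (f(i := f' i)) j (x $ j))" for i
    by (rule Suc.IH) (use f' Suc.prems diffn_Suc_imp in auto)
  moreover have "(\<lambda>t. \<Prod>j\<in>UNIV. f j ((x + t *\<^sub>R axis i 1) $ j)) field_differentiable at 0"
    for i and x :: "real^'d" using D[of x i] unfolding field_differentiable_def by blast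
  ultimately show ?case by (simp only: Ck.simps) blast
qed

definition box_bump :: "real^'d \<Rightarrow> real^'d \<Rightarrow> nat \<Rightarrow> real^'d \<Rightarrow> real" where
  "box_bump a b n x = (\<Prod>i\<in>UNIV. bump (a $ i) (b $ i) n (x $ i))"

lemma indicator_box_prod:
  "(\<Prod>i\<in>UNIV. indicator {a $ i<..<b $ i} (x $ i)) = (indicator (box a b) x :: real)"
  for a b x :: "real^'d"
proof (cases "x \<in> box a b")
  case True then show ?thesis by (auto simp: mem_box_cart)
next
  case False
  then obtain i where "x $ i \<notin> {a $ i<..<b $ i}" by (auto simp: mem_box_cart)
  then have "(\<Prod>i\<in>UNIV. indicator {a $ i<..<b $ i} (x $ i)) = (0::real)"
    by (intro prod_zero bexI[of _ i]) auto
  then show ?thesis using False by simp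
qed

lemma box_bump_bounds: "0 \<le> box_bump a b n x" "box_bump a b n x \<le> indicator (box a b) x"
proof -
  show "0 \<le> box_bump a b n x" unfolding box_bump_def by (intro prod_nonneg) (auto simp: bump_nonneg)
  show "box_bump a b n x \<le> indicator (box a b) x"
    unfolding box_bump_def indicator_box_prod[symmetric]
    by (intro prod_mono) (auto simp: bump_nonneg bump_le_indicator)
qed

lemma box_bump_tendsto: "(\<lambda>n. box_bump a b n x) \<longlonglongrightarrow> indicator (box a b) x"
  unfolding box_bump_def indicator_box_prod[symmetric] by (intro tendsto_prod bump_tendsto)

lemma test_function_box_bump: "test_function (box_bump a b n)"
proof -
  have "Ck k (box_bump a b n)" for k
    unfolding box_bump_def[abs_def] by (intro Ck_tensor diffn_bump)
  moreover have "{x. box_bump a b n x \<noteq> 0} \<subseteq> box a b"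
  proof
    fix x assume "x \<in> {x. box_bump a b n x \<noteq> 0}"
    then show "x \<in> box a b" using box_bump_bounds[of a b n x] by (cases "x \<in> box a b") auto
  qed
  then have "bounded {x. box_bump a b n x \<noteq> 0}"
    by (rule bounded_subset[OF bounded_box])
  ultimately show ?thesis by (simp add: test_function_def)
qed

section \<open>Supports, bounds and translates of test functions\<close>

lemma test_function_continuous: "test_function \<phi> \<Longrightarrow> continuous_on UNIV \<phi>"
  unfolding test_function_def by (metis Ck.simps(1))

lemma test_function_measurable[measurable_dest]: "test_function \<phi> \<Longrightarrow> \<phi> \<in> borel_measurable borel"
  by (rule borel_measurable_continuous_onI[OF test_function_continuous])

lemma test_function_support:
  assumes "test_function \<phi>" obtains R where "R > 0" "\<And>x. norm x > R \<Longrightarrow> \<phi> x = 0"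
proof -
  have "bounded {x. \<phi> x \<noteq> 0}" using assms by (simp add: test_function_def)
  then obtain R where "R > 0" "\<forall>x\<in>{x. \<phi> x \<noteq> 0}. norm x \<le> R" using bounded_pos by blast
  then show thesis by (intro that[of R]) (auto simp: not_le[symmetric])
qed

lemma test_function_bounded:
  assumes "test_function \<phi>" obtains B where "B > 0" "\<And>x. \<bar>\<phi> x\<bar> \<le> B"
proof -
  have "compact (\<phi> ` closure {x. \<phi> x \<noteq> 0})"
    using assms test_function_continuous[OF assms]
    by (intro compact_continuous_image) (auto simp: test_function_def intro: continuous_on_subset)
  then have "bounded (\<phi> ` closure {x. \<phi> x \<noteq> 0})" by (rule compact_imp_bounded)
  then obtain B where B: "B > 0" "\<forall>y\<in>\<phi> ` closure {x. \<phi> x \<noteq> 0}. norm y \<le> B" using bounded_pos by blast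
  have "\<bar>\<phi> x\<bar> \<le> B" for x
  proof (cases "\<phi> x = 0")
    case False
    then have "x \<in> closure {x. \<phi> x \<noteq> 0}" by (intro closure_subset[THEN subsetD]) simp
    then show ?thesis using B by auto
  qed (use B in auto)
  then show thesis using B by (intro that)
qed

lemma L2_indicator_cball: "(\<lambda>x::'a::euclidean_space. c * indicator (cball y R) x) \<in> L2"
proof -
  have "integrable lborel (\<lambda>x::'a. indicator (cball y R) x * c\<^sup>2)"
    by (intro integrable_mult_left integrable_real_indicator) (use emeasure_lborel_cball_finite in auto)
  moreover have "(c * indicator (cball y R) x)\<^sup>2 = indicator (cball y R) x * c\<^sup>2" for x :: 'a
    by (simp add: indicator_def)
  moreover have "(\<lambda>x::'a. c * indicator (cball y R) x) \<in> borel_measurable borel"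
    by (intro borel_measurable_times borel_measurable_const borel_measurable_indicator) simp
  ultimately show ?thesis by (simp add: L2_def)
qed

lemma test_function_L2:
  assumes "test_function \<phi>" shows "\<phi> \<in> L2"
proof -
  obtain R where R: "R > 0" "\<And>x. norm x > R \<Longrightarrow> \<phi> x = 0" using test_function_support[OF assms] by metis
  obtain B where B: "B > 0" "\<And>x. \<bar>\<phi> x\<bar> \<le> B" using test_function_bounded[OF assms] by metis
  show ?thesis
  proof (rule L2_bound[OF L2_indicator_cball[of B 0 R]])
    show "\<phi> \<in> borel_measurable borel" using test_function_measurable[OF assms] .
    fix x show "\<bar>\<phi> x\<bar> \<le> 1 * \<bar>B * indicator (cball 0 R) x\<bar>"
      using R(2)[of x] B by (cases "norm x \<le> R") (auto simp: indicator_def)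
  qed
qed

text \<open>Off the closed support the function vanishes near the point, hence so does its
  derivative: differentiation does not enlarge the support.\<close>

lemma test_function_partial:
  assumes "test_function \<phi>" shows "test_function (partial i \<phi>)"
proof -
  have "Ck k (partial i \<phi>)" for k
    using assms unfolding test_function_def by (metis Ck.simps(2))
  moreover have "{x. partial i \<phi> x \<noteq> 0} \<subseteq> closure {x. \<phi> x \<noteq> 0}"
  proof (rule ccontr)
    assume "\<not> ?thesis"
    then obtain x where x: "partial i \<phi> x \<noteq> 0" "x \<in> - closure {x. \<phi> x \<noteq> 0}" by auto
    have "open (- closure {x. \<phi> x \<noteq> 0})" by (intro open_Compl closed_closure)
    then have "open ((\<lambda>t. x + t *\<^sub>R axis i 1) -` (- closure {x. \<phi> x \<noteq> 0}))"
      by (intro open_vimage) (auto intro!: continuous_intros)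
    moreover have "0 \<in> (\<lambda>t. x + t *\<^sub>R axis i 1) -` (- closure {x. \<phi> x \<noteq> 0})" using x by simp
    moreover have "((\<lambda>t::real. 0::real) has_real_derivative 0) (at 0)" by simp
    ultimately have "((\<lambda>t. \<phi> (x + t *\<^sub>R axis i 1)) has_real_derivative 0) (at 0)"
      using closure_subset[of "{x. \<phi> x \<noteq> 0}"]
      by (rule_tac has_field_derivative_transform_within_open[of "\<lambda>t. 0"]) auto
    then have "partial i \<phi> x = 0" unfolding partial_def by (rule DERIV_imp_deriv)
    then show False using x by simp
  qed
  then have "closure {x. partial i \<phi> x \<noteq> 0} \<subseteq> closure {x. \<phi> x \<noteq> 0}"
    by (rule closure_minimal) simp
  then have "compact (closure {x. partial i \<phi> x \<noteq> 0})"
    using assms by (metis closed_closure compact_Int_closed inf.absorb2 test_function_def)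
  ultimately show ?thesis by (simp add: test_function_def)
qed

lemma partial_translate: "partial i (\<lambda>x. \<phi> (x + z)) = (\<lambda>x. partial i \<phi> (x + z))"
  unfolding partial_def by (simp add: algebra_simps)

lemma Ck_translate: "Ck k \<phi> \<Longrightarrow> Ck k (\<lambda>x. \<phi> (x + z))"
proof (induction k arbitrary: \<phi>)
  case 0 then show ?case by (auto intro!: continuous_intros continuous_on_compose2[of UNIV \<phi>])
next
  case (Suc k)
  have "(\<lambda>t. \<phi> (x + t *\<^sub>R axis i 1 + z)) field_differentiable at 0" for i x
  proof -
    have "(\<lambda>t. \<phi> ((x + z) + t *\<^sub>R axis i 1)) field_differentiable at 0" using Suc.prems by simp
    then show ?thesis by (simp add: algebra_simps)
  qed
  then show ?case using Suc by (simp add: partial_translate)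
qed

lemma test_function_translate:
  assumes "test_function \<phi>" shows "test_function (\<lambda>x. \<phi> (x + z))"
proof -
  obtain R where R: "R > 0" "\<And>x. norm x > R \<Longrightarrow> \<phi> x = 0" using test_function_support[OF assms] by metis
  have "norm x \<le> R + norm z" if "\<phi> (x + z) \<noteq> 0" for x
  proof -
    have "norm (x + z) \<le> R" using that R(2)[of "x + z"] by (cases "norm (x + z) \<le> R") auto
    then show ?thesis using norm_triangle_ineq4[of "x + z" z] by simp
  qed
  then have "bounded {x. \<phi> (x + z) \<noteq> 0}" by (auto simp: bounded_iff)
  then show ?thesis using assms Ck_translate by (auto simp: test_function_def)
qed

lemma test_function_line_deriv:
  assumes "test_function \<phi>"
  shows "((\<lambda>t. \<phi> (x + t *\<^sub>R axis i 1)) has_real_derivative partial i \<phi> (x + s *\<^sub>R axis i 1)) (at s)"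
proof -
  have "Ck (Suc 0) \<phi>" using assms by (simp add: test_function_def del: Ck.simps)
  then have "(\<lambda>t. \<phi> ((x + s *\<^sub>R axis i 1) + t *\<^sub>R axis i 1)) field_differentiable at 0" by simp
  then have "((\<lambda>t. \<phi> ((x + s *\<^sub>R axis i 1) + t *\<^sub>R axis i 1)) has_real_derivative
     partial i \<phi> (x + s *\<^sub>R axis i 1)) (at 0)"
    unfolding partial_def by (simp add: DERIV_deriv_iff_field_differentiable)
  then have "((\<lambda>t. \<phi> (x + (t + s) *\<^sub>R axis i 1)) has_real_derivative
     partial i \<phi> (x + s *\<^sub>R axis i 1)) (at 0)"
    by (simp add: algebra_simps)
  then show ?thesis
    using DERIV_shift[of "\<lambda>t. \<phi> (x + t *\<^sub>R axis i 1)" _ 0 s] by simp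
qed

section \<open>Fundamental lemma of the calculus of variations\<close>

text \<open>Positive and negative part of w are densities of two measures that agree on boxes, an
  intersection-stable generator with finite values on an exhaustion. The measures coincide, hence so
  do the two parts, and at each point one of them is 0.\<close>

lemma AE_eq_0_if_box_integrals_0:
  fixes w :: "'a::euclidean_space \<Rightarrow> real"
  assumes w: "w \<in> L2" and 0: "\<And>a b. (LINT x|lborel. w x * indicator (box a b) x) = 0"
  shows "AE x in lborel. w x = 0"
proof -
  have [measurable]: "w \<in> borel_measurable borel" using w by measurable
  define M where "M = (\<lambda>s::real. density lborel (\<lambda>x::'a. ennreal (s * w x)))"
  have ib: "indicator (box a b) \<in> (L2 :: ('a \<Rightarrow> real) set)" for a b
  proof -
    obtain R where R: "box a b \<subseteq> cball 0 R"
      using bounded_subset_ballD[OF bounded_box, of a b 0] ball_subset_cball by blast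
    show ?thesis
      by (rule L2_bound[OF L2_indicator_cball[of 1 0 R], where C=1])
         (use R in \<open>auto simp: indicator_def\<close>)
  qed
  have int: "integrable lborel (\<lambda>x. w x * indicator (box a b) x)" for a b
    by (rule L2_mult_integrable[OF w ib])
  have em: "emeasure (M s) (box a b) = ennreal (LINT x|lborel. max 0 (s * w x) * indicator (box a b) x)"
    for s a b
  proof -
    have "emeasure (M s) (box a b) = (\<integral>\<^sup>+x. ennreal (max 0 (s * w x) * indicator (box a b) x) \<partial>lborel)"
      unfolding M_def by (subst emeasure_density)
        (auto intro!: nn_integral_cong simp: indicator_def max_def ennreal_neg)
    also have "\<dots> = ennreal (LINT x|lborel. max 0 (s * w x) * indicator (box a b) x)"
    proof (rule nn_integral_eq_integral)
      show "integrable lborel (\<lambda>x. max 0 (s * w x) * indicator (box a b) x)"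
        by (rule Bochner_Integration.integrable_bound[OF integrable_mult_right[OF int[of a b], of s]])
           (auto simp: indicator_def abs_mult[symmetric])
    qed auto
    finally show ?thesis .
  qed
  have "M 1 = M (-1)"
  proof (rule measure_eqI_generator_eq[where E="range (\<lambda>(a, b). box a b)" and \<Omega>=UNIV and
        A="\<lambda>n::nat. box (- (real n *\<^sub>R One)) (real n *\<^sub>R One)"])
    show "Int_stable (range (\<lambda>(a, b). box a b))" by (auto simp: Int_stable_def box_Int_box)
    show "sets (M 1) = sigma_sets UNIV (range (\<lambda>(a, b). box a b))"
      by (simp add: M_def borel_eq_box)
    show "sets (M (-1)) = sigma_sets UNIV (range (\<lambda>(a, b). box a b))"
      by (simp add: M_def borel_eq_box)
    show "emeasure (M 1) X = emeasure (M (- 1)) X" if X: "X \<in> range (\<lambda>(a, b). box a b)" for X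
    proof -
      obtain a b where ab: "X = box a b" using X by auto
      have i: "integrable lborel (\<lambda>x. max 0 (s * w x) * indicator (box a b) x)" for s
        by (rule Bochner_Integration.integrable_bound[OF integrable_mult_right[OF int[of a b], of s]])
           (auto simp: indicator_def abs_mult[symmetric])
      have "(LINT x|lborel. max 0 (1 * w x) * indicator (box a b) x) -
         (LINT x|lborel. max 0 (- 1 * w x) * indicator (box a b) x) =
         (LINT x|lborel. w x * indicator (box a b) x)"
        by (subst Bochner_Integration.integral_diff[OF i i, symmetric])
           (auto intro!: Bochner_Integration.integral_cong simp: max_def indicator_def)
      then show ?thesis unfolding ab em using 0[of a b] by simp
    qed
    show "range (\<lambda>n. box (- (real n *\<^sub>R One)) (real n *\<^sub>R One)) \<subseteq> range (\<lambda>(a, b). box a b)" by auto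
    show "(\<Union>n. box (- (real n *\<^sub>R One)) (real n *\<^sub>R One)) = (UNIV :: 'a set)"
      by (rule UN_box_eq_UNIV)
    show "emeasure (M 1) (box (- (real n *\<^sub>R One)) (real n *\<^sub>R One)) \<noteq> \<infinity>" for n by (simp add: em)
  qed auto
  then have "AE x in lborel. ennreal (1 * w x) = ennreal (- 1 * w x)"
    unfolding M_def by (subst (asm) sigma_finite_measure.density_unique_iff[OF sigma_finite_lborel]) auto
  then show ?thesis
  proof eventually_elim
    case (elim x) then show ?case
      by (cases "w x \<ge> 0") (auto simp: ennreal_neg ennreal_eq_0_iff not_le dest: sym)
  qed
qed

text \<open>Bumps below the indicator of a box converge to it, so dominated convergence reduces the
  claim to integrals over boxes.\<close>

lemma fundamental_lemma:
  fixes w :: "real^'d \<Rightarrow> real"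
  assumes w: "w \<in> L2" and 0: "\<And>\<phi>. test_function \<phi> \<Longrightarrow> (LINT x|lborel. w x * \<phi> x) = 0"
  shows "AE x in lborel. w x = 0"
proof (rule AE_eq_0_if_box_integrals_0[OF w])
  fix a b :: "real^'d"
  have [measurable]: "w \<in> borel_measurable borel" using w by measurable
  obtain R where R: "box a b \<subseteq> cball 0 R"
    using bounded_subset_ballD[OF bounded_box, of a b 0] ball_subset_cball by blast
  have ib: "indicator (box a b) \<in> (L2 :: (real^'d \<Rightarrow> real) set)"
    by (rule L2_bound[OF L2_indicator_cball[of 1 0 R], where C=1])
       (use R in \<open>auto simp: indicator_def\<close>)
  have "(\<lambda>n. LINT x|lborel. w x * box_bump a b n x) \<longlonglongrightarrow> (LINT x|lborel. w x * indicator (box a b) x)"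
  proof (rule integral_dominated_convergence[where w="\<lambda>x. \<bar>w x * indicator (box a b) x\<bar>"])
    show "(\<lambda>x. w x * box_bump a b n x) \<in> borel_measurable lborel" for n
      using test_function_measurable[OF test_function_box_bump[of a b n]] by measurable
    show "integrable lborel (\<lambda>x. \<bar>w x * indicator (box a b) x\<bar>)"
      by (intro integrable_abs L2_mult_integrable w ib)
    show "AE x in lborel. (\<lambda>n. w x * box_bump a b n x) \<longlonglongrightarrow> w x * indicator (box a b) x"
      by (intro AE_I2 tendsto_mult tendsto_const box_bump_tendsto)
    show "AE x in lborel. norm (w x * box_bump a b n x) \<le> \<bar>w x * indicator (box a b) x\<bar>" for n
      using box_bump_bounds[of a b n] by (intro AE_I2) (auto simp: abs_mult intro!: mult_left_mono)
  qed measurable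
  then show "(LINT x|lborel. w x * indicator (box a b) x) = 0"
    using 0[OF test_function_box_bump] by (simp add: LIMSEQ_const_iff)
qed

section \<open>Weak derivatives and translations\<close>

lemma integral_translate:
  fixes f :: "'a::euclidean_space \<Rightarrow> real"
  assumes [measurable]: "f \<in> borel_measurable borel"
  shows "(LINT x|lborel. f (x + z)) = (LINT x|lborel. f x)"
proof -
  have "(LINT x|lborel. f x) = (LINT x|distr lborel borel ((+) z). f x)"
    by (simp add: lborel_distr_plus)
  also have "\<dots> = (LINT x|lborel. f (z + x))" by (rule integral_distr) auto
  finally show ?thesis by (simp add: add.commute)
qed

lemma integrable_translate:
  fixes f :: "'a::euclidean_space \<Rightarrow> real"
  assumes "integrable lborel f"
  shows "integrable lborel (\<lambda>x. f (x + z))"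
proof -
  have "integrable (distr lborel borel ((+) z)) f" using assms by (simp add: lborel_distr_plus)
  then have "integrable lborel (\<lambda>x. f (z + x))" by (subst (asm) integrable_distr_eq) (use assms in auto)
  then show ?thesis by (simp add: add.commute)
qed

lemma L2_translate:
  assumes "u \<in> L2" shows "(\<lambda>x. u (x + z)) \<in> L2"
  using integrable_translate[OF L2_sq[OF assms], of z] assms by (auto simp: L2_def)

lemma ip_translate:
  assumes [measurable]: "u \<in> borel_measurable borel" "v \<in> borel_measurable borel"
  shows "ip (\<lambda>x. u (x + z)) (\<lambda>x. v (x + z)) = ip u v"
  unfolding ip_def by (rule integral_translate[of "\<lambda>x. u x * v x" z]) measurable

definition nrm :: "('a::euclidean_space \<Rightarrow> real) \<Rightarrow> real" where "nrm u = sqrt (ip u u)"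

lemma nrm_nonneg: "0 \<le> nrm u" by (simp add: nrm_def ip_self_nonneg)

lemma nrm_sq: "(nrm u)\<^sup>2 = ip u u" by (simp add: nrm_def ip_self_nonneg)

lemma nrm_triangle:
  assumes "u \<in> L2" "v \<in> L2" shows "nrm (\<lambda>x. u x + v x) \<le> nrm u + nrm v"
proof (rule power2_le_imp_le)
  have "ip u v \<le> nrm u * nrm v" using ip_abs_le[OF assms] by (simp add: nrm_def)
  then show "(nrm (\<lambda>x. u x + v x))\<^sup>2 \<le> (nrm u + nrm v)\<^sup>2"
    by (simp add: power2_sum nrm_sq ip_add_self[OF assms])
qed (simp add: nrm_nonneg)

lemma indicator_power: "(indicator A x :: real)\<^sup>2 = indicator A x"
  by (simp add: indicator_def)

text \<open>Real counterpart of \<open>has_weak_partial\<close>. Since test functions are real, a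
  complex weak derivative is a pair of these, one for the real and one for the imaginary
  part.\<close>

definition wpd :: "'d \<Rightarrow> (real^'d \<Rightarrow> real) \<Rightarrow> (real^'d \<Rightarrow> real) \<Rightarrow> bool" where
  "wpd i u g \<longleftrightarrow> g \<in> L2 \<and> (\<forall>\<phi>. test_function \<phi> \<longrightarrow> ip u (partial i \<phi>) = - ip g \<phi>)"

lemma wpd_unique:
  assumes "wpd i u g" "wpd i u h" shows "AE x in lborel. g x = h x"
proof -
  have gh: "g \<in> L2" "h \<in> L2" using assms by (auto simp: wpd_def)
  have "AE x in lborel. g x - h x = 0"
  proof (rule fundamental_lemma)
    show "(\<lambda>x. g x - h x) \<in> L2" by (rule L2_diff[OF gh])
    fix \<phi> :: "real^'a \<Rightarrow> real" assume \<phi>: "test_function \<phi>"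
    have "ip (\<lambda>x. g x - h x) \<phi> = ip g \<phi> - ip h \<phi>" by (rule ip_diff_left[OF gh test_function_L2[OF \<phi>]])
    also have "\<dots> = 0" using assms \<phi> by (simp add: wpd_def)
    finally show "(LINT x|lborel. (g x - h x) * \<phi> x) = 0" by (simp add: ip_def)
  qed
  then show ?thesis by simp
qed

lemma wpd_add:
  assumes "wpd i u g" "wpd i v h" "u \<in> L2" "v \<in> L2"
  shows "wpd i (\<lambda>x. u x + v x) (\<lambda>x. g x + h x)"
  using assms by (auto simp: wpd_def L2_add ip_add_left test_function_L2 test_function_partial)

lemma wpd_cmult: "wpd i u g \<Longrightarrow> wpd i (\<lambda>x. c * u x) (\<lambda>x. c * g x)"
  by (auto simp: wpd_def L2_cmult ip_cmult_left)

definition H1r :: "(real^'d \<Rightarrow> real) set" where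
  "H1r = {u. u \<in> L2 \<and> (\<forall>i. \<exists>g. wpd i u g)}"

definition wd :: "'d \<Rightarrow> (real^'d \<Rightarrow> real) \<Rightarrow> real^'d \<Rightarrow> real" where
  "wd i u = (SOME g. wpd i u g)"

definition dform :: "(real^'d \<Rightarrow> real) \<Rightarrow> (real^'d \<Rightarrow> real) \<Rightarrow> real" where
  "dform u v = (\<Sum>i\<in>UNIV. ip (wd i u) (wd i v))"

lemma H1r_L2: "u \<in> H1r \<Longrightarrow> u \<in> L2" by (simp add: H1r_def)

lemma wpd_wd: "u \<in> H1r \<Longrightarrow> wpd i u (wd i u)"
  unfolding wd_def H1r_def by (metis (mono_tags, lifting) mem_Collect_eq someI_ex)

lemma wd_L2: "u \<in> H1r \<Longrightarrow> wd i u \<in> L2"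
  using wpd_wd[of u i] by (simp add: wpd_def)

lemma wd_eqI: "u \<in> H1r \<Longrightarrow> wpd i u g \<Longrightarrow> AE x in lborel. wd i u x = g x"
  using wpd_unique[OF wpd_wd] .

lemma H1r_add: assumes "u \<in> H1r" "v \<in> H1r" shows "(\<lambda>x. u x + v x) \<in> H1r"
proof -
  have "wpd i (\<lambda>x. u x + v x) (\<lambda>x. wd i u x + wd i v x)" for i
    by (intro wpd_add wpd_wd assms H1r_L2)
  then show ?thesis using assms by (auto simp: H1r_def L2_add)
qed

lemma H1r_cmult: assumes "u \<in> H1r" shows "(\<lambda>x. c * u x) \<in> H1r"
proof -
  have "wpd i (\<lambda>x. c * u x) (\<lambda>x. c * wd i u x)" for i by (intro wpd_cmult wpd_wd assms)
  then show ?thesis using assms by (auto simp: H1r_def L2_cmult)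
qed

lemma H1r_diff: "u \<in> H1r \<Longrightarrow> v \<in> H1r \<Longrightarrow> (\<lambda>x. u x - v x) \<in> H1r"
  using H1r_add[OF _ H1r_cmult[of v "-1"], of u] by simp

lemma H1r_zero: "(\<lambda>x. 0) \<in> H1r"
  by (auto simp: H1r_def L2_zero wpd_def intro!: exI[of _ "\<lambda>x. 0"])

lemma H1r_sum: "(\<And>i. i \<in> F \<Longrightarrow> u i \<in> H1r) \<Longrightarrow> (\<lambda>x. \<Sum>i\<in>F. u i x) \<in> H1r"
proof (induction F rule: infinite_finite_induct)
  case (insert i F) then show ?case using H1r_add[of "u i" "\<lambda>x. \<Sum>i\<in>F. u i x"] by simp
qed (simp_all add: H1r_zero)

lemma dform_commute: "dform u v = dform v u" by (simp add: dform_def ip_commute)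

lemma dform_self_nonneg: "0 \<le> dform u u" by (simp add: dform_def ip_self_nonneg sum_nonneg)

lemma dform_add_left:
  assumes "u \<in> H1r" "v \<in> H1r" "w \<in> H1r"
  shows "dform (\<lambda>x. u x + v x) w = dform u w + dform v w"
proof -
  have "ip (wd i (\<lambda>x. u x + v x)) (wd i w) = ip (wd i u) (wd i w) + ip (wd i v) (wd i w)" for i
  proof -
    have "ip (wd i (\<lambda>x. u x + v x)) (wd i w) = ip (\<lambda>x. wd i u x + wd i v x) (wd i w)"
      using wd_eqI[OF H1r_add[OF assms(1,2)] wpd_add[OF wpd_wd wpd_wd H1r_L2 H1r_L2, OF assms(1,2,1,2), of i]]
        wd_L2[OF assms(1), of i] wd_L2[OF assms(2), of i] wd_L2[OF assms(3), of i]
        wd_L2[OF H1r_add[OF assms(1,2)], of i]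
      by (intro ip_cong_AE) (auto intro: L2_measurable)
    then show ?thesis using assms by (simp add: ip_add_left wd_L2)
  qed
  then show ?thesis by (simp add: dform_def sum.distrib)
qed

lemma dform_cmult_left:
  assumes "u \<in> H1r" "w \<in> H1r" shows "dform (\<lambda>x. c * u x) w = c * dform u w"
proof -
  have "ip (wd i (\<lambda>x. c * u x)) (wd i w) = c * ip (wd i u) (wd i w)" for i
  proof -
    have "ip (wd i (\<lambda>x. c * u x)) (wd i w) = ip (\<lambda>x. c * wd i u x) (wd i w)"
      using wd_eqI[OF H1r_cmult[OF assms(1)] wpd_cmult[OF wpd_wd, OF assms(1), of i]]
        wd_L2[OF assms(1), of i] wd_L2[OF assms(2), of i] wd_L2[OF H1r_cmult[OF assms(1)], of i]
      by (intro ip_cong_AE) (auto intro: L2_measurable)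
    then show ?thesis by (simp add: ip_cmult_left)
  qed
  then show ?thesis by (simp add: dform_def sum_distrib_left)
qed

lemma dform_add_right:
  "u \<in> H1r \<Longrightarrow> v \<in> H1r \<Longrightarrow> w \<in> H1r \<Longrightarrow> dform w (\<lambda>x. u x + v x) = dform w u + dform w v"
  using dform_add_left[of u v w] by (simp add: dform_commute)

lemma dform_cmult_right:
  "u \<in> H1r \<Longrightarrow> w \<in> H1r \<Longrightarrow> dform w (\<lambda>x. c * u x) = c * dform w u"
  using dform_cmult_left[of u w c] by (simp add: dform_commute)

section \<open>Norm bounds for differences of translates\<close>

lemma pair_measurable_comp:
  fixes a :: "'b::euclidean_space \<Rightarrow> real" and p :: "'a::euclidean_space \<times> 'b \<Rightarrow> 'b"
  assumes "a \<in> borel_measurable borel" "continuous_on UNIV p"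
  shows "(\<lambda>z. a (p z)) \<in> borel_measurable (lborel \<Otimes>\<^sub>M lborel)"
proof -
  have "p \<in> borel \<rightarrow>\<^sub>M borel" using assms(2) by (rule borel_measurable_continuous_onI)
  then have "p \<in> lborel \<Otimes>\<^sub>M lborel \<rightarrow>\<^sub>M borel" by (simp add: lborel_prod)
  then show ?thesis using assms(1) by (rule measurable_compose)
qed

lemma integrable_segment_translate:
  fixes c :: "'a::euclidean_space \<Rightarrow> real"
  assumes c: "integrable lborel c"
  shows "integrable (lborel \<Otimes>\<^sub>M lborel) (\<lambda>(s::real, x). indicator {0..t} s * c (x + s *\<^sub>R p))"
proof (rule lborel_pair.Fubini_integrable)
  have [measurable]: "c \<in> borel_measurable borel" using c by auto
  have "(\<lambda>z::real \<times> 'a. c (snd z + fst z *\<^sub>R p)) \<in> borel_measurable (lborel \<Otimes>\<^sub>M lborel)"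
    by (intro pair_measurable_comp continuous_intros) auto
  then show "(\<lambda>(s::real, x). indicator {0..t} s * c (x + s *\<^sub>R p)) \<in> borel_measurable (lborel \<Otimes>\<^sub>M lborel)"
    by (simp add: case_prod_beta)
  have "(LINT y|lborel. norm (case (s, y) of (s::real, x) \<Rightarrow> indicator {0..t} s * c (x + s *\<^sub>R p))) =
     indicator {0..t} s * (LINT y|lborel. \<bar>c y\<bar>)" for s
    using integral_translate[of "\<lambda>x. \<bar>c x\<bar>" "s *\<^sub>R p"] by (simp add: abs_mult)
  moreover have "integrable lborel (\<lambda>s::real. indicator {0..t} s * (LINT y|lborel. \<bar>c y\<bar>))"
    by (intro integrable_mult_left integrable_real_indicator) (auto simp: emeasure_lborel_Icc_eq)
  ultimately show "integrable lborel (\<lambda>s. LINT y|lborel. norm (case (s, y) of (s::real, x) \<Rightarrow> indicator {0..t} s * c (x + s *\<^sub>R p)))"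
    by simp
  show "AE s in lborel. integrable lborel (\<lambda>y. case (s, y) of (s::real, x) \<Rightarrow> indicator {0..t} s * c (x + s *\<^sub>R p))"
    using integrable_translate[OF c] by simp
qed

lemma integrable_segment_product:
  fixes a b :: "'a::euclidean_space \<Rightarrow> real"
  assumes "a \<in> L2" "b \<in> L2"
  shows "integrable (lborel \<Otimes>\<^sub>M lborel)
    (\<lambda>(s::real, x). indicator {0..t} s * (a (x + s *\<^sub>R p) * b (x + s *\<^sub>R q)))"
proof (rule Bochner_Integration.integrable_bound)
  show "integrable (lborel \<Otimes>\<^sub>M lborel) (\<lambda>z. (case z of (s::real, x) \<Rightarrow> indicator {0..t} s * (a (x + s *\<^sub>R p))\<^sup>2)
     + (case z of (s::real, x) \<Rightarrow> indicator {0..t} s * (b (x + s *\<^sub>R q))\<^sup>2))"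
    by (intro Bochner_Integration.integrable_add integrable_segment_translate[of "\<lambda>x. (a x)\<^sup>2"]
          integrable_segment_translate[of "\<lambda>x. (b x)\<^sup>2"] L2_sq assms)
  have [measurable]: "a \<in> borel_measurable borel" "b \<in> borel_measurable borel" using assms by measurable
  have "(\<lambda>z::real \<times> 'a. a (snd z + fst z *\<^sub>R p)) \<in> borel_measurable (lborel \<Otimes>\<^sub>M lborel)"
    "(\<lambda>z::real \<times> 'a. b (snd z + fst z *\<^sub>R q)) \<in> borel_measurable (lborel \<Otimes>\<^sub>M lborel)"
    by (intro pair_measurable_comp continuous_intros; auto)+
  then show "(\<lambda>(s::real, x). indicator {0..t} s * (a (x + s *\<^sub>R p) * b (x + s *\<^sub>R q)))
     \<in> borel_measurable (lborel \<Otimes>\<^sub>M lborel)"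
    by (simp add: case_prod_beta)
  show "AE z in lborel \<Otimes>\<^sub>M lborel. norm (case z of (s::real, x) \<Rightarrow> indicator {0..t} s * (a (x + s *\<^sub>R p) * b (x + s *\<^sub>R q)))
     \<le> norm ((case z of (s::real, x) \<Rightarrow> indicator {0..t} s * (a (x + s *\<^sub>R p))\<^sup>2)
     + (case z of (s::real, x) \<Rightarrow> indicator {0..t} s * (b (x + s *\<^sub>R q))\<^sup>2))"
    using abs_mult_le_sum_squares by (intro AE_I2) (auto simp: indicator_def)
qed

text \<open>In the weak sense u(x - t e) - u(x) is minus the integral of g(x - s e) over s from 0 to
  t, called \<open>G\<close> below. Cauchy-Schwarz in s and translation invariance then bound the
  norm of \<open>G\<close>.\<close>

lemma axis_translation_bound:
  fixes u :: "real^'d \<Rightarrow> real"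
  assumes u: "u \<in> L2" and g: "wpd i u g" and t: "0 \<le> t"
  shows "nrm (\<lambda>x. u (x - t *\<^sub>R axis i 1) - u x) \<le> t * nrm g"
proof -
  define e where "e = (axis i 1 :: real^'d)"
  have gL: "g \<in> L2" using g by (simp add: wpd_def)
  have [measurable]: "u \<in> borel_measurable borel" "g \<in> borel_measurable borel" using u gL by measurable
  define G where "G = (\<lambda>x. LINT s|lborel. indicator {0..t} s * g (x - s *\<^sub>R e))"
  have int2: "integrable (lborel \<Otimes>\<^sub>M lborel) (\<lambda>(s::real, x). indicator {0..t} s * (g (x - s *\<^sub>R e))\<^sup>2)"
    using integrable_segment_translate[OF L2_sq[OF gL], of t "- e"] by simp
  have "(\<lambda>z::real \<times> (real^'d). g (snd z - fst z *\<^sub>R e)) \<in> borel_measurable (lborel \<Otimes>\<^sub>M lborel)"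
    by (intro pair_measurable_comp continuous_intros) auto
  then have m: "(\<lambda>z::real \<times> (real^'d). indicator {0..t} (fst z) * g (snd z - fst z *\<^sub>R e)) \<in> borel_measurable (lborel \<Otimes>\<^sub>M lborel)"
    by simp
  have "(\<lambda>(x, s::real). indicator {0..t} s * g (x - s *\<^sub>R e)) \<in> borel_measurable (lborel \<Otimes>\<^sub>M lborel)"
    using measurable_pair_swap[OF m] by (simp add: case_prod_beta)
  then have Gm[measurable]: "G \<in> borel_measurable borel"
    unfolding G_def using lborel.borel_measurable_lebesgue_integral[of "\<lambda>x (s::real). indicator {0..t} s * g (x - s *\<^sub>R e)" lborel]
    by simp
  define G2 where "G2 = (\<lambda>x. LINT s|lborel. indicator {0..t} s * (g (x - s *\<^sub>R e))\<^sup>2)"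
  have AE1: "AE x in lborel. integrable lborel (\<lambda>s. indicator {0..t} s * (g (x - s *\<^sub>R e))\<^sup>2)"
    using lborel_pair.AE_integrable_snd[OF int2] .
  \<comment> \<open>Cauchy-Schwarz in s against the indicator of [0, t] gives one factor t here;
    integrating \<open>G2\<close> over x gives the other.\<close>
  have GG2: "AE x in lborel. (G x)\<^sup>2 \<le> t * G2 x"
    using AE1
  proof eventually_elim
    case (elim x)
    have sm[measurable]: "(\<lambda>s. g (x - s *\<^sub>R e)) \<in> borel_measurable borel"
      by (rule measurable_compose[of _ borel borel]) (auto intro!: borel_measurable_continuous_onI continuous_intros)
    have a: "(\<lambda>s. indicator {0..t} s * g (x - s *\<^sub>R e)) \<in> L2"
      using elim by (auto simp: L2_def power_mult_distrib indicator_power)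
    have b: "indicator {0..t} \<in> (L2 :: (real \<Rightarrow> real) set)"
      by (auto simp: L2_def indicator_power emeasure_lborel_Icc_eq intro!: integrable_real_indicator)
    have "(ip (indicator {0..t}) (\<lambda>s. indicator {0..t} s * g (x - s *\<^sub>R e)))\<^sup>2 \<le>
        ip (indicator {0..t}) (indicator {0..t}) *
        ip (\<lambda>s. indicator {0..t} s * g (x - s *\<^sub>R e)) (\<lambda>s. indicator {0..t} s * g (x - s *\<^sub>R e))"
      by (rule ip_Cauchy_Schwarz[OF b a])
    also have "ip (indicator {0..t}) (\<lambda>s. indicator {0..t} s * g (x - s *\<^sub>R e)) = G x"
      unfolding ip_def G_def by (intro Bochner_Integration.integral_cong) (auto simp: indicator_def)
    also have "ip (\<lambda>s. indicator {0..t} s * g (x - s *\<^sub>R e)) (\<lambda>s. indicator {0..t} s * g (x - s *\<^sub>R e)) = G2 x"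
      unfolding ip_def G2_def by (intro Bochner_Integration.integral_cong) (auto simp: indicator_def power2_eq_square)
    also have "ip (indicator {0..t}) (indicator {0..t}) = (LINT s|lborel. indicator {0..t} (s::real))"
      unfolding ip_def by (intro Bochner_Integration.integral_cong) (auto simp: indicator_def)
    also have "\<dots> = t" using t by simp
    finally show ?case .
  qed
  have G2i: "integrable lborel G2"
    unfolding G2_def by (rule lborel_pair.integrable_snd[OF int2])
  have "(LINT x|lborel. G2 x) = (LINT s|lborel. LINT x|lborel. indicator {0..t} s * (g (x - s *\<^sub>R e))\<^sup>2)"
    unfolding G2_def by (rule lborel_pair.Fubini_integral[OF int2])
  also have "\<dots> = (LINT s|lborel. indicator {0..t} s * ip g g)"
    using integral_translate[of "\<lambda>x. (g x)\<^sup>2" "- (s *\<^sub>R e)" for s] by (simp add: ip_self)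
  also have "\<dots> = t * ip g g" using t by simp
  finally have G2v: "(LINT x|lborel. G2 x) = t * ip g g" .
  have GL: "G \<in> L2"
  proof -
    have "integrable lborel (\<lambda>x. (G x)\<^sup>2)"
      by (rule Bochner_Integration.integrable_bound[OF integrable_mult_right[OF G2i, of t]])
         (use GG2 in auto)
    then show ?thesis by (simp add: L2_def)
  qed
  have Gn: "ip G G \<le> t\<^sup>2 * ip g g"
  proof -
    have "ip G G \<le> (LINT x|lborel. t * G2 x)" unfolding ip_self
      by (rule integral_mono_AE) (use GG2 L2_sq[OF GL] G2i in auto)
    then show ?thesis by (simp add: G2v power2_eq_square mult.assoc)
  qed
  define ut where "ut = (\<lambda>x. u (x - t *\<^sub>R e))"
  have utL: "ut \<in> L2" using L2_translate[OF u, of "- (t *\<^sub>R e)"] by (simp add: ut_def)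
  have wL: "(\<lambda>x. ut x - u x + G x) \<in> L2" by (intro L2_add L2_diff utL u GL)
  have "AE x in lborel. ut x - u x + G x = 0"
  proof (rule fundamental_lemma[OF wL])
    fix \<phi> :: "real^'d \<Rightarrow> real" assume \<phi>: "test_function \<phi>"
    have \<phi>L: "\<phi> \<in> L2" by (rule test_function_L2[OF \<phi>])
    have p\<phi>: "test_function (partial i \<phi>)" by (rule test_function_partial[OF \<phi>])
    have p\<phi>L: "partial i \<phi> \<in> L2" by (rule test_function_L2[OF p\<phi>])
    have [measurable]: "\<phi> \<in> borel_measurable borel" by (rule L2_measurable[OF \<phi>L])
    have "ip ut \<phi> = ip (\<lambda>x. ut (x + t *\<^sub>R e)) (\<lambda>x. \<phi> (x + t *\<^sub>R e))"
      by (rule ip_translate[symmetric]) (use utL in measurable)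
    also have "(\<lambda>x. ut (x + t *\<^sub>R e)) = u" by (simp add: ut_def)
    finally have "ip ut \<phi> - ip u \<phi> = ip u (\<lambda>x. \<phi> (x + t *\<^sub>R e) - \<phi> x)"
      using u \<phi>L L2_translate[OF \<phi>L] by (simp add: ip_diff_right)
    also have "\<dots> = (LINT x|lborel. LINT s|lborel. indicator {0..t} s * (u x * partial i \<phi> (x + s *\<^sub>R e)))"
      unfolding ip_def
    proof (intro Bochner_Integration.integral_cong refl)
      fix x
      have "(LINT s|lborel. partial i \<phi> (x + s *\<^sub>R e) * indicator {0..t} s) = \<phi> (x + t *\<^sub>R e) - \<phi> (x + 0 *\<^sub>R e)"
      proof (rule integral_FTC_Icc_real)
        show "0 \<le> t" by fact
        show "((\<lambda>s. \<phi> (x + s *\<^sub>R e)) has_real_derivative partial i \<phi> (x + s *\<^sub>R e)) (at s)" for s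
          unfolding e_def by (rule test_function_line_deriv[OF \<phi>])
        have "continuous_on UNIV (\<lambda>s. partial i \<phi> (x + s *\<^sub>R e))"
          by (rule continuous_on_compose2[OF test_function_continuous[OF p\<phi>]]) (auto intro!: continuous_intros)
        then show "isCont (\<lambda>s. partial i \<phi> (x + s *\<^sub>R e)) s" for s
          by (simp add: continuous_on_eq_continuous_at)
      qed
      then have "u x * (\<phi> (x + t *\<^sub>R e) - \<phi> x) = u x * (LINT s|lborel. partial i \<phi> (x + s *\<^sub>R e) * indicator {0..t} s)"
        by simp
      also have "\<dots> = (LINT s|lborel. u x * (partial i \<phi> (x + s *\<^sub>R e) * indicator {0..t} s))"
        by (rule integral_mult_right_zero[symmetric])
      also have "\<dots> = (LINT s|lborel. indicator {0..t} s * (u x * partial i \<phi> (x + s *\<^sub>R e)))"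
        by (intro Bochner_Integration.integral_cong) (simp_all only: mult_ac)
      finally show "u x * (\<phi> (x + t *\<^sub>R e) - \<phi> x) = (LINT s|lborel. indicator {0..t} s * (u x * partial i \<phi> (x + s *\<^sub>R e)))" .
    qed
    also have "\<dots> = (LINT s|lborel. LINT x|lborel. indicator {0..t} s * (u x * partial i \<phi> (x + s *\<^sub>R e)))"
      using lborel_pair.Fubini_integral[of "\<lambda>(s::real) x. indicator {0..t} s * (u x * partial i \<phi> (x + s *\<^sub>R e))"]
        integrable_segment_product[OF u p\<phi>L, of t 0 e] by simp
    also have "\<dots> = (LINT s|lborel. LINT x|lborel. - (indicator {0..t} s * (g (x - s *\<^sub>R e) * \<phi> x)))"
    proof (rule Bochner_Integration.integral_cong[OF refl])
      fix s :: real
      have "ip u (\<lambda>x. partial i \<phi> (x + s *\<^sub>R e)) = - ip g (\<lambda>x. \<phi> (x + s *\<^sub>R e))"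
        using g test_function_translate[OF \<phi>, of "s *\<^sub>R e"] unfolding wpd_def partial_translate[symmetric] by blast
      also have "ip g (\<lambda>x. \<phi> (x + s *\<^sub>R e)) = ip (\<lambda>x. g (x - s *\<^sub>R e)) \<phi>"
        using ip_translate[of g "\<lambda>x. \<phi> (x + s *\<^sub>R e)" "- (s *\<^sub>R e)"] by simp
      finally show "(LINT x|lborel. indicator {0..t} s * (u x * partial i \<phi> (x + s *\<^sub>R e))) =
         (LINT x|lborel. - (indicator {0..t} s * (g (x - s *\<^sub>R e) * \<phi> x)))"
        by (simp add: ip_def)
    qed
    also have "\<dots> = - (LINT s|lborel. LINT x|lborel. indicator {0..t} s * (g (x - s *\<^sub>R e) * \<phi> x))" by simp
    also have "(LINT s|lborel. LINT x|lborel. indicator {0..t} s * (g (x - s *\<^sub>R e) * \<phi> x)) =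
       (LINT x|lborel. LINT s|lborel. indicator {0..t} s * (g (x - s *\<^sub>R e) * \<phi> x))"
      using lborel_pair.Fubini_integral[of "\<lambda>(s::real) x. indicator {0..t} s * (g (x - s *\<^sub>R e) * \<phi> x)"]
        integrable_segment_product[OF gL \<phi>L, of t "- e" 0] by simp
    also have "\<dots> = ip G \<phi>"
      unfolding ip_def G_def by (simp add: mult.assoc[symmetric])
    finally have "ip ut \<phi> - ip u \<phi> = - ip G \<phi>" .
    then have "ip (\<lambda>x. ut x - u x + G x) \<phi> = 0"
      using utL u GL \<phi>L by (simp add: ip_add_left ip_diff_left L2_diff)
    then show "(LINT x|lborel. (ut x - u x + G x) * \<phi> x) = 0" by (simp add: ip_def)
  qed
  then have "AE x in lborel. ut x - u x = - G x" by eventually_elim simp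
  moreover have [measurable]: "ut \<in> borel_measurable borel" using utL by measurable
  ultimately have "ip (\<lambda>x. ut x - u x) (\<lambda>x. ut x - u x) = ip (\<lambda>x. - G x) (\<lambda>x. - G x)"
    by (intro ip_cong_AE) auto
  also have "\<dots> = ip G G" by (simp add: ip_def)
  also note Gn
  finally have "nrm (\<lambda>x. ut x - u x) \<le> sqrt (t\<^sup>2 * ip g g)" unfolding nrm_def by (rule real_sqrt_le_mono)
  then show ?thesis using t by (simp add: nrm_def real_sqrt_mult ut_def e_def)
qed

text \<open>For t > 0 the forward difference is the backward difference moved by t, and the norm is
  translation invariant.\<close>

lemma axis_translation_bound_abs:
  fixes u :: "real^'d \<Rightarrow> real"
  assumes u: "u \<in> L2" and g: "wpd i u g"
  shows "nrm (\<lambda>x. u (x + t *\<^sub>R axis i 1) - u x) \<le> \<bar>t\<bar> * nrm g"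
proof (cases "t \<le> 0")
  case True
  then show ?thesis using axis_translation_bound[OF u g, of "- t"] by simp
next
  case False
  have [measurable]: "u \<in> borel_measurable borel" using u by measurable
  define h where "h = (\<lambda>x. u (x - t *\<^sub>R axis i 1) - u x)"
  have hm: "h \<in> borel_measurable borel" unfolding h_def by measurable
  have "ip (\<lambda>x. u (x + t *\<^sub>R axis i 1) - u x) (\<lambda>x. u (x + t *\<^sub>R axis i 1) - u x) =
     ip (\<lambda>x. h (x + t *\<^sub>R axis i 1)) (\<lambda>x. h (x + t *\<^sub>R axis i 1))"
    by (simp add: h_def ip_def algebra_simps)
  also have "\<dots> = ip h h" by (rule ip_translate[OF hm hm])
  finally show ?thesis using axis_translation_bound[OF u g, of t] False by (simp add: nrm_def h_def)
qed

text \<open>The shift z is reached by one step along each axis. Cauchy-Schwarz over the coordinates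
  restores the Euclidean norm of z with constant 1.\<close>

theorem translation_bound:
  fixes u :: "real^'d \<Rightarrow> real"
  assumes u: "u \<in> H1r"
  shows "ip (\<lambda>x. u (x + z) - u x) (\<lambda>x. u (x + z) - u x) \<le> (norm z)\<^sup>2 * dform u u"
proof -
  have uL: "u \<in> L2" using u by (rule H1r_L2)
  have [measurable]: "u \<in> borel_measurable borel" using uL by measurable
  have *: "nrm (\<lambda>x. u (x + (\<Sum>i\<in>S. (z $ i) *\<^sub>R axis i 1)) - u x) \<le> (\<Sum>i\<in>S. \<bar>z $ i\<bar> * nrm (wd i u))"
    if "finite S" for S using that
  proof (induction S)
    case empty then show ?case by (simp add: nrm_def)
  next
    case (insert i S)
    define y where "y = (\<Sum>i\<in>S. (z $ i) *\<^sub>R axis i (1::real))"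
    define h where "h = (\<lambda>x. u (x + (z $ i) *\<^sub>R axis i 1) - u x)"
    have hL: "h \<in> L2" unfolding h_def by (intro L2_diff L2_translate uL)
    have yL: "(\<lambda>x. u (x + y) - u x) \<in> L2" by (intro L2_diff L2_translate uL)
    have "(\<lambda>x. u (x + (\<Sum>i\<in>insert i S. (z $ i) *\<^sub>R axis i 1)) - u x) = (\<lambda>x. h (x + y) + (u (x + y) - u x))"
      using insert.hyps by (simp add: h_def y_def algebra_simps)
    then have "nrm (\<lambda>x. u (x + (\<Sum>i\<in>insert i S. (z $ i) *\<^sub>R axis i 1)) - u x) \<le>
       nrm (\<lambda>x. h (x + y)) + nrm (\<lambda>x. u (x + y) - u x)"
      using nrm_triangle[OF L2_translate[OF hL] yL] by simp
    also have "nrm (\<lambda>x. h (x + y)) = nrm h"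
      unfolding nrm_def by (simp add: ip_translate L2_measurable[OF hL])
    also have "nrm h \<le> \<bar>z $ i\<bar> * nrm (wd i u)"
      unfolding h_def by (rule axis_translation_bound_abs[OF uL wpd_wd[OF u]])
    finally show ?case using insert unfolding y_def by simp
  qed
  have z: "(\<Sum>i\<in>UNIV. (z $ i) *\<^sub>R axis i 1) = z"
    using basis_expansion[of z] by (simp add: scalar_mult_eq_scaleR)
  have "nrm (\<lambda>x. u (x + z) - u x) \<le> (\<Sum>i\<in>UNIV. \<bar>z $ i\<bar> * nrm (wd i u))"
    using *[of UNIV] unfolding z by simp
  then have "(nrm (\<lambda>x. u (x + z) - u x))\<^sup>2 \<le> (\<Sum>i\<in>UNIV. \<bar>z $ i\<bar> * nrm (wd i u))\<^sup>2"
    by (intro power_mono) (auto simp: nrm_nonneg)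
  also have "\<dots> \<le> (\<Sum>i\<in>UNIV. \<bar>z $ i\<bar>\<^sup>2) * (\<Sum>i\<in>UNIV. (nrm (wd i u))\<^sup>2)"
    by (rule Cauchy_Schwarz_ineq_sum)
  also have "\<dots> = (norm z)\<^sup>2 * dform u u"
    by (simp add: nrm_sq dform_def norm_vec_def L2_set_def sum_nonneg)
  finally show ?thesis by (simp add: nrm_sq)
qed

section \<open>The heat semigroup\<close>

definition gauss :: "real \<Rightarrow> 'a::euclidean_space \<Rightarrow> real" where
  "gauss c x = exp (- (c * (norm x)\<^sup>2))"

lemma gauss_pos: "0 < gauss c x" by (simp add: gauss_def)

lemma gauss_measurable[measurable]: "gauss c \<in> borel_measurable borel"
  unfolding gauss_def[abs_def] by measurable

text \<open>Finiteness suffices because the heat kernel is normalised by the integral itself. The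
  comparison function 1/(1 + s^2) has the bounded primitive arctan, and scaling by sqrt c handles
  general c.\<close>

lemma nn_integral_gauss_real_finite:
  assumes "c > 0" shows "(\<integral>\<^sup>+s. ennreal (exp (- (c * s\<^sup>2))) \<partial>lborel) < \<infinity>"
proof -
  define r where "r = sqrt c"
  have r: "r > 0" "r\<^sup>2 = c" using assms by (auto simp: r_def)
  define f where "f = (\<lambda>s::real. 1 / (1 + s\<^sup>2))"
  have f0: "0 \<le> f s" for s unfolding f_def by (intro divide_nonneg_nonneg add_nonneg_nonneg) auto
  have [measurable]: "f \<in> borel_measurable borel" unfolding f_def by measurable
  have half: "(\<integral>\<^sup>+s. ennreal (f s) * indicator {0..} s \<partial>lborel) = ennreal (pi / 2 - arctan 0)"
  proof (rule nn_integral_FTC_atLeast)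
    show "DERIV arctan s :> f s" for s
      unfolding f_def using DERIV_arctan[of s] by (simp add: divide_inverse)
  qed (use f0 tendsto_arctan_at_top in auto)
  have "(\<integral>\<^sup>+s. ennreal (f s) * indicator {..0} s \<partial>lborel) =
      ennreal \<bar>-1\<bar> * (\<integral>\<^sup>+s. ennreal (f (0 + - 1 * s)) * indicator {..0} (0 + - 1 * s) \<partial>lborel)"
    by (rule nn_integral_real_affine) auto
  also have "\<dots> = (\<integral>\<^sup>+s. ennreal (f s) * indicator {0..} s \<partial>lborel)"
    by (auto simp: f_def indicator_def intro!: nn_integral_cong)
  finally have half': "(\<integral>\<^sup>+s. ennreal (f s) * indicator {..0} s \<partial>lborel) = ennreal (pi / 2 - arctan 0)"
    using half by simp
  have "(\<integral>\<^sup>+s. ennreal (f s) \<partial>lborel) \<le>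
    (\<integral>\<^sup>+s. ennreal (f s) * indicator {..0} s + ennreal (f s) * indicator {0..} s \<partial>lborel)"
    by (intro nn_integral_mono) (auto simp: indicator_def)
  also have "\<dots> = ennreal (pi / 2) + ennreal (pi / 2)"
    by (subst nn_integral_add) (simp_all add: half half')
  also have "\<dots> < \<infinity>" by simp
  finally have fin: "(\<integral>\<^sup>+s. ennreal (f s) \<partial>lborel) < \<infinity>" .
  have "exp (- s\<^sup>2) \<le> f s" for s :: real
  proof -
    have "1 + s\<^sup>2 \<le> exp (s\<^sup>2)" by simp
    moreover have "0 < 1 + s\<^sup>2" by (simp add: add_pos_nonneg)
    ultimately show ?thesis by (simp add: f_def exp_minus field_simps)
  qed
  then have "(\<integral>\<^sup>+s. ennreal (exp (- s\<^sup>2)) \<partial>lborel) \<le> (\<integral>\<^sup>+s. ennreal (f s) \<partial>lborel)"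
    by (intro nn_integral_mono ennreal_leI)
  also note fin
  finally have "(\<integral>\<^sup>+s. ennreal (exp (- s\<^sup>2)) \<partial>lborel) < \<infinity>" .
  moreover have "(\<integral>\<^sup>+s. ennreal (exp (- s\<^sup>2)) \<partial>lborel) =
     ennreal \<bar>r\<bar> * (\<integral>\<^sup>+s. ennreal (exp (- (0 + r * s)\<^sup>2)) \<partial>lborel)"
    by (rule nn_integral_real_affine) (use r in auto)
  moreover have "(\<lambda>s. exp (- (0 + r * s)\<^sup>2)) = (\<lambda>s. exp (- (c * s\<^sup>2)))"
    using r by (simp add: power_mult_distrib)
  ultimately have "ennreal \<bar>r\<bar> * (\<integral>\<^sup>+s. ennreal (exp (- (c * s\<^sup>2))) \<partial>lborel) < \<infinity>"
    by metis
  then have "ennreal r * (\<integral>\<^sup>+s. ennreal (exp (- (c * s\<^sup>2))) \<partial>lborel) < \<infinity>"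
    using r by simp
  then show ?thesis using r by (auto simp: ennreal_mult_less_top)
qed

lemma gauss_integrable:
  assumes "c > 0" shows "integrable lborel (gauss c :: 'a::euclidean_space \<Rightarrow> real)"
proof (rule integrableI_nonneg)
  have "gauss c x = (\<Prod>b\<in>Basis. exp (- (c * (x \<bullet> b)\<^sup>2)))" for x :: 'a
    unfolding gauss_def exp_sum[OF finite_Basis, symmetric]
    by (simp add: norm_eq_sqrt_inner euclidean_inner[of x x] sum_nonneg sum_distrib_left sum_negf power2_eq_square)
  then have "(\<integral>\<^sup>+x. ennreal (gauss c (x::'a)) \<partial>lborel) =
     (\<integral>\<^sup>+x. (\<Prod>b\<in>Basis. ennreal (exp (- (c * ((x::'a) \<bullet> b)\<^sup>2)))) \<partial>lborel)"
    by (simp add: prod_ennreal)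
  also have "\<dots> = (\<Prod>b\<in>(Basis::'a set). \<integral>\<^sup>+s. ennreal (exp (- (c * s\<^sup>2))) \<partial>lborel)"
    by (rule nn_integral_lborel_prod) auto
  also have "\<dots> < \<infinity>"
    using nn_integral_gauss_real_finite[OF assms] by (simp add: ennreal_prod_eq_top less_top power_less_top_ennreal)
  finally show "(\<integral>\<^sup>+x. ennreal (gauss c (x::'a)) \<partial>lborel) < \<infinity>" .
qed (auto simp: gauss_def)

text \<open>The type token selects the dimension. The Gaussian integral is never evaluated: the heat
  kernel asks only for its positivity and its scaling in c.\<close>

definition gint :: "'a::euclidean_space itself \<Rightarrow> real \<Rightarrow> real" where
  "gint T c = (LINT x|lborel. gauss c (x::'a))"

lemma gint_scale:
  assumes c: "c > 0" shows "gint TYPE('a::euclidean_space) c = c powr (- (DIM('a) / 2)) * gint TYPE('a) 1"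
proof -
  define r where "r = sqrt c"
  have r: "r > 0" "r\<^sup>2 = c" using c by (auto simp: r_def)
  have "gint TYPE('a) 1 = (LINT x|density (distr lborel borel (\<lambda>x. 0 + r *\<^sub>R x)) (\<lambda>_. ennreal (\<bar>r\<bar>^DIM('a))). gauss 1 (x::'a))"
    unfolding gint_def using lborel_affine[of r "0::'a"] r by (simp add: ennreal_power)
  also have "\<dots> = (LINT x|distr lborel borel (\<lambda>x. 0 + r *\<^sub>R x). \<bar>r\<bar>^DIM('a) *\<^sub>R gauss 1 (x::'a))"
    by (rule integral_density) auto
  also have "\<dots> = (LINT x|lborel. \<bar>r\<bar>^DIM('a) *\<^sub>R gauss 1 (0 + r *\<^sub>R (x::'a)))"
    by (rule integral_distr) auto
  also have "\<dots> = r ^ DIM('a) * gint TYPE('a) c"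
    using r by (simp add: gint_def gauss_def power_mult_distrib)
  finally have "gint TYPE('a) 1 = r ^ DIM('a) * gint TYPE('a) c" .
  moreover have "r ^ DIM('a) = c powr (DIM('a) / 2)"
    using c r by (simp add: r_def powr_half_sqrt[symmetric] powr_realpow[symmetric] powr_powr)
  ultimately show ?thesis using c by (simp add: powr_minus field_simps)
qed

lemma gint_pos: assumes "c > 0" shows "gint TYPE('a::euclidean_space) c > 0"
proof -
  have "gint TYPE('a) c \<noteq> 0"
  proof
    assume "gint TYPE('a) c = 0"
    moreover have "(LINT x|lborel. gauss c (x::'a)) = 0 \<longleftrightarrow> (AE x in lborel. gauss c (x::'a) = 0)"
      by (rule integral_nonneg_eq_0_iff_AE[OF gauss_integrable[OF assms]]) (simp add: gauss_def)
    ultimately have "AE x in lborel. gauss c (x::'a) = 0" by (simp add: gint_def)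
    then have "AE x in (lborel :: 'a measure). False"
      by eventually_elim (simp add: gauss_def)
    then show False by (simp add: eventually_False ae_filter_eq_bot_iff)
  qed
  moreover have "gint TYPE('a) c \<ge> 0" unfolding gint_def by (simp add: gauss_def)
  ultimately show ?thesis by simp
qed

text \<open>The kernel of exp(t Laplacian), usually written (4 pi t)^(-d/2) exp(-|x|^2/(4t)), with
  the normalising factor left as \<open>gint\<close>.\<close>

definition heat :: "real \<Rightarrow> 'a::euclidean_space \<Rightarrow> real" where
  "heat t x = gauss (1 / (4 * t)) x / gint TYPE('a) (1 / (4 * t))"

lemma heat_measurable[measurable]: "heat t \<in> borel_measurable borel"
  unfolding heat_def[abs_def] by measurable

lemma heat_continuous: "continuous_on UNIV (heat t)"
  unfolding heat_def[abs_def] gauss_def divide_inverse by (intro continuous_intros)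

lemma heat_pos: assumes "t > 0" shows "0 < heat t x"
proof -
  have "0 < 1 / (4 * t)" using assms by simp
  then show ?thesis unfolding heat_def by (intro divide_pos_pos[OF gauss_pos gint_pos])
qed

lemma heat_nonneg: "t > 0 \<Longrightarrow> 0 \<le> heat t x"
  by (simp add: heat_pos less_imp_le)

lemma heat_even: "heat t (- x) = heat t x"
  by (simp add: heat_def gauss_def)

lemma heat_commute: "heat t (x - y) = heat t (y - x)"
  using heat_even[of t "x - y"] by simp

lemma heat_integrable: "t > 0 \<Longrightarrow> integrable lborel (heat t)"
  unfolding heat_def[abs_def] by (intro integrable_divide gauss_integrable) simp

lemma heat_integral: assumes "t > 0" shows "(LINT x|lborel. heat t (x::'a::euclidean_space)) = 1"
  using gint_pos[of "1 / (4 * t)", where 'a='a] assms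
  by (simp add: heat_def gint_def)

lemma heat_translate_integral:
  fixes x :: "'a::euclidean_space"
  assumes "t > 0"
  shows "integrable lborel (\<lambda>y. heat t (x - y))" "(LINT y|lborel. heat t (x - y)) = 1"
    "integrable lborel (\<lambda>y. heat t (y - x))" "(LINT y|lborel. heat t (y - x)) = 1"
  using integrable_translate[OF heat_integrable[OF assms], of "- x"] heat_integral[OF assms, where 'a='a]
    integral_translate[of "heat t" "- x"]
  by (simp_all add: heat_commute[of t x])

lemma heat_le:
  fixes x :: "'a::euclidean_space"
  assumes "t > 0" shows "heat t x \<le> heat t (0::'a)"
  using gint_pos[of "1 / (4 * t)", where 'a='a] assms
  by (auto simp: heat_def gauss_def divide_le_cancel mult_nonneg_nonneg)

lemma heat_0: assumes "t > 0"
  shows "heat t (0::'a::euclidean_space) = (4 * t) powr (- (DIM('a) / 2)) / gint TYPE('a) 1"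
proof -
  have "(1 / (4 * t)) powr (- q) = 1 / (4 * t) powr (- q)" for q
    using powr_divide[of 1 "4 * t" "- q"] assms by simp
  then show ?thesis
    using assms gint_scale[of "1 / (4 * t)", where 'a='a] by (simp add: heat_def gauss_def)
qed

lemma heat_L2: assumes "t > 0" shows "heat t \<in> L2"
proof -
  have "integrable lborel (\<lambda>x. (heat t x)\<^sup>2)"
    by (rule Bochner_Integration.integrable_bound[OF integrable_mult_right[OF heat_integrable[OF assms], of "heat t 0"]])
       (use heat_le[OF assms] heat_nonneg[OF assms] in \<open>auto simp: power2_eq_square intro!: AE_I2 mult_right_mono order.trans[OF _ abs_ge_self]\<close>)
  then show ?thesis by (simp add: L2_def)
qed

lemma heat_reflect_translate_L2: "t > 0 \<Longrightarrow> (\<lambda>y. heat t (x - y)) \<in> L2"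
  using L2_translate[OF heat_L2, of t "- x"] heat_commute[of t x] by simp

text \<open>Completing the square about the midpoint of x and z, which is the parallelogram identity
  \<open>par\<close>, splits off a factor without y; what remains is a translated Gaussian
  integral.\<close>

lemma heat_semigroup:
  fixes x z :: "'a::euclidean_space"
  assumes t: "t > 0"
  shows "(LINT y|lborel. heat t (x - y) * heat t (y - z)) = heat (2 * t) (x - z)"
proof -
  define m where "m = (1/2) *\<^sub>R (x + z)"
  let ?G = "gint TYPE('a)"
  have par: "(norm (x - y))\<^sup>2 + (norm (y - z))\<^sup>2 = (norm (x - z))\<^sup>2 / 2 + 2 * (norm (y - m))\<^sup>2" for y
    unfolding m_def power2_norm_eq_inner
    by (simp add: inner_diff inner_add inner_commute field_simps)
  have "heat t (x - y) * heat t (y - z) =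
      gauss (1 / (8 * t)) (x - z) / (?G (1 / (4 * t)))\<^sup>2 * gauss (1 / (2 * t)) (y - m)" for y
  proof -
    have "1 / (4 * t) * (norm (x - y))\<^sup>2 + 1 / (4 * t) * (norm (y - z))\<^sup>2 =
       1 / (4 * t) * ((norm (x - y))\<^sup>2 + (norm (y - z))\<^sup>2)" by (simp add: distrib_left)
    also have "\<dots> = 1 / (8 * t) * (norm (x - z))\<^sup>2 + 1 / (2 * t) * (norm (y - m))\<^sup>2"
      unfolding par using t by (simp add: field_simps)
    finally show ?thesis
      unfolding heat_def gauss_def by (simp add: exp_add[symmetric] power2_eq_square)
  qed
  then have "(LINT y|lborel. heat t (x - y) * heat t (y - z)) =
     gauss (1 / (8 * t)) (x - z) / (?G (1 / (4 * t)))\<^sup>2 * (LINT y|lborel. gauss (1 / (2 * t)) (y - m))"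
    by simp
  also have "(LINT y|lborel. gauss (1 / (2 * t)) (y - m)) = ?G (1 / (2 * t))"
    using integral_translate[of "gauss (1 / (2 * t))" "- m"] by (simp add: gint_def)
  \<comment> \<open>The normalisations match because (1/(2t)) (1/(8t)) = (1/(4t))^2.\<close>
  also have "?G (1 / (2 * t)) = (?G (1 / (4 * t)))\<^sup>2 / ?G (1 / (8 * t))"
  proof -
    define q where "q = real DIM('a) / 2"
    have "?G (1 / (2 * t)) * ?G (1 / (8 * t)) = ((1 / (2 * t)) powr (- q) * (1 / (8 * t)) powr (- q)) * (?G 1)\<^sup>2"
      using t by (subst (1 2) gint_scale) (auto simp: power2_eq_square q_def)
    also have "(1 / (2 * t)) powr (- q) * (1 / (8 * t)) powr (- q) = ((1 / (4 * t)) powr (- q))\<^sup>2"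
      using t by (simp add: powr_mult[symmetric] power2_eq_square)
    also have "((1 / (4 * t)) powr (- q))\<^sup>2 * (?G 1)\<^sup>2 = (?G (1 / (4 * t)))\<^sup>2"
      using t by (subst (2) gint_scale) (auto simp: q_def power_mult_distrib)
    finally show ?thesis using gint_pos[of "1 / (8 * t)", where 'a='a] t by (simp add: field_simps)
  qed
  also have "gauss (1 / (8 * t)) (x - z) / (?G (1 / (4 * t)))\<^sup>2 * ((?G (1 / (4 * t)))\<^sup>2 / ?G (1 / (8 * t))) = heat (2 * t) (x - z)"
    using gint_pos[of "1 / (4 * t)", where 'a='a] t by (simp add: heat_def)
  finally show ?thesis .
qed

lemma heat_ip_self:
  fixes x :: "'a::euclidean_space"
  assumes "t > 0"
  shows "ip (\<lambda>y. heat t (x - y)) (\<lambda>y. heat t (x - y)) = heat (2 * t) (0::'a)"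
  using heat_semigroup[OF assms, of x x] by (simp add: ip_def heat_commute[of t _ x])

text \<open>The weight |z|^2 is paid for by half of the Gaussian decay, using q exp(-q) <= 1 at q =
  |z|^2/(8t). The resulting wider Gaussian has a mass larger by 2^(d/2), which explains the
  constant.\<close>

lemma heat_second_moment:
  assumes t: "t > 0"
  shows "integrable lborel (\<lambda>z::'a::euclidean_space. heat t z * (norm z)\<^sup>2)"
    "(LINT z|lborel. heat t (z::'a) * (norm z)\<^sup>2) \<le> 8 * 2 powr (DIM('a) / 2) * t"
proof -
  let ?G = "gint TYPE('a)"
  have b: "heat t z * (norm z)\<^sup>2 \<le> 8 * t / ?G (1 / (4 * t)) * gauss (1 / (8 * t)) z" for z :: 'a
  proof -
    define q where "q = 1 / (8 * t) * (norm z)\<^sup>2"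
    have "q \<le> exp q" using exp_ge_add_one_self[of q] by linarith
    then have "q * exp (- q) \<le> 1" by (simp add: exp_minus field_simps)
    then have "q * exp (- q) * exp (- q) \<le> 1 * exp (- q)" by (intro mult_right_mono) auto
    moreover have "exp (- (1 / (4 * t) * (norm z)\<^sup>2)) = exp (- q) * exp (- q)"
      using t by (simp add: q_def exp_add[symmetric] field_simps)
    moreover have "(norm z)\<^sup>2 = 8 * t * q" using t by (simp add: q_def)
    ultimately have "gauss (1 / (4 * t)) z * (norm z)\<^sup>2 = 8 * t * (q * exp (- q) * exp (- q))"
      unfolding gauss_def by (simp only: mult_ac)
    also have "\<dots> \<le> 8 * t * (1 * exp (- q))"
      using t \<open>q * exp (- q) * exp (- q) \<le> 1 * exp (- q)\<close> by (intro mult_left_mono) auto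
    also have "\<dots> = 8 * t * gauss (1 / (8 * t)) z" by (simp add: gauss_def q_def)
    finally have "gauss (1 / (4 * t)) z * (norm z)\<^sup>2 \<le> 8 * t * gauss (1 / (8 * t)) z" .
    then show ?thesis using gint_pos[of "1 / (4 * t)", where 'a='a] t
      by (simp add: heat_def field_simps)
  qed
  have gi: "integrable lborel (\<lambda>z::'a. 8 * t / ?G (1 / (4 * t)) * gauss (1 / (8 * t)) z)"
    using t by (intro integrable_mult_right gauss_integrable) simp
  show int: "integrable lborel (\<lambda>z::'a. heat t z * (norm z)\<^sup>2)"
    by (rule Bochner_Integration.integrable_bound[OF gi])
       (use b heat_nonneg[OF t, where 'a='a] in \<open>auto intro!: AE_I2 order.trans[OF _ abs_ge_self] simp: abs_of_nonneg simp del: times_divide_eq_left abs_divide abs_mult\<close>)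
  have "(LINT z|lborel. heat t (z::'a) * (norm z)\<^sup>2) \<le> (LINT z|lborel. 8 * t / ?G (1 / (4 * t)) * gauss (1 / (8 * t)) (z::'a))"
    by (rule integral_mono[OF int gi]) (use b in auto)
  also have "\<dots> = 8 * t * (?G (1 / (8 * t)) / ?G (1 / (4 * t)))" by (simp add: gint_def)
  also have "?G (1 / (8 * t)) / ?G (1 / (4 * t)) = 2 powr (DIM('a) / 2)"
  proof -
    define q where "q = real DIM('a) / 2"
    have "?G (1 / (8 * t)) / ?G (1 / (4 * t)) = (1 / (8 * t)) powr (- q) / (1 / (4 * t)) powr (- q)"
      using t gint_pos[of 1, where 'a='a] by (subst (1 2) gint_scale) (auto simp: q_def)
    also have "\<dots> = ((1 / (8 * t)) / (1 / (4 * t))) powr (- q)" using t by (simp only: powr_divide[symmetric])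
    also have "(1 / (8 * t)) / (1 / (4 * t)) = 1 / 2" using t by simp
    finally show ?thesis by (simp add: powr_divide powr_minus q_def)
  qed
  finally show "(LINT z|lborel. heat t (z::'a) * (norm z)\<^sup>2) \<le> 8 * 2 powr (DIM('a) / 2) * t" by (simp add: mult_ac)
qed

text \<open>As an inner product, the convolution makes the values \<open>heat_op t (u i) x\<close>
  the coefficients of a single function, the kernel centred at x, and Bessel's inequality applies to
  them.\<close>

definition heat_op :: "real \<Rightarrow> ('a::euclidean_space \<Rightarrow> real) \<Rightarrow> 'a \<Rightarrow> real" where
  "heat_op t u x = ip (\<lambda>y. heat t (x - y)) u"

lemma heat_diff_measurable:
  "(\<lambda>z::'a::euclidean_space \<times> 'a. heat t (fst z - snd z)) \<in> borel_measurable (lborel \<Otimes>\<^sub>M lborel)"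
  by (intro pair_measurable_comp continuous_intros) auto

lemma heat_conv_integrable:
  fixes c :: "'a::euclidean_space \<Rightarrow> real"
  assumes t: "t > 0" and c: "integrable lborel c"
  shows "integrable (lborel \<Otimes>\<^sub>M lborel) (\<lambda>(x, y). heat t (x - y) * c x)"
    "integrable (lborel \<Otimes>\<^sub>M lborel) (\<lambda>(x, y). heat t (x - y) * c y)"
proof -
  have [measurable]: "c \<in> borel_measurable borel" using c by auto
  have m: "(\<lambda>(x, y). heat t (x - y) * c x) \<in> borel_measurable (lborel \<Otimes>\<^sub>M lborel)"
    using heat_diff_measurable[of t] by (simp add: case_prod_beta)
  show *: "integrable (lborel \<Otimes>\<^sub>M lborel) (\<lambda>(x, y). heat t (x - y) * c x)"
  proof (rule lborel_pair.Fubini_integrable[OF m])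
    have "(LINT y|lborel. norm (case (x, y) of (x, y) \<Rightarrow> heat t (x - y) * c x)) = \<bar>c x\<bar>" for x
      using heat_translate_integral[OF t, of x]
      by (simp add: abs_mult heat_nonneg[OF t] abs_of_nonneg)
    then show "integrable lborel (\<lambda>x. LINT y|lborel. norm (case (x, y) of (x, y) \<Rightarrow> heat t (x - y) * c x))"
      using c by simp
    show "AE x in lborel. integrable lborel (\<lambda>y. case (x, y) of (x, y) \<Rightarrow> heat t (x - y) * c x)"
      by (intro AE_I2) (simp add: heat_translate_integral[OF t])
  qed
  show "integrable (lborel \<Otimes>\<^sub>M lborel) (\<lambda>(x, y). heat t (x - y) * c y)"
    using lborel_pair.integrable_product_swap[OF *] by (simp add: case_prod_beta heat_commute)
qed

lemma heat_form_integrable: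
  fixes u v :: "'a::euclidean_space \<Rightarrow> real"
  assumes t: "t > 0" and "u \<in> L2" "v \<in> L2"
  shows "integrable (lborel \<Otimes>\<^sub>M lborel) (\<lambda>(x, y). heat t (x - y) * (u x * v y))"
proof (rule Bochner_Integration.integrable_bound)
  have [measurable]: "u \<in> borel_measurable borel" "v \<in> borel_measurable borel" using assms by measurable
  show "integrable (lborel \<Otimes>\<^sub>M lborel) (\<lambda>z. (case z of (x, y) \<Rightarrow> heat t (x - y) * (u x)\<^sup>2) + (case z of (x, y) \<Rightarrow> heat t (x - y) * (v y)\<^sup>2))"
    by (intro Bochner_Integration.integrable_add heat_conv_integrable[OF t, of "\<lambda>x. (u x)\<^sup>2"]
        heat_conv_integrable[OF t, of "\<lambda>x. (v x)\<^sup>2"] L2_sq assms)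
  show "(\<lambda>(x, y). heat t (x - y) * (u x * v y)) \<in> borel_measurable (lborel \<Otimes>\<^sub>M lborel)"
    using heat_diff_measurable[of t] by (simp add: case_prod_beta)
  show "AE z in lborel \<Otimes>\<^sub>M lborel. norm (case z of (x, y) \<Rightarrow> heat t (x - y) * (u x * v y)) \<le>
     norm ((case z of (x, y) \<Rightarrow> heat t (x - y) * (u x)\<^sup>2) + (case z of (x, y) \<Rightarrow> heat t (x - y) * (v y)\<^sup>2))"
    using heat_nonneg[OF t] abs_mult_le_sum_squares
    by (intro AE_I2) (auto simp: abs_mult distrib_left[symmetric] intro!: mult_left_mono)
qed

lemma heat_op_diff: "t > 0 \<Longrightarrow> u \<in> L2 \<Longrightarrow> v \<in> L2 \<Longrightarrow> heat_op t (\<lambda>x. u x - v x) x = heat_op t u x - heat_op t v x"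
  by (simp add: heat_op_def ip_diff_right heat_reflect_translate_L2)

lemma heat_op_measurable:
  assumes "t > 0" "u \<in> L2" shows "heat_op t u \<in> borel_measurable borel"
proof -
  have [measurable]: "u \<in> borel_measurable borel" using assms by measurable
  have "(\<lambda>(x, y). heat t (x - y) * u y) \<in> borel_measurable (lborel \<Otimes>\<^sub>M lborel)"
    using heat_diff_measurable[of t] by (simp add: case_prod_beta)
  then show ?thesis
    unfolding heat_op_def[abs_def] ip_def
    using lborel.borel_measurable_lebesgue_integral[of "\<lambda>x y. heat t (x - y) * u y" lborel] by simp
qed

text \<open>Jensen's inequality for the probability density given by the kernel, obtained from
  Cauchy-Schwarz by splitting the kernel into two square roots.\<close>

lemma heat_op_sq_le:
  assumes t: "t > 0" and u: "u \<in> L2"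
  shows "(heat_op t u x)\<^sup>2 \<le> (LINT y|lborel. heat t (x - y) * (u y)\<^sup>2)"
proof -
  have [measurable]: "u \<in> borel_measurable borel" using u by measurable
  have h0: "0 \<le> heat t z" for z :: 'a using heat_nonneg[OF t] .
  have a: "(\<lambda>y. sqrt (heat t (x - y))) \<in> L2"
    using heat_translate_integral[OF t, of x] h0 by (simp add: L2_def)
  have b: "(\<lambda>y. sqrt (heat t (x - y)) * u y) \<in> L2"
  proof -
    have "integrable lborel (\<lambda>y. heat t (x - y) * (u y)\<^sup>2)"
      by (rule Bochner_Integration.integrable_bound[OF integrable_mult_right[OF L2_sq[OF u], of "heat t 0"]])
         (use heat_le[OF t] h0 in \<open>auto intro!: mult_right_mono AE_I2 order.trans[OF _ abs_ge_self] simp: abs_mult abs_of_nonneg[OF h0]\<close>)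
    then show ?thesis using h0 by (simp add: L2_def power_mult_distrib)
  qed
  have "(ip (\<lambda>y. sqrt (heat t (x - y))) (\<lambda>y. sqrt (heat t (x - y)) * u y))\<^sup>2 \<le>
     ip (\<lambda>y. sqrt (heat t (x - y))) (\<lambda>y. sqrt (heat t (x - y))) *
     ip (\<lambda>y. sqrt (heat t (x - y)) * u y) (\<lambda>y. sqrt (heat t (x - y)) * u y)"
    by (rule ip_Cauchy_Schwarz[OF a b])
  also have "ip (\<lambda>y. sqrt (heat t (x - y))) (\<lambda>y. sqrt (heat t (x - y)) * u y) = heat_op t u x"
    using h0 by (simp add: ip_def heat_op_def mult.assoc[symmetric])
  also have "ip (\<lambda>y. sqrt (heat t (x - y))) (\<lambda>y. sqrt (heat t (x - y))) = 1"
    using h0 heat_translate_integral[OF t, of x] by (simp add: ip_self)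
  also have "ip (\<lambda>y. sqrt (heat t (x - y)) * u y) (\<lambda>y. sqrt (heat t (x - y)) * u y) = (LINT y|lborel. heat t (x - y) * (u y)\<^sup>2)"
    using h0 by (simp add: ip_self power_mult_distrib)
  finally show ?thesis by simp
qed

lemma heat_op_L2:
  assumes t: "t > 0" and u: "u \<in> L2" shows "heat_op t u \<in> L2"
proof -
  have "integrable lborel (\<lambda>x. LINT y|lborel. heat t (x - y) * (u y)\<^sup>2)"
    using lborel_pair.integrable_fst[OF heat_conv_integrable(2)[OF t L2_sq[OF u]]] .
  then have "integrable lborel (\<lambda>x. (heat_op t u x)\<^sup>2)"
    by (rule Bochner_Integration.integrable_bound)
       (use heat_op_measurable[OF t u] heat_op_sq_le[OF t u] in \<open>auto intro!: AE_I2 order.trans[OF _ abs_ge_self]\<close>)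
  then show ?thesis using heat_op_measurable[OF t u] by (simp add: L2_def)
qed

lemma ip_heat_op:
  assumes "t > 0" "u \<in> L2" "v \<in> L2"
  shows "ip u (heat_op t v) = (LINT x|lborel. LINT y|lborel. heat t (x - y) * (u x * v y))"
  unfolding ip_def heat_op_def by (simp add: mult.left_commute)

lemma heat_op_symmetric:
  assumes "t > 0" "u \<in> L2" "v \<in> L2" shows "ip u (heat_op t v) = ip (heat_op t u) v"
proof -
  have "ip u (heat_op t v) = (LINT y|lborel. LINT x|lborel. heat t (x - y) * (u x * v y))"
    using lborel_pair.Fubini_integral[OF heat_form_integrable[OF assms]] ip_heat_op[OF assms] by simp
  also have "\<dots> = ip v (heat_op t u)"
    unfolding ip_heat_op[OF assms(1,3,2)] by (simp add: heat_commute mult.commute)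
  finally show ?thesis by (simp add: ip_commute)
qed

lemma heat_op_semigroup:
  assumes t: "t > 0" and u: "u \<in> L2" shows "heat_op t (heat_op t u) x = heat_op (2 * t) u x"
proof -
  have "heat_op t (heat_op t u) x = (LINT y|lborel. LINT z|lborel. heat t (y - z) * (heat t (x - y) * u z))"
    unfolding heat_op_def[of t "heat_op t u"] by (rule ip_heat_op[OF t heat_reflect_translate_L2[OF t] u])
  also have "\<dots> = (LINT z|lborel. LINT y|lborel. heat t (y - z) * (heat t (x - y) * u z))"
    using lborel_pair.Fubini_integral[OF heat_form_integrable[OF t heat_reflect_translate_L2[OF t, of x] u]] by simp
  also have "\<dots> = (LINT z|lborel. (LINT y|lborel. heat t (x - y) * heat t (y - z)) * u z)"
    by (simp add: mult_ac)
  also have "\<dots> = heat_op (2 * t) u x" by (simp add: heat_semigroup[OF t] heat_op_def ip_def)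
  finally show ?thesis .
qed

section \<open>The heat defect and its bound by the Dirichlet form\<close>

definition heat_defect :: "real \<Rightarrow> ('a::euclidean_space \<Rightarrow> real) \<Rightarrow> real" where
  "heat_defect t u = ip u u - ip u (heat_op t u)"

text \<open>Symmetry and the semigroup law turn |P_t u|^2 into (u, P_2t u).\<close>

lemma heat_op_residual:
  assumes t: "t > 0" and u: "u \<in> L2"
  shows "ip (\<lambda>x. u x - heat_op t u x) (\<lambda>x. u x - heat_op t u x) = 2 * heat_defect t u - heat_defect (2 * t) u"
proof -
  have "ip (heat_op t u) (heat_op t u) = ip u (heat_op t (heat_op t u))"
    by (rule heat_op_symmetric[OF t u heat_op_L2[OF t u], symmetric])
  also have "heat_op t (heat_op t u) = heat_op (2 * t) u" using heat_op_semigroup[OF t u] by auto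
  finally show ?thesis
    by (simp add: ip_diff_self u heat_op_L2[OF t u] heat_defect_def)
qed

text \<open>As the kernel has mass 1, the double integral of heat t (x - y) (u x - u y)^2 is twice
  the defect. The substitution x = y + z and Fubini bring it into a form that is visibly nonnegative
  and to which \<open>translation_bound\<close> applies.\<close>

lemma heat_defect_eq:
  assumes t: "t > 0" and u: "u \<in> L2"
  shows "heat_defect t u = (LINT z|lborel. heat t z * ip (\<lambda>y. u (y + z) - u y) (\<lambda>y. u (y + z) - u y)) / 2"
    "integrable lborel (\<lambda>z. heat t z * ip (\<lambda>y. u (y + z) - u y) (\<lambda>y. u (y + z) - u y))"
proof -
  have um[measurable]: "u \<in> borel_measurable borel" using u by measurable
  note I1 = heat_conv_integrable(1)[OF t L2_sq[OF u]] and I2 = heat_conv_integrable(2)[OF t L2_sq[OF u]]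
    and I3 = heat_form_integrable[OF t u u]
  have ui: "integrable lborel (\<lambda>x. (u x)\<^sup>2)" by (rule L2_sq[OF u])
  let ?F = "\<lambda>z. (case z of (x, y) \<Rightarrow> heat t (x - y) * (u x)\<^sup>2) + (case z of (x, y) \<Rightarrow> heat t (x - y) * (u y)\<^sup>2)
       - 2 * (case z of (x, y) \<Rightarrow> heat t (x - y) * (u x * u y))"
  have FI: "integrable (lborel \<Otimes>\<^sub>M lborel) ?F"
    by (intro Bochner_Integration.integrable_diff Bochner_Integration.integrable_add integrable_mult_right I1 I2 I3)
  have Feq: "?F = (\<lambda>(x, y). heat t (x - y) * (u x - u y)\<^sup>2)"
    by (auto simp: fun_eq_iff power2_eq_square algebra_simps)
  have FI': "integrable (lborel \<Otimes>\<^sub>M lborel) (\<lambda>(x, y). heat t (x - y) * (u x - u y)\<^sup>2)"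
    using FI unfolding Feq .
  have "integral\<^sup>L (lborel \<Otimes>\<^sub>M lborel) ?F = integral\<^sup>L (lborel \<Otimes>\<^sub>M lborel) (\<lambda>(x, y). heat t (x - y) * (u x)\<^sup>2)
     + integral\<^sup>L (lborel \<Otimes>\<^sub>M lborel) (\<lambda>(x, y). heat t (x - y) * (u y)\<^sup>2)
     - 2 * integral\<^sup>L (lborel \<Otimes>\<^sub>M lborel) (\<lambda>(x, y). heat t (x - y) * (u x * u y))"
    using I1 I2 I3 by simp
  also have "integral\<^sup>L (lborel \<Otimes>\<^sub>M lborel) (\<lambda>(x, y). heat t (x - y) * (u x)\<^sup>2) = ip u u"
    unfolding lborel_pair.integral_fst[OF I1, symmetric] by (simp add: ip_self heat_translate_integral[OF t])
  also have "integral\<^sup>L (lborel \<Otimes>\<^sub>M lborel) (\<lambda>(x, y). heat t (x - y) * (u y)\<^sup>2) = ip u u"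
    unfolding lborel_pair.integral_snd[OF I2, symmetric] by (simp add: ip_self heat_translate_integral[OF t])
  also have "integral\<^sup>L (lborel \<Otimes>\<^sub>M lborel) (\<lambda>(x, y). heat t (x - y) * (u x * u y)) = ip u (heat_op t u)"
    using lborel_pair.integral_fst[OF I3] ip_heat_op[OF t u u] by simp
  finally have e1: "integral\<^sup>L (lborel \<Otimes>\<^sub>M lborel) (\<lambda>(x, y). heat t (x - y) * (u x - u y)\<^sup>2) = 2 * heat_defect t u"
    unfolding Feq heat_defect_def by simp
  have "(LINT y|lborel. LINT x|lborel. heat t (x - y) * (u x - u y)\<^sup>2) = 2 * heat_defect t u"
    using lborel_pair.integral_snd[OF FI'] e1 by simp
  moreover have "(LINT x|lborel. heat t (x - y) * (u x - u y)\<^sup>2) = (LINT z|lborel. heat t z * (u (y + z) - u y)\<^sup>2)" for y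
    using integral_translate[of "\<lambda>x. heat t (x - y) * (u x - u y)\<^sup>2" y] by (simp add: add.commute)
  ultimately have e2: "(LINT y|lborel. LINT z|lborel. heat t z * (u (y + z) - u y)\<^sup>2) = 2 * heat_defect t u" by simp
  have m1: "(\<lambda>z::'a\<times>'a. u (fst z + snd z)) \<in> borel_measurable (lborel \<Otimes>\<^sub>M lborel)"
    by (intro pair_measurable_comp um continuous_intros)
  then have m: "(\<lambda>(y, z). heat t z * (u (y + z) - u y)\<^sup>2) \<in> borel_measurable (lborel \<Otimes>\<^sub>M lborel)"
    by (simp add: case_prod_beta)
  have J: "integrable (lborel \<Otimes>\<^sub>M lborel) (\<lambda>(y, z). heat t z * (u (y + z) - u y)\<^sup>2)"
  proof (rule lborel_pair.Fubini_integrable[OF m])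
    have "(LINT z|lborel. norm (case (y, z) of (y, z) \<Rightarrow> heat t z * (u (y + z) - u y)\<^sup>2)) = (LINT x|lborel. heat t (x - y) * (u x - u y)\<^sup>2)" for y
      using integral_translate[of "\<lambda>x. heat t (x - y) * (u x - u y)\<^sup>2" y] abs_of_nonneg[OF heat_nonneg[OF t, where 'a='a]]
      by (simp add: add.commute abs_mult)
    then show "integrable lborel (\<lambda>y. LINT z|lborel. norm (case (y, z) of (y, z) \<Rightarrow> heat t z * (u (y + z) - u y)\<^sup>2))"
      using lborel_pair.integrable_snd[OF FI'] by simp
    show "AE y in lborel. integrable lborel (\<lambda>z. case (y, z) of (y, z) \<Rightarrow> heat t z * (u (y + z) - u y)\<^sup>2)"
      using lborel_pair.AE_integrable_snd[OF FI']
    proof eventually_elim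
      case (elim y)
      then show ?case using integrable_translate[OF elim, of y] by (simp add: add.commute)
    qed
  qed
  show "heat_defect t u = (LINT z|lborel. heat t z * ip (\<lambda>y. u (y + z) - u y) (\<lambda>y. u (y + z) - u y)) / 2"
    using lborel_pair.Fubini_integral[OF J] e2 by (simp add: ip_self)
  show "integrable lborel (\<lambda>z. heat t z * ip (\<lambda>y. u (y + z) - u y) (\<lambda>y. u (y + z) - u y))"
    using lborel_pair.integrable_snd[OF J] by (simp add: ip_self)
qed

lemma heat_defect_nonneg: "t > 0 \<Longrightarrow> u \<in> L2 \<Longrightarrow> 0 \<le> heat_defect t u"
  by (simp add: heat_defect_eq Bochner_Integration.integral_nonneg heat_nonneg ip_self_nonneg)

text \<open>The translation bound is integrated against the second moment of the kernel; the 4 is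
  half of the 8 in \<open>heat_second_moment\<close>.\<close>

lemma heat_defect_le:
  fixes u :: "real^'d \<Rightarrow> real"
  assumes t: "t > 0" and u: "u \<in> H1r"
  shows "heat_defect t u \<le> 4 * 2 powr (CARD('d) / 2) * t * dform u u"
proof -
  have uL: "u \<in> L2" by (rule H1r_L2[OF u])
  have "(LINT z|lborel. heat t z * ip (\<lambda>y. u (y + z) - u y) (\<lambda>y. u (y + z) - u y)) \<le>
     (LINT z|lborel. heat t (z::real^'d) * (norm z)\<^sup>2 * dform u u)"
  proof (rule integral_mono[OF heat_defect_eq(2)[OF t uL]])
    show "integrable lborel (\<lambda>z::real^'d. heat t z * (norm z)\<^sup>2 * dform u u)"
      by (intro integrable_mult_left heat_second_moment(1)[OF t])
    show "heat t z * ip (\<lambda>y. u (y + z) - u y) (\<lambda>y. u (y + z) - u y) \<le> heat t z * (norm z)\<^sup>2 * dform u u" for z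
      unfolding mult.assoc by (intro mult_left_mono translation_bound[OF u] heat_nonneg[OF t])
  qed
  also have "\<dots> = (LINT z|lborel. heat t (z::real^'d) * (norm z)\<^sup>2) * dform u u" by simp
  also have "\<dots> \<le> 8 * 2 powr (DIM(real^'d) / 2) * t * dform u u"
    by (intro mult_right_mono heat_second_moment(2)[OF t] dform_self_nonneg)
  finally show ?thesis by (simp add: heat_defect_eq(1)[OF t uL])
qed

text \<open>The sum telescopes: the residual at time \<open>t\<close> is \<open>2 g(t) - g(2 t)\<close> for the defect \<open>g\<close>, and
  \<open>g(t) / t\<close> is bounded by the Dirichlet form.\<close>

lemma heat_residual_sum:
  fixes u :: "real^'d \<Rightarrow> real"
  assumes s: "s > 0" and u: "u \<in> H1r"
  shows "(\<Sum>j<m. ip (\<lambda>x. u x - heat_op (2 ^ j * s) u x) (\<lambda>x. u x - heat_op (2 ^ j * s) u x) / (2 ^ j * s))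
     \<le> 8 * 2 powr (CARD('d) / 2) * dform u u"
proof -
  have uL: "u \<in> L2" by (rule H1r_L2[OF u])
  define a where "a = (\<lambda>j::nat. heat_defect (2 ^ j * s) u / (2 ^ j * s))"
  have "(\<Sum>j<m. ip (\<lambda>x. u x - heat_op (2 ^ j * s) u x) (\<lambda>x. u x - heat_op (2 ^ j * s) u x) / (2 ^ j * s)) =
     (\<Sum>j<m. 2 * a j - 2 * a (Suc j))"
  proof (rule sum.cong[OF refl])
    fix j
    have "ip (\<lambda>x. u x - heat_op (2 ^ j * s) u x) (\<lambda>x. u x - heat_op (2 ^ j * s) u x) =
       2 * heat_defect (2 ^ j * s) u - heat_defect (2 * (2 ^ j * s)) u"
      by (rule heat_op_residual[OF _ uL]) (use s in simp)
    then show "ip (\<lambda>x. u x - heat_op (2 ^ j * s) u x) (\<lambda>x. u x - heat_op (2 ^ j * s) u x) / (2 ^ j * s) = 2 * a j - 2 * a (Suc j)"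
      using s by (simp add: a_def field_simps)
  qed
  also have "\<dots> = 2 * a 0 - 2 * a m" by (rule sum_lessThan_telescope')
  also have "\<dots> \<le> 2 * a 0" using heat_defect_nonneg[OF _ uL, of "2 ^ m * s"] s by (simp add: a_def)
  also have "\<dots> \<le> 8 * 2 powr (CARD('d) / 2) * dform u u"
    using heat_defect_le[OF s u] s by (simp add: a_def field_simps)
  finally show ?thesis .
qed

lemma heat_residual_le:
  fixes u :: "real^'d \<Rightarrow> real"
  assumes t: "t > 0" and u: "u \<in> H1r"
  shows "ip (\<lambda>x. u x - heat_op t u x) (\<lambda>x. u x - heat_op t u x) \<le> 8 * 2 powr (CARD('d) / 2) * t * dform u u"
  using heat_residual_sum[OF t u, of 1] t by (simp add: field_simps)

text \<open>The summands are squared coefficients of the kernel centred at x, so the bound is the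
  squared norm of that kernel and does not grow with F.\<close>

lemma heat_op_sum_sq_le:
  fixes x :: "'a::euclidean_space"
  assumes "t > 0" "orthonormal_on F u" "finite F"
  shows "(\<Sum>i\<in>F. (heat_op t (u i) x)\<^sup>2) \<le> heat (2 * t) (0::'a)"
  using Bessel_inequality[OF assms(2,3) heat_reflect_translate_L2[OF assms(1), of x]]
  by (simp add: heat_op_def heat_ip_self[OF assms(1)])

section \<open>The dual Lieb-Thirring inequality\<close>

definition heat_const :: "'d::finite itself \<Rightarrow> real" where
  "heat_const T = 8 powr (- (CARD('d) / 2)) / gint TYPE(real^'d) 1"

lemma heat_const_pos: "heat_const TYPE('d::finite) > 0"
  unfolding heat_const_def by (intro divide_pos_pos gint_pos) auto

lemma heat_double_0:
  "t > 0 \<Longrightarrow> heat (2 * t) (0::real^'d) = heat_const TYPE('d) * t powr (- (CARD('d) / 2))"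
  by (simp add: heat_0 heat_const_def powr_mult)

definition wdens :: "real \<Rightarrow> 'i set \<Rightarrow> ('i \<Rightarrow> real) \<Rightarrow> ('i \<Rightarrow> 'a \<Rightarrow> real) \<Rightarrow> 'a \<Rightarrow> real" where
  "wdens \<gamma> F \<kappa> u x = (\<Sum>i\<in>F. \<kappa> i powr (\<gamma> - 1) * (u i x)\<^sup>2)"

lemma wdens_nonneg: "0 \<le> wdens \<gamma> F \<kappa> u x"
  by (simp add: wdens_def sum_nonneg)

lemma wdens_measurable:
  "(\<And>i. i \<in> F \<Longrightarrow> u i \<in> borel_measurable borel) \<Longrightarrow> wdens \<gamma> F \<kappa> u \<in> borel_measurable borel"
  unfolding wdens_def[abs_def] by (intro borel_measurable_sum borel_measurable_times borel_measurable_power) auto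

text \<open>Low frequencies of the modes with \<open>\<kappa> \<le> 1/t\<close> are controlled by Bessel's inequality, their high
  frequencies by the residual, and the modes with \<open>\<kappa> > 1/t\<close> by the last sum.\<close>

lemma wdens_pointwise:
  fixes u :: "'i \<Rightarrow> real^'d \<Rightarrow> real"
  assumes g: "\<gamma> \<ge> 1" and F: "finite F" and on: "orthonormal_on F u" and \<kappa>: "\<And>i. i \<in> F \<Longrightarrow> \<kappa> i > 0" and t: "t > 0"
  shows "wdens \<gamma> F \<kappa> u x \<le> 2 * heat_const TYPE('d) * t powr (- (\<gamma> + CARD('d) / 2 - 1))
     + 2 * (\<Sum>i\<in>F. \<kappa> i powr (\<gamma> - 1) * (u i x - heat_op t (u i) x)\<^sup>2) + t * (\<Sum>i\<in>F. \<kappa> i powr \<gamma> * (u i x)\<^sup>2)"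
proof -
  have single: "\<kappa> i powr (\<gamma> - 1) * (u i x)\<^sup>2 \<le> 2 * t powr (1 - \<gamma>) * (heat_op t (u i) x)\<^sup>2 +
     2 * (\<kappa> i powr (\<gamma> - 1) * (u i x - heat_op t (u i) x)\<^sup>2) + t * (\<kappa> i powr \<gamma> * (u i x)\<^sup>2)" if i: "i \<in> F" for i
  proof (cases "\<kappa> i \<le> 1 / t")
    case True
    define a b where "a = heat_op t (u i) x" and "b = u i x - heat_op t (u i) x"
    have "(u i x)\<^sup>2 = (a + b)\<^sup>2" by (simp add: a_def b_def)
    also have "\<dots> \<le> 2 * a\<^sup>2 + 2 * b\<^sup>2"
      using sum_squares_bound[of a b] by (simp add: power2_sum)
    finally have "\<kappa> i powr (\<gamma> - 1) * (u i x)\<^sup>2 \<le> \<kappa> i powr (\<gamma> - 1) * (2 * a\<^sup>2 + 2 * b\<^sup>2)"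
      by (intro mult_left_mono) auto
    also have "\<dots> = 2 * (\<kappa> i powr (\<gamma> - 1) * a\<^sup>2) + 2 * (\<kappa> i powr (\<gamma> - 1) * b\<^sup>2)" by (simp add: algebra_simps)
    also have "\<kappa> i powr (\<gamma> - 1) * a\<^sup>2 \<le> t powr (1 - \<gamma>) * a\<^sup>2"
    proof (intro mult_right_mono)
      have "\<kappa> i powr (\<gamma> - 1) \<le> (1 / t) powr (\<gamma> - 1)" using True \<kappa>[OF i] g by (intro powr_mono2) auto
      also have "\<dots> = t powr (1 - \<gamma>)" using t powr_divide[of 1 t "\<gamma> - 1"] powr_minus_divide[of t "\<gamma> - 1"] by simp
      finally show "\<kappa> i powr (\<gamma> - 1) \<le> t powr (1 - \<gamma>)" .
    qed simp
    finally have "\<kappa> i powr (\<gamma> - 1) * (u i x)\<^sup>2 \<le> 2 * (t powr (1 - \<gamma>) * a\<^sup>2) + 2 * (\<kappa> i powr (\<gamma> - 1) * b\<^sup>2)" by simp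
    moreover have "0 \<le> t * (\<kappa> i powr \<gamma> * (u i x)\<^sup>2)" using t by simp
    ultimately show ?thesis by (simp add: a_def b_def)
  next
    case False
    then have "1 \<le> t * \<kappa> i" using t by (simp add: field_simps)
    then have "\<kappa> i powr (\<gamma> - 1) * (u i x)\<^sup>2 \<le> (t * \<kappa> i) * (\<kappa> i powr (\<gamma> - 1) * (u i x)\<^sup>2)"
      by (intro mult_right_mono[of 1 "t * \<kappa> i", simplified]) auto
    also have "\<dots> = t * (\<kappa> i powr \<gamma> * (u i x)\<^sup>2)"
      using \<kappa>[OF i] powr_mult_base[of "\<kappa> i" "\<gamma> - 1"] by (simp add: mult_ac)
    finally have "\<kappa> i powr (\<gamma> - 1) * (u i x)\<^sup>2 \<le> t * (\<kappa> i powr \<gamma> * (u i x)\<^sup>2)" .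
    moreover have "0 \<le> 2 * t powr (1 - \<gamma>) * (heat_op t (u i) x)\<^sup>2" by simp
    moreover have "0 \<le> 2 * (\<kappa> i powr (\<gamma> - 1) * (u i x - heat_op t (u i) x)\<^sup>2)" by simp
    ultimately show ?thesis by linarith
  qed
  have "wdens \<gamma> F \<kappa> u x \<le> (\<Sum>i\<in>F. 2 * t powr (1 - \<gamma>) * (heat_op t (u i) x)\<^sup>2 +
     2 * (\<kappa> i powr (\<gamma> - 1) * (u i x - heat_op t (u i) x)\<^sup>2) + t * (\<kappa> i powr \<gamma> * (u i x)\<^sup>2))"
    unfolding wdens_def by (intro sum_mono single)
  also have "\<dots> = 2 * t powr (1 - \<gamma>) * (\<Sum>i\<in>F. (heat_op t (u i) x)\<^sup>2) +
     2 * (\<Sum>i\<in>F. \<kappa> i powr (\<gamma> - 1) * (u i x - heat_op t (u i) x)\<^sup>2) + t * (\<Sum>i\<in>F. \<kappa> i powr \<gamma> * (u i x)\<^sup>2)"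
    by (simp add: sum.distrib sum_distrib_left)
  also have "2 * t powr (1 - \<gamma>) * (\<Sum>i\<in>F. (heat_op t (u i) x)\<^sup>2) \<le>
      2 * t powr (1 - \<gamma>) * (heat_const TYPE('d) * t powr (- (CARD('d) / 2)))"
    using heat_op_sum_sq_le[OF t on F, of x] unfolding heat_double_0[OF t] by (intro mult_left_mono) auto
  also have "\<dots> = 2 * heat_const TYPE('d) * t powr (- (\<gamma> + CARD('d) / 2 - 1))"
    by (simp add: powr_add[symmetric] algebra_simps)
  finally show ?thesis by simp
qed

text \<open>The times 2^(j - N) with j at most 2N fill the dyadic grid from 2^(-N) to 2^N, and
  rounding log 2 y upwards costs at most a factor 2.\<close>

lemma dyadic_time:
  fixes y :: real assumes "y > 0"
  obtains N0 where "\<And>N::nat. N \<ge> N0 \<Longrightarrow> \<exists>j < 2 * N + 1. y \<le> 2 ^ j * (1 / 2 ^ N) \<and> 2 ^ j * (1 / 2 ^ N) \<le> 2 * y"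
proof -
  define k where "k = \<lceil>log 2 y\<rceil>"
  have k1: "y \<le> 2 powr k"
  proof -
    have "y = 2 powr (log 2 y)" using assms by simp
    also have "\<dots> \<le> 2 powr k" unfolding k_def by (intro powr_mono) auto
    finally show ?thesis .
  qed
  have k2: "2 powr k \<le> 2 * y"
  proof -
    have "real_of_int k \<le> log 2 y + 1" unfolding k_def by linarith
    then have "2 powr k \<le> 2 powr (log 2 y + 1)" by (intro powr_mono) auto
    also have "\<dots> = 2 * y" using assms by (simp add: powr_add)
    finally show ?thesis .
  qed
  show thesis
  proof (rule that[of "nat \<bar>k\<bar>"])
    fix N :: nat assume N: "nat \<bar>k\<bar> \<le> N"
    define j where "j = nat (k + int N)"
    have j: "int j = k + int N" "j < 2 * N + 1" using N by (auto simp: j_def)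
    have "2 ^ j * (1 / 2 ^ N) = 2 powr (real j - real N)" by (simp add: powr_diff powr_realpow)
    also have "real j - real N = k" using j(1) by linarith
    finally show "\<exists>j < 2 * N + 1. y \<le> 2 ^ j * (1 / 2 ^ N) \<and> 2 ^ j * (1 / 2 ^ N) \<le> 2 * y"
      using k1 k2 j(2) by (intro exI[of _ j]) simp
  qed
qed

text \<open>The first two factors come from expressing a power of the density through the chosen
  time. In the last factor, 16 * 2^(d/2) is twice the constant of \<open>heat_residual_sum\<close>,
  and the 1 accounts for the eigenvalue sum.\<close>

definition dual_const :: "'d::finite itself \<Rightarrow> real \<Rightarrow> real" where
  "dual_const T \<gamma> = 4 * (4 * heat_const T) powr (1 / (\<gamma> + CARD('d) / 2 - 1)) * (16 * 2 powr (CARD('d) / 2) + 1)"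

lemma dual_const_pos: "dual_const TYPE('d::finite) \<gamma> > 0"
  unfolding dual_const_def using heat_const_pos[where 'd='d] by (intro mult_pos_pos add_pos_pos) auto

text \<open>For t beyond a threshold fixed by the density at x, the Bessel term of
  \<open>wdens_pointwise\<close> is at most half of the density and can be absorbed. With t
  comparable to that threshold, rho^(p/(p-1)) is comparable to rho/t, and the remaining terms
  divided by t integrate to the kinetic and the eigenvalue sum.\<close>

theorem dual_Lieb_Thirring:
  fixes u :: "'i \<Rightarrow> real^'d \<Rightarrow> real" and \<gamma> :: real
  defines "p \<equiv> \<gamma> + CARD('d) / 2"
  assumes g: "\<gamma> \<ge> 1" and F: "finite F" and on: "orthonormal_on F u" and H: "\<And>i. i \<in> F \<Longrightarrow> u i \<in> H1r"
    and \<kappa>: "\<And>i. i \<in> F \<Longrightarrow> \<kappa> i > 0"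
  shows "integrable lborel (\<lambda>x. wdens \<gamma> F \<kappa> u x powr (p / (p - 1)))"
    and "(LINT x|lborel. wdens \<gamma> F \<kappa> u x powr (p / (p - 1))) \<le>
      dual_const TYPE('d) \<gamma> * ((\<Sum>i\<in>F. \<kappa> i powr (\<gamma> - 1) * dform (u i) (u i)) + (\<Sum>i\<in>F. \<kappa> i powr \<gamma>))"
proof -
  let ?\<rho> = "wdens \<gamma> F \<kappa> u"
  have uL: "u i \<in> L2" if "i \<in> F" for i using H1r_L2[OF H[OF that]] .
  have um: "u i \<in> borel_measurable borel" if "i \<in> F" for i using uL[OF that] by measurable
  have \<rho>m[measurable]: "?\<rho> \<in> borel_measurable borel" by (rule wdens_measurable[OF um])
  have p1: "p - 1 > 0" using g zero_less_card_finite[where 'a='d] unfolding p_def by linarith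
  define c where "c = heat_const TYPE('d)"
  have c: "c > 0" unfolding c_def by (rule heat_const_pos)
  define K where "K = 4 * (4 * c) powr (1 / (p - 1))"
  have K: "K > 0" using c by (simp add: K_def)
  define R where "R = (\<lambda>t x. \<Sum>i\<in>F. \<kappa> i powr (\<gamma> - 1) * (u i x - heat_op t (u i) x)\<^sup>2)"
  define S where "S = (\<lambda>x. \<Sum>i\<in>F. \<kappa> i powr \<gamma> * (u i x)\<^sup>2)"
  \<comment> \<open>The suitable time depends on x, so all dyadic times of stage N are summed;
    telescoping bounds the integral uniformly in N.\<close>
  define Q where "Q = (\<lambda>(N::nat) x. K * (2 * (\<Sum>j<2 * N + 1. R (2 ^ j * (1 / 2 ^ N)) x / (2 ^ j * (1 / 2 ^ N))) + S x))"
  have R0: "0 \<le> R t x" for t x unfolding R_def by (intro sum_nonneg) auto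
  have S0: "0 \<le> S x" for x unfolding S_def by (intro sum_nonneg) auto
  have Q0: "0 \<le> Q N x" for N x unfolding Q_def using K R0 S0
    by (intro mult_nonneg_nonneg add_nonneg_nonneg sum_nonneg divide_nonneg_pos) auto
  have ev: "\<exists>N0. \<forall>N\<ge>N0. ?\<rho> x powr (p / (p - 1)) \<le> Q N x" for x
  proof (cases "?\<rho> x = 0")
    case True then show ?thesis using Q0 by simp
  next
    case False
    then have \<rho>0: "?\<rho> x > 0" using wdens_nonneg[of \<gamma> F \<kappa> u x] by simp
    \<comment> \<open>The time at which the Bessel term is half of the density: 2 c y^(-(p - 1)) =
      rho/2.\<close>
    define y where "y = (?\<rho> x / (4 * c)) powr (- (1 / (p - 1)))"
    have y: "y > 0" using \<rho>0 c by (simp add: y_def)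
    obtain N0 where N0: "\<And>N::nat. N \<ge> N0 \<Longrightarrow> \<exists>j < 2 * N + 1. y \<le> 2 ^ j * (1 / 2 ^ N) \<and> 2 ^ j * (1 / 2 ^ N) \<le> 2 * y"
      using dyadic_time[OF y] by metis
    have "?\<rho> x powr (p / (p - 1)) \<le> Q N x" if N: "N \<ge> N0" for N
    proof -
      obtain j where j: "j < 2 * N + 1" "y \<le> 2 ^ j * (1 / 2 ^ N)" "2 ^ j * (1 / 2 ^ N) \<le> 2 * y"
        using N0[OF N] by auto
      define t where "t = (2 ^ j * (1 / 2 ^ N) :: real)"
      have t: "t > 0" "y \<le> t" "t \<le> 2 * y" using j by (auto simp: t_def)
      have "t powr (- (p - 1)) \<le> y powr (- (p - 1))"
        using t y p1 by (intro powr_mono2') auto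
      also have "\<dots> = ?\<rho> x / (4 * c)"
      proof -
        have e: "- (1 / (p - 1)) * - (p - 1) = 1" using p1 by (simp add: divide_simps)
        show ?thesis unfolding y_def powr_powr e using \<rho>0 c by simp
      qed
      finally have "4 * c * t powr (- (p - 1)) \<le> ?\<rho> x" using c by (simp add: field_simps)
      moreover have "?\<rho> x \<le> 2 * c * t powr (- (p - 1)) + 2 * R t x + t * S x"
        using wdens_pointwise[where x=x and \<kappa>=\<kappa>, OF g F on \<kappa> t(1)] by (simp add: c_def p_def R_def S_def)
      ultimately have "?\<rho> x / 2 \<le> 2 * R t x + t * S x" by linarith
      then have 1: "?\<rho> x / t \<le> 2 * (2 * (R t x / t) + S x)" using t by (simp add: field_simps)
      have "?\<rho> x powr (p / (p - 1)) = ?\<rho> x * ?\<rho> x powr (1 / (p - 1))"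
        using \<rho>0 p1 powr_mult_base[of "?\<rho> x" "1 / (p - 1)"] by (simp add: field_simps)
      also have "?\<rho> x powr (1 / (p - 1)) = (4 * c) powr (1 / (p - 1)) / y"
        using \<rho>0 c by (simp add: y_def powr_divide powr_minus field_simps)
      also have "?\<rho> x * ((4 * c) powr (1 / (p - 1)) / y) \<le> ?\<rho> x * ((4 * c) powr (1 / (p - 1)) * (2 / t))"
      proof -
        have "1 / y \<le> 2 / t" using t y by (simp add: field_simps)
        then have "(4 * c) powr (1 / (p - 1)) * (1 / y) \<le> (4 * c) powr (1 / (p - 1)) * (2 / t)"
          by (intro mult_left_mono) auto
        then show ?thesis using \<rho>0 by (intro mult_left_mono) auto
      qed
      also have "\<dots> = 2 * (4 * c) powr (1 / (p - 1)) * (?\<rho> x / t)" by simp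
      also have "\<dots> \<le> 2 * (4 * c) powr (1 / (p - 1)) * (2 * (2 * (R t x / t) + S x))"
        by (intro mult_left_mono 1) auto
      also have "\<dots> = K * (2 * (R t x / t) + S x)" by (simp add: K_def)
      also have "\<dots> \<le> Q N x"
      proof -
        have "R t x / t \<le> (\<Sum>j<2 * N + 1. R (2 ^ j * (1 / 2 ^ N)) x / (2 ^ j * (1 / 2 ^ N)))"
          unfolding t_def using j(1)
          by (intro member_le_sum[of j _ "\<lambda>j. R (2 ^ j * (1 / 2 ^ N)) x / (2 ^ j * (1 / 2 ^ N))"]) (auto simp: R0)
        then show ?thesis unfolding Q_def using K by (intro mult_left_mono) auto
      qed
      finally show ?thesis .
    qed
    then show ?thesis by blast
  qed
  let ?T = "\<Sum>i\<in>F. \<kappa> i powr (\<gamma> - 1) * dform (u i) (u i)" and ?K = "\<Sum>i\<in>F. \<kappa> i powr \<gamma>"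
  have T0: "0 \<le> ?T" by (intro sum_nonneg mult_nonneg_nonneg dform_self_nonneg) auto
  have K0: "0 \<le> ?K" by (intro sum_nonneg) auto
  have dL: "(\<lambda>x. u i x - heat_op t (u i) x) \<in> L2" if "i \<in> F" "t > 0" for i t
    by (intro L2_diff heat_op_L2 uL that)
  have Ri: "integrable lborel (R t)" and Rv: "(LINT x|lborel. R t x) =
     (\<Sum>i\<in>F. \<kappa> i powr (\<gamma> - 1) * ip (\<lambda>x. u i x - heat_op t (u i) x) (\<lambda>x. u i x - heat_op t (u i) x))" if "t > 0" for t
  proof -
    have i: "integrable lborel (\<lambda>x. \<kappa> i powr (\<gamma> - 1) * (u i x - heat_op t (u i) x)\<^sup>2)" if "i \<in> F" for i
      using L2_sq[OF dL[OF that \<open>t > 0\<close>]] by simp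
    then show "integrable lborel (R t)" unfolding R_def by (intro Bochner_Integration.integrable_sum)
    show "(LINT x|lborel. R t x) =
       (\<Sum>i\<in>F. \<kappa> i powr (\<gamma> - 1) * ip (\<lambda>x. u i x - heat_op t (u i) x) (\<lambda>x. u i x - heat_op t (u i) x))"
      unfolding R_def ip_self using i by (subst Bochner_Integration.integral_sum) auto
  qed
  have Si: "integrable lborel S" and Sv: "(LINT x|lborel. S x) = ?K"
  proof -
    have i: "integrable lborel (\<lambda>x. \<kappa> i powr \<gamma> * (u i x)\<^sup>2)" if "i \<in> F" for i
      using L2_sq[OF uL[OF that]] by simp
    then show "integrable lborel S" unfolding S_def by (intro Bochner_Integration.integrable_sum)
    have "(LINT x|lborel. S x) = (\<Sum>i\<in>F. \<kappa> i powr \<gamma> * ip (u i) (u i))"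
      unfolding S_def ip_self using i by (subst Bochner_Integration.integral_sum) auto
    also have "\<dots> = ?K" using on by (intro sum.cong) (auto simp: orthonormal_on_def)
    finally show "(LINT x|lborel. S x) = ?K" .
  qed
  have tp: "0 < (2 ^ j * (1 / 2 ^ N) :: real)" for j N :: nat by simp
  have Qi: "integrable lborel (Q N)" for N
    unfolding Q_def using Ri[OF tp] Si by (intro integrable_mult_right Bochner_Integration.integrable_add Bochner_Integration.integrable_sum integrable_divide) auto
  have Qv: "(LINT x|lborel. Q N x) \<le> dual_const TYPE('d) \<gamma> * (?T + ?K)" for N
  proof -
    let ?t = "\<lambda>j. 2 ^ j * (1 / 2 ^ N) :: real"
    have 1: "(LINT x|lborel. Q N x) = K * (2 * (\<Sum>j<2 * N + 1. (LINT x|lborel. R (?t j) x) / ?t j) + ?K)"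
      unfolding Q_def using Ri[OF tp] Si by (simp add: Sv del: power_Suc)
    have "(\<Sum>j<2 * N + 1. (LINT x|lborel. R (?t j) x) / ?t j) =
      (\<Sum>i\<in>F. \<kappa> i powr (\<gamma> - 1) * (\<Sum>j<2 * N + 1. ip (\<lambda>x. u i x - heat_op (?t j) (u i) x)
         (\<lambda>x. u i x - heat_op (?t j) (u i) x) / ?t j))"
    proof -
      have "(\<Sum>j\<in>J. (\<Sum>i\<in>F. k i * a i j) / b j) = (\<Sum>i\<in>F. k i * (\<Sum>j\<in>J. a i j / b j))"
        for J :: "nat set" and k :: "'i \<Rightarrow> real" and a b
        unfolding sum_divide_distrib sum_distrib_left times_divide_eq_right by (rule sum.swap)
      then show ?thesis unfolding Rv[OF tp] .
    qed
    also have "\<dots> \<le> (\<Sum>i\<in>F. \<kappa> i powr (\<gamma> - 1) * (8 * 2 powr (CARD('d) / 2) * dform (u i) (u i)))"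
    proof (rule sum_mono)
      fix i assume i: "i \<in> F"
      have "0 < (1 / 2 ^ N :: real)" by simp
      then show "\<kappa> i powr (\<gamma> - 1) * (\<Sum>j<2 * N + 1. ip (\<lambda>x. u i x - heat_op (?t j) (u i) x)
         (\<lambda>x. u i x - heat_op (?t j) (u i) x) / ?t j) \<le> \<kappa> i powr (\<gamma> - 1) * (8 * 2 powr (CARD('d) / 2) * dform (u i) (u i))"
        by (rule mult_left_mono[OF heat_residual_sum[OF _ H[OF i]]]) simp
    qed
    also have "\<dots> = 8 * 2 powr (CARD('d) / 2) * ?T"
      unfolding sum_distrib_left by (rule sum.cong) (simp_all only: mult_ac)
    finally have "(LINT x|lborel. Q N x) \<le> K * (2 * (8 * 2 powr (CARD('d) / 2) * ?T) + ?K)"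
      unfolding 1 using K by (intro mult_left_mono add_right_mono) auto
    also have "\<dots> \<le> K * ((16 * 2 powr (CARD('d) / 2) + 1) * (?T + ?K))"
      using K T0 K0 by (intro mult_left_mono) (auto simp: algebra_simps)
    also have "\<dots> = dual_const TYPE('d) \<gamma> * (?T + ?K)" by (simp add: K_def dual_const_def c_def p_def)
    finally show ?thesis .
  qed
  have Qn: "(\<integral>\<^sup>+x. ennreal (Q N x) \<partial>lborel) \<le> ennreal (dual_const TYPE('d) \<gamma> * (?T + ?K))" for N
    using nn_integral_eq_integral[OF Qi[of N]] Q0 Qv[of N] by (auto intro: ennreal_leI)
  \<comment> \<open>The stage from which \<open>Q N\<close> dominates depends on x, which is why
    Fatou's lemma is applied to the sequence \<open>Q\<close>.\<close>
  have "(\<integral>\<^sup>+x. ennreal (?\<rho> x powr (p / (p - 1))) \<partial>lborel) \<le> (\<integral>\<^sup>+x. liminf (\<lambda>N. ennreal (Q N x)) \<partial>lborel)"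
  proof (rule nn_integral_mono)
    fix x
    show "ennreal (?\<rho> x powr (p / (p - 1))) \<le> liminf (\<lambda>N. ennreal (Q N x))"
      using ev[of x] by (intro Liminf_bounded) (auto simp: eventually_sequentially intro: ennreal_leI)
  qed
  also have "\<dots> \<le> liminf (\<lambda>N. \<integral>\<^sup>+x. ennreal (Q N x) \<partial>lborel)"
    using Qi by (intro nn_integral_liminf) auto
  also have "\<dots> \<le> ennreal (dual_const TYPE('d) \<gamma> * (?T + ?K))"
    by (rule Liminf_le) (use Qn in auto)
  finally have fin: "(\<integral>\<^sup>+x. ennreal (?\<rho> x powr (p / (p - 1))) \<partial>lborel) \<le> ennreal (dual_const TYPE('d) \<gamma> * (?T + ?K))" .
  show int: "integrable lborel (\<lambda>x. ?\<rho> x powr (p / (p - 1)))"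
    by (rule integrableI_nonneg) (use fin in \<open>auto intro: le_less_trans\<close>)
  show "(LINT x|lborel. ?\<rho> x powr (p / (p - 1))) \<le> dual_const TYPE('d) \<gamma> * (?T + ?K)"
    using fin nn_integral_eq_integral[OF int] dual_const_pos[where 'd='d, of \<gamma>] T0 K0 by (simp add: ennreal_le_iff)
qed

section \<open>Potentials as form perturbations\<close>

text \<open>Young's inequality after rescaling b by s = eps^(1/q), which places the small constant
  in front of b; the factors 1/p and 1/q are bounded by 1.\<close>

lemma Young_eps:
  fixes a b p \<epsilon> :: real
  assumes p: "p > 1" and e: "\<epsilon> > 0" and ab: "a \<ge> 0" "b \<ge> 0"
  shows "a * b \<le> \<epsilon> * b powr (p / (p - 1)) + \<epsilon> powr (- (p - 1)) * a powr p"
proof -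
  define q where "q = p / (p - 1)"
  have q: "q > 1" "1 / p + 1 / q = 1" using p by (auto simp: q_def field_simps)
  define s where "s = \<epsilon> powr (1 / q)"
  have s: "s > 0" using e by (simp add: s_def)
  have sq: "s powr q = \<epsilon>" using e q by (simp add: s_def powr_powr)
  have sp: "(1 / s) powr p = \<epsilon> powr (- (p - 1))"
  proof -
    have "(1 / s) powr p = s powr (- p)" using s powr_divide[of 1 s p] by (simp add: powr_minus_divide)
    also have "\<dots> = \<epsilon> powr (1 / q * (- p))" by (simp add: s_def powr_powr)
    also have "1 / q * (- p) = - (p - 1)" using p by (simp add: q_def)
    finally show ?thesis .
  qed
  have "a * b = (a * (1 / s)) * (b * s)" using s by simp
  also have "\<dots> \<le> (a * (1 / s)) powr p / p + (b * s) powr q / q"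
    by (rule Youngs_inequality[OF p q]) (use ab s in auto)
  also have "\<dots> \<le> (a * (1 / s)) powr p + (b * s) powr q"
  proof -
    have "X / r \<le> X" if "r > 1" "X \<ge> 0" for X r :: real
      using that by (simp add: divide_le_eq mult_left_le_one_le[of X "1/r"] mult_le_cancel_left1)
    then show ?thesis using p q by (intro add_mono) auto
  qed
  also have "\<dots> = a powr p * (1 / s) powr p + b powr q * s powr q"
    using ab s powr_mult[of a "1 / s" p] powr_mult[of b s q] by simp
  also have "\<dots> = \<epsilon> * b powr q + \<epsilon> powr (- (p - 1)) * a powr p" unfolding sp sq by simp
  finally show ?thesis by (simp add: q_def)
qed

definition Lpi :: "real \<Rightarrow> (real^'d \<Rightarrow> real) \<Rightarrow> real" where
  "Lpi p V = (LINT x|lborel. \<bar>V x\<bar> powr p)"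

lemma Lp_real_iff: "V \<in> Lp p \<longleftrightarrow> V \<in> borel_measurable borel \<and> integrable lborel (\<lambda>x. \<bar>V x\<bar> powr p)"
  for V :: "real^'d \<Rightarrow> real"
  by (simp add: Lp_def)

lemma Lp_real_measurable[measurable_dest]: "V \<in> Lp p \<Longrightarrow> V \<in> borel_measurable borel"
  for V :: "real^'d \<Rightarrow> real"
  by (simp add: Lp_real_iff)

lemma Lpi_nonneg: "0 \<le> Lpi p V" by (simp add: Lpi_def)

text \<open>The type token carries the dimension, on which \<open>p\<close> and \<open>C\<close>
  depend although their types do not show it. Keeping both as parameters prevents their values from
  being unfolded.\<close>

locale exponents =
  fixes \<gamma> :: real and p :: real and C :: real and T :: "'d::finite itself"
  assumes gamma: "\<gamma> \<ge> 1" and p_eq: "p = \<gamma> + CARD('d) / 2" and C_eq: "C = dual_const TYPE('d) \<gamma>"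
begin

lemma p_gt_1: "p > 1"
  using gamma zero_less_card_finite[where 'a='d] unfolding p_eq by linarith

lemma C_pos: "C > 0" unfolding C_eq by (rule dual_const_pos)

text \<open>\<open>Young_eps\<close> bounds the product pointwise by a power of the density, which
  the dual inequality controls, and a power of V. The free eps serves to absorb kinetic energy in
  one place and to make its coefficient arbitrarily small in another.\<close>

lemma potential_density_bound:
  fixes u :: "'i \<Rightarrow> real^'d \<Rightarrow> real" and V :: "real^'d \<Rightarrow> real"
  assumes F: "finite F" and on: "orthonormal_on F u" and H: "\<And>i. i \<in> F \<Longrightarrow> u i \<in> H1r"
    and \<kappa>: "\<And>i. i \<in> F \<Longrightarrow> \<kappa> i > 0" and V: "V \<in> Lp p" and e: "\<epsilon> > 0"
  shows "integrable lborel (\<lambda>x. V x * wdens \<gamma> F \<kappa> u x)"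
    and "(LINT x|lborel. \<bar>V x\<bar> * wdens \<gamma> F \<kappa> u x) \<le>
      \<epsilon> * (C * ((\<Sum>i\<in>F. \<kappa> i powr (\<gamma> - 1) * dform (u i) (u i)) + (\<Sum>i\<in>F. \<kappa> i powr \<gamma>))) + \<epsilon> powr (- (p - 1)) * Lpi p V"
proof -
  let ?\<rho> = "wdens \<gamma> F \<kappa> u"
  have [measurable]: "V \<in> borel_measurable borel" using V by measurable
  have [measurable]: "?\<rho> \<in> borel_measurable borel"
    by (rule wdens_measurable) (rule L2_measurable[OF orthonormal_onD[OF on]])
  note D = dual_Lieb_Thirring[where \<kappa>=\<kappa>, OF gamma F on H \<kappa>, folded p_eq C_eq]
  have Vi: "integrable lborel (\<lambda>x. \<bar>V x\<bar> powr p)" using V by (simp add: Lp_real_iff)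
  let ?B = "\<lambda>x. \<epsilon> * ?\<rho> x powr (p / (p - 1)) + \<epsilon> powr (- (p - 1)) * \<bar>V x\<bar> powr p"
  have Bi: "integrable lborel ?B" using D(1) Vi by simp
  have b: "\<bar>V x\<bar> * ?\<rho> x \<le> ?B x" for x
    by (rule Young_eps[OF p_gt_1 e]) (auto simp: wdens_nonneg)
  have i: "integrable lborel (\<lambda>x. \<bar>V x\<bar> * ?\<rho> x)"
    by (rule Bochner_Integration.integrable_bound[OF Bi])
       (use b in \<open>auto intro!: AE_I2 order.trans[OF _ abs_ge_self] simp: abs_mult abs_of_nonneg[OF wdens_nonneg]\<close>)
  then show "integrable lborel (\<lambda>x. V x * ?\<rho> x)"
    by (rule Bochner_Integration.integrable_bound) (auto simp: abs_mult)
  have "(LINT x|lborel. \<bar>V x\<bar> * ?\<rho> x) \<le> (LINT x|lborel. ?B x)"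
    by (rule integral_mono[OF i Bi]) (rule b)
  also have "\<dots> = \<epsilon> * (LINT x|lborel. ?\<rho> x powr (p / (p - 1))) + \<epsilon> powr (- (p - 1)) * Lpi p V"
    using D(1) Vi by (simp add: Lpi_def)
  also have "\<epsilon> * (LINT x|lborel. ?\<rho> x powr (p / (p - 1))) \<le>
     \<epsilon> * (C * ((\<Sum>i\<in>F. \<kappa> i powr (\<gamma> - 1) * dform (u i) (u i)) + (\<Sum>i\<in>F. \<kappa> i powr \<gamma>)))"
    using D(2) e by (intro mult_left_mono) auto
  finally show "(LINT x|lborel. \<bar>V x\<bar> * ?\<rho> x) \<le>
     \<epsilon> * (C * ((\<Sum>i\<in>F. \<kappa> i powr (\<gamma> - 1) * dform (u i) (u i)) + (\<Sum>i\<in>F. \<kappa> i powr \<gamma>))) + \<epsilon> powr (- (p - 1)) * Lpi p V"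
    by simp
qed

text \<open>The one-function case of \<open>potential_density_bound\<close> with weight 1, made
  homogeneous by normalising u. A null function cannot be normalised and is treated apart.\<close>

lemma potential_form_bound:
  fixes u V :: "real^'d \<Rightarrow> real"
  assumes u: "u \<in> H1r" and V: "V \<in> Lp p"
  shows "integrable lborel (\<lambda>x. V x * (u x)\<^sup>2)"
    and "\<epsilon> > 0 \<Longrightarrow> (LINT x|lborel. \<bar>V x\<bar> * (u x)\<^sup>2) \<le> \<epsilon> * C * dform u u + (\<epsilon> * C + \<epsilon> powr (- (p - 1)) * Lpi p V) * ip u u"
proof -
  have uL: "u \<in> L2" by (rule H1r_L2[OF u])
  have [measurable]: "u \<in> borel_measurable borel" "V \<in> borel_measurable borel" using uL V by measurable
  have "integrable lborel (\<lambda>x. V x * (u x)\<^sup>2) \<and> (\<epsilon> > 0 \<longrightarrow> (LINT x|lborel. \<bar>V x\<bar> * (u x)\<^sup>2) \<le>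
     \<epsilon> * C * dform u u + (\<epsilon> * C + \<epsilon> powr (- (p - 1)) * Lpi p V) * ip u u)"
  proof (cases "ip u u = 0")
    case True
    then have z: "AE x in lborel. u x = 0" using ip_eq_0_AE[OF uL] by simp
    have "integrable lborel (\<lambda>x. V x * (u x)\<^sup>2) \<longleftrightarrow> integrable lborel (\<lambda>x::real^'d. 0::real)"
      by (intro integrable_cong_AE) (use z in auto)
    moreover have "(LINT x|lborel. \<bar>V x\<bar> * (u x)\<^sup>2) = 0"
      by (rule integral_eq_zero_AE) (use z in auto)
    ultimately show ?thesis using True C_pos dform_self_nonneg[of u] by simp
  next
    case False
    then have n: "ip u u > 0" using ip_self_nonneg[of u] by simp
    define w where "w = (\<lambda>x. 1 / nrm u * u x)"
    have n1: "nrm u > 0" "(nrm u)\<^sup>2 = ip u u" using n by (auto simp: nrm_sq) (simp add: nrm_def)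
    have wH: "w \<in> H1r" unfolding w_def by (rule H1r_cmult[OF u])
    have ww: "ip w w = 1"
      unfolding w_def ip_cmult_left ip_cmult_right n1(2)[symmetric] using n1(1) by (simp add: power2_eq_square)
    have wd: "dform w w * ip u u = dform u u"
    proof -
      have "dform w w = 1 / nrm u * (1 / nrm u * dform u u)"
        using u wH unfolding w_def by (subst dform_cmult_left, simp, simp add: w_def, subst dform_cmult_right) auto
      then show ?thesis using n1 n by (simp add: power2_eq_square[symmetric])
    qed
    have usq: "(u x)\<^sup>2 = ip u u * (w x)\<^sup>2" for x
      using n1 n by (simp add: w_def power_divide power_mult_distrib)
    have on: "orthonormal_on {()} (\<lambda>_. w)" using wH ww by (simp add: orthonormal_on_def H1r_L2)
    have dens: "wdens \<gamma> {()} (\<lambda>_. 1) (\<lambda>_. w) = (\<lambda>x. (w x)\<^sup>2)" by (simp add: wdens_def fun_eq_iff)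
    note P = potential_density_bound[where F="{()}" and u="\<lambda>_. w" and \<kappa>="\<lambda>_. 1" and V=V, unfolded dens, simplified, OF on wH V]
    have "integrable lborel (\<lambda>x. ip u u * (V x * (w x)\<^sup>2))" by (rule integrable_mult_right[OF P(1)[of 1]]) simp
    then have 1: "integrable lborel (\<lambda>x. V x * (u x)\<^sup>2)" by (simp add: usq mult_ac)
    have 2: "(LINT x|lborel. \<bar>V x\<bar> * (u x)\<^sup>2) \<le> \<epsilon> * C * dform u u + (\<epsilon> * C + \<epsilon> powr (- (p - 1)) * Lpi p V) * ip u u"
      if "\<epsilon> > 0"
    proof -
      have "(LINT x|lborel. \<bar>V x\<bar> * (u x)\<^sup>2) = (LINT x|lborel. ip u u * (\<bar>V x\<bar> * (w x)\<^sup>2))"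
        by (simp add: usq mult_ac)
      also have "\<dots> = ip u u * (LINT x|lborel. \<bar>V x\<bar> * (w x)\<^sup>2)" by simp
      also have "\<dots> \<le> ip u u * (\<epsilon> * (C * (dform w w + 1)) + \<epsilon> powr (- (p - 1)) * Lpi p V)"
        using P(2)[OF that] n by (intro mult_left_mono) (auto simp: minus_diff_eq)
      also have "\<dots> = \<epsilon> * C * (dform w w * ip u u) + (\<epsilon> * C + \<epsilon> powr (- (p - 1)) * Lpi p V) * ip u u"
        by (simp add: algebra_simps)
      finally show ?thesis unfolding wd .
    qed
    show ?thesis using 1 2 by blast
  qed
  then show "integrable lborel (\<lambda>x. V x * (u x)\<^sup>2)"
    and "\<epsilon> > 0 \<Longrightarrow> (LINT x|lborel. \<bar>V x\<bar> * (u x)\<^sup>2) \<le> \<epsilon> * C * dform u u + (\<epsilon> * C + \<epsilon> powr (- (p - 1)) * Lpi p V) * ip u u"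
    by auto
qed

lemma potential_integrable:
  fixes u v V :: "real^'d \<Rightarrow> real"
  assumes u: "u \<in> H1r" and v: "v \<in> H1r" and V: "V \<in> Lp p"
  shows "integrable lborel (\<lambda>x. V x * (u x * v x))"
proof (rule Bochner_Integration.integrable_bound)
  have [measurable]: "u \<in> borel_measurable borel" "v \<in> borel_measurable borel" "V \<in> borel_measurable borel"
    using H1r_L2[OF u] H1r_L2[OF v] V by measurable
  show "(\<lambda>x. V x * (u x * v x)) \<in> borel_measurable lborel" by measurable
  show "integrable lborel (\<lambda>x. V x * (u x)\<^sup>2 + V x * (v x)\<^sup>2)"
    by (intro Bochner_Integration.integrable_add potential_form_bound(1) u v V)
  show "AE x in lborel. norm (V x * (u x * v x)) \<le> norm (V x * (u x)\<^sup>2 + V x * (v x)\<^sup>2)"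
  proof (intro AE_I2)
    fix x
    have "\<bar>V x\<bar> * \<bar>u x * v x\<bar> \<le> \<bar>V x\<bar> * ((u x)\<^sup>2 + (v x)\<^sup>2)"
      by (intro mult_left_mono abs_mult_le_sum_squares) auto
    also have "\<dots> = \<bar>V x * (u x)\<^sup>2 + V x * (v x)\<^sup>2\<bar>"
      by (simp add: abs_mult distrib_left[symmetric])
    finally show "norm (V x * (u x * v x)) \<le> norm (V x * (u x)\<^sup>2 + V x * (v x)\<^sup>2)" by (simp add: abs_mult)
  qed
qed

end

text \<open>The form of -Delta + V restricted to real functions.\<close>

definition hform :: "(real^'d \<Rightarrow> real) \<Rightarrow> (real^'d \<Rightarrow> real) \<Rightarrow> (real^'d \<Rightarrow> real) \<Rightarrow> real" where
  "hform V u v = dform u v + (LINT x|lborel. V x * (u x * v x))"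

definition real_eigenfunction :: "(real^'d \<Rightarrow> real) \<Rightarrow> real \<Rightarrow> (real^'d \<Rightarrow> real) \<Rightarrow> bool" where
  "real_eigenfunction V \<mu> u \<longleftrightarrow> u \<in> H1r \<and> (\<forall>v\<in>H1r. hform V u v = \<mu> * ip u v)"

lemma hform_commute: "hform V u v = hform V v u"
  by (simp add: hform_def dform_commute[of u v] mult.commute[of "u _" "v _"])

context exponents
begin

lemma hform_add_left:
  fixes u v w V :: "real^'d \<Rightarrow> real"
  assumes "u \<in> H1r" "v \<in> H1r" "w \<in> H1r" "V \<in> Lp p"
  shows "hform V (\<lambda>x. u x + v x) w = hform V u w + hform V v w"
proof -
  have "(LINT x|lborel. V x * ((u x + v x) * w x)) = (LINT x|lborel. V x * (u x * w x) + V x * (v x * w x))"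
    by (simp add: algebra_simps)
  then show ?thesis using assms by (simp add: hform_def dform_add_left potential_integrable)
qed

lemma hform_cmult_left:
  fixes u w V :: "real^'d \<Rightarrow> real"
  assumes "u \<in> H1r" "w \<in> H1r"
  shows "hform V (\<lambda>x. c * u x) w = c * hform V u w"
proof -
  have "(LINT x|lborel. V x * (c * u x * w x)) = (LINT x|lborel. c * (V x * (u x * w x)))"
    by (simp add: mult_ac)
  then show ?thesis using assms by (simp add: hform_def dform_cmult_left distrib_left)
qed

lemma hform_add_right:
  fixes u v w V :: "real^'d \<Rightarrow> real"
  shows "u \<in> H1r \<Longrightarrow> v \<in> H1r \<Longrightarrow> w \<in> H1r \<Longrightarrow> V \<in> Lp p \<Longrightarrow> hform V w (\<lambda>x. u x + v x) = hform V w u + hform V w v"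
  using hform_add_left[of u v w V] by (simp add: hform_commute)

lemma hform_cmult_right:
  fixes u w V :: "real^'d \<Rightarrow> real"
  shows "u \<in> H1r \<Longrightarrow> w \<in> H1r \<Longrightarrow> hform V w (\<lambda>x. c * u x) = c * hform V w u"
  using hform_cmult_left[of u w V c] by (simp add: hform_commute)

lemma hform_sum_left:
  fixes u :: "'i \<Rightarrow> real^'d \<Rightarrow> real" and w V :: "real^'d \<Rightarrow> real"
  assumes "\<And>i. i \<in> F \<Longrightarrow> u i \<in> H1r" "w \<in> H1r" "V \<in> Lp p"
  shows "hform V (\<lambda>x. \<Sum>i\<in>F. u i x) w = (\<Sum>i\<in>F. hform V (u i) w)"
  using assms
proof (induction F rule: infinite_finite_induct)
  case (insert i F)
  then show ?case using hform_add_left[of "u i" "\<lambda>x. \<Sum>i\<in>F. u i x" w V] H1r_sum[of F u] by simp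
next
  case empty
  have "hform V (\<lambda>x. 0 * w x) w = 0 * hform V w w" by (rule hform_cmult_left) (use assms in auto)
  then show ?case by simp
next
  case (infinite F)
  have "hform V (\<lambda>x. 0 * w x) w = 0 * hform V w w" by (rule hform_cmult_left) (use assms in auto)
  then show ?case using infinite by simp
qed

text \<open>At eps = 1/(2C) the dual inequality returns half of the sum being estimated; solving for
  that sum doubles the remaining term.\<close>

definition LT_const :: real where
  "LT_const = 2 * (1 / (2 * C)) powr (- (p - 1))"

text \<open>The potential energy of the weighted density is estimated by Young's inequality, so that half of
  the left-hand side can be absorbed by the dual inequality.\<close>

theorem Lieb_Thirring:
  fixes u :: "'i \<Rightarrow> real^'d \<Rightarrow> real" and V :: "real^'d \<Rightarrow> real"
  assumes F: "finite F" and on: "orthonormal_on F u" and V: "V \<in> Lp p"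
    and e: "\<And>i. i \<in> F \<Longrightarrow> real_eigenfunction V (- \<kappa> i) (u i)" and \<kappa>: "\<And>i. i \<in> F \<Longrightarrow> \<kappa> i > 0"
  shows "(\<Sum>i\<in>F. \<kappa> i powr (\<gamma> - 1) * dform (u i) (u i)) + (\<Sum>i\<in>F. \<kappa> i powr \<gamma>) = - (LINT x|lborel. V x * wdens \<gamma> F \<kappa> u x)"
    and "(\<Sum>i\<in>F. \<kappa> i powr (\<gamma> - 1) * dform (u i) (u i)) + (\<Sum>i\<in>F. \<kappa> i powr \<gamma>) \<le> LT_const * Lpi p V"
proof -
  let ?S = "(\<Sum>i\<in>F. \<kappa> i powr (\<gamma> - 1) * dform (u i) (u i)) + (\<Sum>i\<in>F. \<kappa> i powr \<gamma>)"
  have H: "u i \<in> H1r" if "i \<in> F" for i using e[OF that] by (simp add: real_eigenfunction_def)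
  have "dform (u i) (u i) = - \<kappa> i - (LINT x|lborel. V x * (u i x * u i x))" if "i \<in> F" for i
  proof -
    have "hform V (u i) (u i) = - \<kappa> i * ip (u i) (u i)" using e[OF that] H[OF that] by (simp add: real_eigenfunction_def)
    also have "ip (u i) (u i) = 1" using on that by (simp add: orthonormal_on_def)
    finally show ?thesis by (simp add: hform_def)
  qed
  moreover have "\<kappa> i powr (\<gamma> - 1) * \<kappa> i = \<kappa> i powr \<gamma>" if "i \<in> F" for i
    using \<kappa>[OF that] powr_mult_base[of "\<kappa> i" "\<gamma> - 1"] by (simp add: mult.commute)
  ultimately have "(\<Sum>i\<in>F. \<kappa> i powr (\<gamma> - 1) * dform (u i) (u i)) =
     (\<Sum>i\<in>F. - (\<kappa> i powr \<gamma>) - (LINT x|lborel. \<kappa> i powr (\<gamma> - 1) * (V x * (u i x * u i x))))"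
    by (intro sum.cong) (simp_all add: right_diff_distrib)
  also have "\<dots> = - (\<Sum>i\<in>F. \<kappa> i powr \<gamma>) - (LINT x|lborel. (\<Sum>i\<in>F. \<kappa> i powr (\<gamma> - 1) * (V x * (u i x * u i x))))"
    using H V by (subst Bochner_Integration.integral_sum) (auto simp: sum_subtractf sum_negf intro!: integrable_mult_right potential_integrable)
  also have "(LINT x|lborel. (\<Sum>i\<in>F. \<kappa> i powr (\<gamma> - 1) * (V x * (u i x * u i x)))) = (LINT x|lborel. V x * wdens \<gamma> F \<kappa> u x)"
    by (simp add: wdens_def sum_distrib_left power2_eq_square mult_ac)
  finally show S: "?S = - (LINT x|lborel. V x * wdens \<gamma> F \<kappa> u x)" by simp
  define \<epsilon> where "\<epsilon> = 1 / (2 * C)"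
  have \<epsilon>: "\<epsilon> > 0" "\<epsilon> * C = 1 / 2" using C_pos by (auto simp: \<epsilon>_def)
  note P = potential_density_bound[where \<kappa>=\<kappa>, OF F on H \<kappa> V \<epsilon>(1)]
  have "?S \<le> (LINT x|lborel. \<bar>V x\<bar> * wdens \<gamma> F \<kappa> u x)"
    unfolding S using integral_abs_bound[of lborel "\<lambda>x. V x * wdens \<gamma> F \<kappa> u x"]
    by (simp add: abs_mult abs_of_nonneg[OF wdens_nonneg])
  also have "\<dots> \<le> \<epsilon> * C * ?S + \<epsilon> powr (- (p - 1)) * Lpi p V" using P(2) by (simp only: mult.assoc)
  finally have "?S \<le> 1 / 2 * ?S + \<epsilon> powr (- (p - 1)) * Lpi p V" unfolding \<epsilon>(2) .
  moreover have "s \<le> 1 / 2 * s + x \<Longrightarrow> s \<le> 2 * x" for s x :: real by linarith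
  ultimately show "?S \<le> LT_const * Lpi p V" unfolding LT_const_def \<epsilon>_def[symmetric] mult.assoc by blast
qed

end

section \<open>Complex-valued functions\<close>

lemma Lp_2_iff:
  fixes f :: "real^'d \<Rightarrow> complex"
  shows "f \<in> Lp 2 \<longleftrightarrow> (\<lambda>x. Re (f x)) \<in> L2 \<and> (\<lambda>x. Im (f x)) \<in> L2"
proof -
  show ?thesis
  proof
    assume f: "f \<in> Lp 2"
    then have [measurable]: "f \<in> borel_measurable borel" by (simp add: Lp_def)
    have i: "integrable lborel (\<lambda>x. (Re (f x))\<^sup>2 + (Im (f x))\<^sup>2)" using f by (simp add: Lp_def cmod_power2)
    have "integrable lborel (\<lambda>x. (Re (f x))\<^sup>2)" "integrable lborel (\<lambda>x. (Im (f x))\<^sup>2)"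
      by (rule Bochner_Integration.integrable_bound[OF i]; auto)+
    then show "(\<lambda>x. Re (f x)) \<in> L2 \<and> (\<lambda>x. Im (f x)) \<in> L2" by (simp add: L2_def)
  next
    assume "(\<lambda>x. Re (f x)) \<in> L2 \<and> (\<lambda>x. Im (f x)) \<in> L2"
    then show "f \<in> Lp 2" by (simp add: Lp_def cmod_power2 L2_def borel_measurable_complex_iff)
  qed
qed

lemma Lp_2_of_real: "(\<lambda>x. complex_of_real (u x)) \<in> Lp 2 \<longleftrightarrow> u \<in> L2"
  by (simp add: Lp_2_iff L2_zero)

lemma integral_complex_split:
  fixes f :: "'a::euclidean_space \<Rightarrow> complex"
  assumes "integrable lborel (\<lambda>x. Re (f x))" "integrable lborel (\<lambda>x. Im (f x))"
  shows "(LINT x|lborel. f x) = Complex (LINT x|lborel. Re (f x)) (LINT x|lborel. Im (f x))"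
proof -
  have "integrable lborel (\<lambda>x. complex_of_real (Re (f x)) + \<i> * complex_of_real (Im (f x)))"
    using assms by simp
  then have i: "integrable lborel f" by (simp add: complex_eq[symmetric])
  show ?thesis by (simp add: complex_eq_iff integral_Re[OF i, symmetric] integral_Im[OF i, symmetric])
qed

lemma has_weak_partial_iff:
  fixes u g :: "real^'d \<Rightarrow> complex"
  assumes u: "u \<in> Lp 2"
  shows "has_weak_partial i u g \<longleftrightarrow>
     wpd i (\<lambda>x. Re (u x)) (\<lambda>x. Re (g x)) \<and> wpd i (\<lambda>x. Im (u x)) (\<lambda>x. Im (g x))"
proof -
  have *: "(LINT x|lborel. f x * complex_of_real (\<phi> x)) = Complex (ip (\<lambda>x. Re (f x)) \<phi>) (ip (\<lambda>x. Im (f x)) \<phi>)"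
    if "f \<in> Lp 2" "\<phi> \<in> L2" for f :: "real^'d \<Rightarrow> complex" and \<phi>
  proof -
    have "(LINT x|lborel. f x * complex_of_real (\<phi> x)) =
      Complex (LINT x|lborel. Re (f x * complex_of_real (\<phi> x))) (LINT x|lborel. Im (f x * complex_of_real (\<phi> x)))"
      by (rule integral_complex_split) (use that in \<open>simp_all add: Lp_2_iff L2_mult_integrable\<close>)
    then show ?thesis by (simp add: ip_def)
  qed
  show ?thesis
    unfolding has_weak_partial_def wpd_def
    using u by (auto simp: Lp_2_iff * test_function_L2 test_function_partial complex_eq_iff)
qed

lemma H1_iff:
  fixes u :: "real^'d \<Rightarrow> complex"
  shows "u \<in> H1 \<longleftrightarrow> (\<lambda>x. Re (u x)) \<in> H1r \<and> (\<lambda>x. Im (u x)) \<in> H1r"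
proof
  assume "u \<in> H1"
  then show "(\<lambda>x. Re (u x)) \<in> H1r \<and> (\<lambda>x. Im (u x)) \<in> H1r"
    unfolding H1_def H1r_def using has_weak_partial_iff[of u] by (auto simp: Lp_2_iff) blast+
next
  assume a: "(\<lambda>x. Re (u x)) \<in> H1r \<and> (\<lambda>x. Im (u x)) \<in> H1r"
  then have uL: "u \<in> Lp 2" by (simp add: Lp_2_iff H1r_L2)
  have "has_weak_partial i u (\<lambda>x. Complex (wd i (\<lambda>x. Re (u x)) x) (wd i (\<lambda>x. Im (u x)) x))" for i
    using a by (simp add: has_weak_partial_iff[OF uL] wpd_wd)
  then show "u \<in> H1" using uL by (auto simp: H1_def)
qed

lemma H1_of_real: "(\<lambda>x. complex_of_real (u x)) \<in> H1 \<longleftrightarrow> u \<in> H1r"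
  by (simp add: H1_iff H1r_zero)

lemma weak_partial_parts:
  fixes u :: "real^'d \<Rightarrow> complex"
  assumes u: "u \<in> H1"
  shows "wpd i (\<lambda>x. Re (u x)) (\<lambda>x. Re (weak_partial i u x))" "wpd i (\<lambda>x. Im (u x)) (\<lambda>x. Im (weak_partial i u x))"
proof -
  have "has_weak_partial i u (weak_partial i u)"
    unfolding weak_partial_def using u unfolding H1_def by (metis (mono_tags, lifting) mem_Collect_eq someI_ex)
  moreover have "u \<in> Lp 2" using u by (simp add: H1_def)
  ultimately show "wpd i (\<lambda>x. Re (u x)) (\<lambda>x. Re (weak_partial i u x))" "wpd i (\<lambda>x. Im (u x)) (\<lambda>x. Im (weak_partial i u x))"
    using has_weak_partial_iff by blast+
qed

lemma L2_inner_real_left: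
  assumes "f \<in> L2" "g \<in> Lp 2"
  shows "L2_inner (\<lambda>x. complex_of_real (f x)) g = Complex (ip f (\<lambda>x. Re (g x))) (ip f (\<lambda>x. Im (g x)))"
proof -
  have "L2_inner (\<lambda>x. complex_of_real (f x)) g = Complex (LINT x|lborel. Re (complex_of_real (f x) * g x)) (LINT x|lborel. Im (complex_of_real (f x) * g x))"
    unfolding L2_inner_def complex_cnj_complex_of_real
    by (rule integral_complex_split) (use assms in \<open>simp_all add: Lp_2_iff L2_mult_integrable\<close>)
  then show ?thesis by (simp add: ip_def)
qed

text \<open>\<open>weak_partial\<close> and \<open>wd\<close> are separate choices, equal only up to
  null sets; the imaginary part chosen for a real function vanishes almost everywhere by uniqueness.
  Inner products do not notice either change.\<close>

lemma weak_partial_inner_real_left: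
  fixes u :: "real^'d \<Rightarrow> real" and v :: "real^'d \<Rightarrow> complex"
  assumes u: "u \<in> H1r" and v: "v \<in> H1"
  shows "L2_inner (weak_partial i (\<lambda>x. complex_of_real (u x))) (weak_partial i v) =
    Complex (ip (wd i u) (wd i (\<lambda>x. Re (v x)))) (ip (wd i u) (wd i (\<lambda>x. Im (v x))))"
proof -
  let ?g = "weak_partial i (\<lambda>x. complex_of_real (u x))"
  have uH: "(\<lambda>x. complex_of_real (u x)) \<in> H1" using u by (simp add: H1_of_real)
  note P = weak_partial_parts[OF uH, of i, simplified] and Q = weak_partial_parts[OF v, of i]
  have vr: "(\<lambda>x. Re (v x)) \<in> H1r" "(\<lambda>x. Im (v x)) \<in> H1r" using v by (auto simp: H1_iff)
  have gL: "(\<lambda>x. Re (?g x)) \<in> L2" "(\<lambda>x. Im (?g x)) \<in> L2" using P by (auto simp: wpd_def)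
  have hL: "(\<lambda>x. Re (weak_partial i v x)) \<in> L2" "(\<lambda>x. Im (weak_partial i v x)) \<in> L2" using Q by (auto simp: wpd_def)
  have gm[measurable]: "?g \<in> borel_measurable borel" and hm[measurable]: "weak_partial i v \<in> borel_measurable borel"
    using gL hL by (auto simp: borel_measurable_complex_iff L2_def)
  have re: "AE x in lborel. Re (?g x) = wd i u x" using wd_eqI[OF u P(1)] by eventually_elim simp
  have im: "AE x in lborel. Im (?g x) = 0"
    by (rule wpd_unique[OF P(2)]) (simp add: wpd_def L2_zero)
  have [measurable]: "wd i u \<in> borel_measurable borel" using wd_L2[OF u] by measurable
  have "L2_inner ?g (weak_partial i v) = L2_inner (\<lambda>x. complex_of_real (wd i u x)) (weak_partial i v)"
    unfolding L2_inner_def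
  proof (rule integral_cong_AE)
    show "AE x in lborel. cnj (?g x) * weak_partial i v x = cnj (complex_of_real (wd i u x)) * weak_partial i v x"
      using re im by eventually_elim (simp add: complex_eq_iff)
  qed (auto simp: borel_measurable_complex_iff)
  also have "\<dots> = Complex (ip (wd i u) (\<lambda>x. Re (weak_partial i v x))) (ip (wd i u) (\<lambda>x. Im (weak_partial i v x)))"
    by (rule L2_inner_real_left[OF wd_L2[OF u]]) (simp add: Lp_2_iff hL)
  also have "ip (wd i u) (\<lambda>x. Re (weak_partial i v x)) = ip (wd i u) (wd i (\<lambda>x. Re (v x)))"
    using wd_eqI[OF vr(1) Q(1)] L2_measurable[OF wd_L2[OF vr(1)]]
    by (intro ip_cong_AE) auto
  also have "ip (wd i u) (\<lambda>x. Im (weak_partial i v x)) = ip (wd i u) (wd i (\<lambda>x. Im (v x)))"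
    using wd_eqI[OF vr(2) Q(2)] L2_measurable[OF wd_L2[OF vr(2)]]
    by (intro ip_cong_AE) auto
  finally show ?thesis .
qed

context exponents
begin

lemma schroedinger_form_real_left:
  fixes u V :: "real^'d \<Rightarrow> real" and v :: "real^'d \<Rightarrow> complex"
  assumes u: "u \<in> H1r" and v: "v \<in> H1" and V: "V \<in> Lp p"
  shows "schroedinger_form V (\<lambda>x. complex_of_real (u x)) v =
    Complex (hform V u (\<lambda>x. Re (v x))) (hform V u (\<lambda>x. Im (v x)))"
proof -
  have vr: "(\<lambda>x. Re (v x)) \<in> H1r" "(\<lambda>x. Im (v x)) \<in> H1r" using v by (auto simp: H1_iff)
  have "(LINT x|lborel. complex_of_real (V x) * cnj (complex_of_real (u x)) * v x) =
    Complex (LINT x|lborel. Re (complex_of_real (V x) * cnj (complex_of_real (u x)) * v x))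
      (LINT x|lborel. Im (complex_of_real (V x) * cnj (complex_of_real (u x)) * v x))"
    by (rule integral_complex_split)
       (use potential_integrable[OF u vr(1) V] potential_integrable[OF u vr(2) V] in \<open>simp_all add: mult.assoc\<close>)
  then show ?thesis
    unfolding schroedinger_form_def weak_partial_inner_real_left[OF u v]
    by (simp add: hform_def dform_def complex_eq_iff Re_sum Im_sum mult.assoc)
qed

text \<open>V and u are real and the form is linear in its second argument, so one complex test
  function amounts to two real ones.\<close>

lemma eigenspace_of_real_iff:
  fixes u V :: "real^'d \<Rightarrow> real"
  assumes V: "V \<in> Lp p"
  shows "(\<lambda>x. complex_of_real (u x)) \<in> eigenspace V \<mu> \<longleftrightarrow> real_eigenfunction V \<mu> u"
proof -
  have i: "L2_inner (\<lambda>x. complex_of_real \<mu> * complex_of_real (u x)) v = Complex (\<mu> * ip u (\<lambda>x. Re (v x))) (\<mu> * ip u (\<lambda>x. Im (v x)))"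
    if "u \<in> L2" "v \<in> Lp 2" for v
    using L2_inner_real_left[OF L2_cmult[OF that(1)] that(2), of \<mu>] unfolding of_real_mult ip_cmult_left .
  show ?thesis
  proof
    assume "(\<lambda>x. complex_of_real (u x)) \<in> eigenspace V \<mu>"
    then have u: "u \<in> H1r" and e: "\<And>v. v \<in> H1 \<Longrightarrow> schroedinger_form V (\<lambda>x. complex_of_real (u x)) v = L2_inner (\<lambda>x. complex_of_real \<mu> * complex_of_real (u x)) v"
      by (auto simp: eigenspace_def schroedinger_op_def H1_of_real)
    have "hform V u v = \<mu> * ip u v" if v: "v \<in> H1r" for v
    proof -
      have vH: "(\<lambda>x. complex_of_real (v x)) \<in> H1" using v by (simp add: H1_of_real)
      have "Complex (hform V u v) (hform V u (\<lambda>x. 0)) = Complex (\<mu> * ip u v) (\<mu> * ip u (\<lambda>x. 0))"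
        using e[OF vH] schroedinger_form_real_left[OF u vH V] i[OF H1r_L2[OF u], of "\<lambda>x. complex_of_real (v x)"]
          H1r_L2[OF v] by (simp add: Lp_2_of_real)
      then show ?thesis by simp
    qed
    then show "real_eigenfunction V \<mu> u" using u by (simp add: real_eigenfunction_def)
  next
    assume r: "real_eigenfunction V \<mu> u"
    then have u: "u \<in> H1r" by (simp add: real_eigenfunction_def)
    have "schroedinger_form V (\<lambda>x. complex_of_real (u x)) v = L2_inner (\<lambda>x. complex_of_real \<mu> * complex_of_real (u x)) v" if v: "v \<in> H1" for v
    proof -
      have "(\<lambda>x. Re (v x)) \<in> H1r" "(\<lambda>x. Im (v x)) \<in> H1r" "v \<in> Lp 2"
        using v H1_iff[of v] by (auto simp: H1_def)
      then show ?thesis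
        using r schroedinger_form_real_left[OF u v V] i[OF H1r_L2[OF u], of v] by (simp add: real_eigenfunction_def)
    qed
    then show "(\<lambda>x. complex_of_real (u x)) \<in> eigenspace V \<mu>"
      using u Lp_2_of_real[of "\<lambda>x. \<mu> * u x"] by (simp add: eigenspace_def schroedinger_op_def H1_of_real L2_cmult H1r_L2)
  qed
qed

end

section \<open>Completeness\<close>

definition L2_Cauchy :: "(nat \<Rightarrow> 'a::euclidean_space \<Rightarrow> real) \<Rightarrow> bool" where
  "L2_Cauchy u \<longleftrightarrow> (\<forall>e>0. \<exists>N. \<forall>m\<ge>N. \<forall>n\<ge>N. ip (\<lambda>x. u m x - u n x) (\<lambda>x. u m x - u n x) < e)"

definition L2_lim :: "(nat \<Rightarrow> 'a::euclidean_space \<Rightarrow> real) \<Rightarrow> ('a \<Rightarrow> real) \<Rightarrow> bool" where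
  "L2_lim u l \<longleftrightarrow> l \<in> L2 \<and> (\<lambda>n. ip (\<lambda>x. u n x - l x) (\<lambda>x. u n x - l x)) \<longlonglongrightarrow> 0"

text \<open>Multiplication by the positive square integrable heat kernel turns an \<open>L2\<close> Cauchy sequence into an
  \<open>L1\<close> Cauchy sequence, for which almost everywhere convergent subsequences are available.\<close>

lemma L2_Cauchy_AE_subseq:
  fixes u :: "nat \<Rightarrow> 'a::euclidean_space \<Rightarrow> real"
  assumes u: "\<And>n. u n \<in> L2" and C: "L2_Cauchy u"
  obtains r where "strict_mono r" "AE x in lborel. Cauchy (\<lambda>k. u (r k) x)"
proof -
  define w where "w = (heat 1 :: 'a \<Rightarrow> real)"
  have w: "w \<in> L2" "w x > 0" for x unfolding w_def by (auto intro: heat_L2 heat_pos)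
  have H: "\<exists>N. \<forall>i\<ge>N. \<forall>j\<ge>N. (LINT x|lborel. norm (u i x * w x - u j x * w x)) < e" if e: "e > 0" for e
  proof -
    define e' where "e' = e\<^sup>2 / (ip w w + 1)"
    have ww: "ip w w + 1 > 0" using ip_self_nonneg[of w] by simp
    have e': "e' > 0" using e ww by (simp add: e'_def)
    then obtain N where N: "\<And>i j. i \<ge> N \<Longrightarrow> j \<ge> N \<Longrightarrow> ip (\<lambda>x. u i x - u j x) (\<lambda>x. u i x - u j x) < e'"
      using C unfolding L2_Cauchy_def by meson
    have "(LINT x|lborel. norm (u i x * w x - u j x * w x)) < e" if ij: "i \<ge> N" "j \<ge> N" for i j
    proof -
      define d where "d = (\<lambda>x. u i x - u j x)"
      have d: "d \<in> L2" unfolding d_def by (intro L2_diff u)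
      have da: "(\<lambda>x. \<bar>d x\<bar>) \<in> L2" using d by (auto simp: L2_def)
      have "(LINT x|lborel. norm (u i x * w x - u j x * w x)) = ip (\<lambda>x. \<bar>d x\<bar>) w"
        using w(2) by (simp add: ip_def d_def left_diff_distrib[symmetric] abs_mult abs_of_pos)
      moreover have "(ip (\<lambda>x. \<bar>d x\<bar>) w)\<^sup>2 < e\<^sup>2"
      proof -
        have "(ip (\<lambda>x. \<bar>d x\<bar>) w)\<^sup>2 \<le> ip d d * ip w w"
          using ip_Cauchy_Schwarz[OF da w(1)] by (simp add: ip_self)
        also have "\<dots> \<le> ip d d * (ip w w + 1)" using ip_self_nonneg[of d] by (simp add: distrib_left)
        also have "\<dots> < e' * (ip w w + 1)" using N[OF ij] ww by (simp add: d_def)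
        also have "\<dots> = e\<^sup>2" using ww by (simp add: e'_def)
        finally show ?thesis .
      qed
      ultimately show ?thesis using e by (simp add: power2_less_imp_less)
    qed
    then show ?thesis by blast
  qed
  obtain r where r: "strict_mono r" "AE x in lborel. Cauchy (\<lambda>k. u (r k) x * w x)"
    using cauchy_L1_AE_cauchy_subseq[where M=lborel and s="\<lambda>n x. u n x * w x", OF L2_mult_integrable[OF u w(1)] H] by blast
  have "AE x in lborel. Cauchy (\<lambda>k. u (r k) x)"
    using r(2)
  proof eventually_elim
    case (elim x)
    then have "convergent (\<lambda>k. u (r k) x * w x)" by (simp add: Cauchy_convergent_iff)
    then have "convergent (\<lambda>k. (u (r k) x * w x) * (1 / w x))"
      by (rule convergent_mult) (rule convergent_const)
    moreover have "(\<lambda>k. (u (r k) x * w x) * (1 / w x)) = (\<lambda>k. u (r k) x)" using w(2)[of x] by simp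
    ultimately show ?case by (simp add: Cauchy_convergent_iff)
  qed
  then show thesis using r(1) that by blast
qed

text \<open>The almost everywhere limit of a subsequence is the limit of the whole sequence in norm:
  Fatou's lemma in the second index of the Cauchy condition transfers the bound to the
  limit.\<close>

theorem L2_complete:
  fixes u :: "nat \<Rightarrow> 'a::euclidean_space \<Rightarrow> real"
  assumes u: "\<And>n. u n \<in> L2" and C: "L2_Cauchy u"
  obtains l where "L2_lim u l"
proof -
  obtain r where r: "strict_mono r" "AE x in lborel. Cauchy (\<lambda>k. u (r k) x)"
    using L2_Cauchy_AE_subseq[OF u C] by blast
  have um[measurable]: "u n \<in> borel_measurable borel" for n using u[of n] by measurable
  define l where "l = (\<lambda>x. lim (\<lambda>k. u (r k) x))"
  have lm[measurable]: "l \<in> borel_measurable borel" unfolding l_def by measurable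
  have lim: "AE x in lborel. (\<lambda>k. u (r k) x) \<longlonglongrightarrow> l x"
    using r(2) by eventually_elim (simp add: l_def Cauchy_convergent_iff convergent_LIMSEQ_iff)
  have key: "(\<integral>\<^sup>+x. ennreal ((u n x - l x)\<^sup>2) \<partial>lborel) \<le> ennreal e"
    if N: "\<And>m. m \<ge> N \<Longrightarrow> ip (\<lambda>x. u n x - u m x) (\<lambda>x. u n x - u m x) < e" for n N e
  proof -
    have "(\<integral>\<^sup>+x. ennreal ((u n x - l x)\<^sup>2) \<partial>lborel) \<le> (\<integral>\<^sup>+x. liminf (\<lambda>k. ennreal ((u n x - u (r k) x)\<^sup>2)) \<partial>lborel)"
    proof (rule nn_integral_mono_AE)
      show "AE x in lborel. ennreal ((u n x - l x)\<^sup>2) \<le> liminf (\<lambda>k. ennreal ((u n x - u (r k) x)\<^sup>2))"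
        using lim
      proof eventually_elim
        case (elim x)
        then have "(\<lambda>k. ennreal ((u n x - u (r k) x)\<^sup>2)) \<longlonglongrightarrow> ennreal ((u n x - l x)\<^sup>2)"
          by (intro tendsto_ennrealI tendsto_intros)
        then have "liminf (\<lambda>k. ennreal ((u n x - u (r k) x)\<^sup>2)) = ennreal ((u n x - l x)\<^sup>2)"
          by (rule lim_imp_Liminf[OF trivial_limit_sequentially])
        then show ?case by simp
      qed
    qed
    also have "\<dots> \<le> liminf (\<lambda>k. \<integral>\<^sup>+x. ennreal ((u n x - u (r k) x)\<^sup>2) \<partial>lborel)"
      by (intro nn_integral_liminf) auto
    also have "\<dots> \<le> ennreal e"
    proof (rule Liminf_le)
      have "(\<integral>\<^sup>+x. ennreal ((u n x - u (r k) x)\<^sup>2) \<partial>lborel) \<le> ennreal e" if "k \<ge> N" for k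
      proof -
        have "r k \<ge> N" using seq_suble[OF r(1), of k] that by simp
        then have "(LINT x|lborel. (u n x - u (r k) x)\<^sup>2) < e" using N[of "r k"] by (simp add: ip_self)
        then show ?thesis
          using nn_integral_eq_integral[OF L2_sq[OF L2_diff[OF u[of n] u[of "r k"]]]] by (auto intro: ennreal_leI)
      qed
      then show "\<forall>\<^sub>F k in sequentially. (\<integral>\<^sup>+x. ennreal ((u n x - u (r k) x)\<^sup>2) \<partial>lborel) \<le> ennreal e"
        unfolding eventually_sequentially by blast
    qed simp
    finally show ?thesis .
  qed
  have dL: "(\<lambda>x. u n x - l x) \<in> L2" and dn: "ip (\<lambda>x. u n x - l x) (\<lambda>x. u n x - l x) \<le> e"
    if N: "\<And>m. m \<ge> N \<Longrightarrow> ip (\<lambda>x. u n x - u m x) (\<lambda>x. u n x - u m x) < e" and e: "e > 0" for n N e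
  proof -
    have f: "(\<integral>\<^sup>+x. ennreal ((u n x - l x)\<^sup>2) \<partial>lborel) \<le> ennreal e" by (rule key[OF N])
    have i: "integrable lborel (\<lambda>x. (u n x - l x)\<^sup>2)"
      by (rule integrableI_nonneg) (use le_less_trans[OF f] in auto)
    then show "(\<lambda>x. u n x - l x) \<in> L2" by (simp add: L2_def)
    show "ip (\<lambda>x. u n x - l x) (\<lambda>x. u n x - l x) \<le> e"
      using f nn_integral_eq_integral[OF i] e by (simp add: ip_self)
  qed
  have lL: "l \<in> L2"
  proof -
    obtain N where "\<And>m n. m \<ge> N \<Longrightarrow> n \<ge> N \<Longrightarrow> ip (\<lambda>x. u m x - u n x) (\<lambda>x. u m x - u n x) < 1"
      using C unfolding L2_Cauchy_def by (meson zero_less_one)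
    then have "(\<lambda>x. u N x - l x) \<in> L2" using dL[of N N 1] by simp
    then have "(\<lambda>x. u N x - (u N x - l x)) \<in> L2" by (rule L2_diff[OF u])
    then show ?thesis by simp
  qed
  have "(\<lambda>n. ip (\<lambda>x. u n x - l x) (\<lambda>x. u n x - l x)) \<longlonglongrightarrow> 0"
  proof (rule LIMSEQ_I)
    fix e :: real assume e: "e > 0"
    then have "e / 2 > 0" by simp
    then obtain N where "\<And>m n. m \<ge> N \<Longrightarrow> n \<ge> N \<Longrightarrow> ip (\<lambda>x. u m x - u n x) (\<lambda>x. u m x - u n x) < e / 2"
      using C unfolding L2_Cauchy_def by meson
    then have "ip (\<lambda>x. u n x - l x) (\<lambda>x. u n x - l x) \<le> e / 2" if "n \<ge> N" for n
      using dn[of N n "e / 2"] that e by simp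
    then have "norm (ip (\<lambda>x. u n x - l x) (\<lambda>x. u n x - l x) - 0) < e" if "n \<ge> N" for n
      using that e ip_self_nonneg[of "\<lambda>x. u n x - l x"] by fastforce
    then show "\<exists>N. \<forall>n\<ge>N. norm (ip (\<lambda>x. u n x - l x) (\<lambda>x. u n x - l x) - 0) < e" by blast
  qed
  then show thesis using lL by (intro that) (simp add: L2_lim_def)
qed

lemma L2_lim_ip:
  assumes u: "\<And>n. u n \<in> L2" and l: "L2_lim u l" and w: "w \<in> L2"
  shows "(\<lambda>n. ip (u n) w) \<longlonglongrightarrow> ip l w"
proof -
  have lL: "l \<in> L2" using l by (simp add: L2_lim_def)
  have "(\<lambda>n. sqrt (ip (\<lambda>x. u n x - l x) (\<lambda>x. u n x - l x)) * sqrt (ip w w)) \<longlonglongrightarrow> sqrt 0 * sqrt (ip w w)"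
    using l by (intro tendsto_intros) (simp add: L2_lim_def)
  then have "(\<lambda>n. sqrt (ip (\<lambda>x. u n x - l x) (\<lambda>x. u n x - l x)) * sqrt (ip w w)) \<longlonglongrightarrow> 0" by simp
  then have "(\<lambda>n. ip (u n) w - ip l w) \<longlonglongrightarrow> 0"
  proof (rule Lim_null_comparison[rotated])
    show "\<forall>\<^sub>F n in sequentially. norm (ip (u n) w - ip l w) \<le> sqrt (ip (\<lambda>x. u n x - l x) (\<lambda>x. u n x - l x)) * sqrt (ip w w)"
      using ip_abs_le[OF L2_diff[OF u lL] w] by (simp add: ip_diff_left[OF u lL w])
  qed
  then show ?thesis by (simp add: LIM_zero_iff)
qed

lemma L2_lim_ip_self:
  assumes u: "\<And>n. u n \<in> L2" and l: "L2_lim u l"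
  shows "(\<lambda>n. ip (u n) (u n)) \<longlonglongrightarrow> ip l l"
proof -
  have lL: "l \<in> L2" using l by (simp add: L2_lim_def)
  have "(\<lambda>n. ip (\<lambda>x. u n x - l x) (\<lambda>x. u n x - l x) + 2 * ip (u n) l - ip l l) \<longlonglongrightarrow> 0 + 2 * ip l l - ip l l"
    using l by (intro tendsto_intros L2_lim_ip[OF u l lL]) (simp add: L2_lim_def)
  then show ?thesis by (simp add: ip_diff_self[OF u lL])
qed

text \<open>The square of the Sobolev norm.\<close>

definition h1n :: "(real^'d \<Rightarrow> real) \<Rightarrow> real" where "h1n u = ip u u + dform u u"

lemma h1n_nonneg: "0 \<le> h1n u" by (simp add: h1n_def ip_self_nonneg dform_self_nonneg)

lemma dform_diff_left:
  "u \<in> H1r \<Longrightarrow> v \<in> H1r \<Longrightarrow> w \<in> H1r \<Longrightarrow> dform (\<lambda>x. u x - v x) w = dform u w - dform v w"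
  using dform_add_left[of u "\<lambda>x. -1 * v x" w] dform_cmult_left[of v w "-1"] H1r_cmult[of v "-1"] by simp

lemma dform_diff_self:
  "u \<in> H1r \<Longrightarrow> v \<in> H1r \<Longrightarrow> dform (\<lambda>x. u x - v x) (\<lambda>x. u x - v x) = dform u u - 2 * dform u v + dform v v"
  using dform_diff_left[of u v "\<lambda>x. u x - v x"] dform_diff_left[of u v u] dform_diff_left[of u v v]
  by (simp add: H1r_diff dform_commute[of u "\<lambda>x. u x - v x"] dform_commute[of v "\<lambda>x. u x - v x"] dform_commute[of v u])

lemma wd_diff_AE:
  assumes "u \<in> H1r" "v \<in> H1r"
  shows "AE x in lborel. wd i (\<lambda>x. u x - v x) x = wd i u x - wd i v x"
proof -
  have "wpd i (\<lambda>x. u x + - 1 * v x) (\<lambda>x. wd i u x + - 1 * wd i v x)"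
    by (intro wpd_add wpd_cmult wpd_wd assms H1r_L2 L2_cmult)
  then show ?thesis using wd_eqI[OF H1r_diff[OF assms], of i "\<lambda>x. wd i u x - wd i v x"] by simp
qed

lemma ip_wd_diff:
  assumes "u \<in> H1r" "v \<in> H1r"
  shows "ip (\<lambda>x. wd i u x - wd i v x) (\<lambda>x. wd i u x - wd i v x) =
    ip (wd i (\<lambda>x. u x - v x)) (wd i (\<lambda>x. u x - v x))"
  using wd_diff_AE[OF assms, of i] L2_measurable[OF wd_L2[OF H1r_diff[OF assms]], of i]
    L2_measurable[OF L2_diff[OF wd_L2[OF assms(1)] wd_L2[OF assms(2)]], of i i]
  by (intro ip_cong_AE) auto

lemma ip_wd_le_dform: "ip (wd i u) (wd i u) \<le> dform u u"
  unfolding dform_def by (rule member_le_sum) (auto simp: ip_self_nonneg)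

text \<open>Functions and weak derivatives converge separately in L2, and the defining identity of a
  weak derivative passes to the limit because each side is an inner product with a fixed
  function.\<close>

theorem H1r_complete:
  fixes u :: "nat \<Rightarrow> real^'d \<Rightarrow> real"
  assumes u: "\<And>n. u n \<in> H1r"
    and C: "\<And>e. e > 0 \<Longrightarrow> \<exists>N. \<forall>m\<ge>N. \<forall>n\<ge>N. h1n (\<lambda>x. u m x - u n x) < e"
  obtains l where "l \<in> H1r" "(\<lambda>n. h1n (\<lambda>x. u n x - l x)) \<longlonglongrightarrow> 0" "L2_lim u l"
proof -
  have uL: "u n \<in> L2" for n by (rule H1r_L2[OF u])
  have C0: "L2_Cauchy u"
    unfolding L2_Cauchy_def
  proof (intro allI impI)
    fix e :: real assume "e > 0"
    then obtain N where "\<forall>m\<ge>N. \<forall>n\<ge>N. h1n (\<lambda>x. u m x - u n x) < e" using C by blast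
    moreover have "ip w w \<le> h1n w" for w :: "real^'d \<Rightarrow> real" by (simp add: h1n_def dform_self_nonneg)
    ultimately show "\<exists>N. \<forall>m\<ge>N. \<forall>n\<ge>N. ip (\<lambda>x. u m x - u n x) (\<lambda>x. u m x - u n x) < e"
      by (meson le_less_trans)
  qed
  have Ci: "L2_Cauchy (\<lambda>n. wd i (u n))" for i
    unfolding L2_Cauchy_def
  proof (intro allI impI)
    fix e :: real assume "e > 0"
    then obtain N where "\<forall>m\<ge>N. \<forall>n\<ge>N. h1n (\<lambda>x. u m x - u n x) < e" using C by blast
    moreover have "ip (\<lambda>x. wd i (u m) x - wd i (u n) x) (\<lambda>x. wd i (u m) x - wd i (u n) x) \<le> h1n (\<lambda>x. u m x - u n x)" for m n
      unfolding ip_wd_diff[OF u u] h1n_def using ip_wd_le_dform[of i "\<lambda>x. u m x - u n x"] ip_self_nonneg[of "\<lambda>x. u m x - u n x"]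
      by linarith
    ultimately show "\<exists>N. \<forall>m\<ge>N. \<forall>n\<ge>N. ip (\<lambda>x. wd i (u m) x - wd i (u n) x) (\<lambda>x. wd i (u m) x - wd i (u n) x) < e"
      by (meson le_less_trans)
  qed
  obtain l where l: "L2_lim u l" using L2_complete[OF uL C0] by blast
  have "\<exists>g. L2_lim (\<lambda>n. wd i (u n)) g" for i using L2_complete[OF wd_L2[OF u] Ci] by blast
  then obtain g where g: "\<And>i. L2_lim (\<lambda>n. wd i (u n)) (g i)" by metis
  have lL: "l \<in> L2" and gL: "g i \<in> L2" for i using l g by (auto simp: L2_lim_def)
  have w: "wpd i l (g i)" for i
    unfolding wpd_def
  proof (intro conjI allI impI gL)
    fix \<phi> :: "real^'d \<Rightarrow> real" assume \<phi>: "test_function \<phi>"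
    have "(\<lambda>n. ip (u n) (partial i \<phi>)) \<longlonglongrightarrow> ip l (partial i \<phi>)"
      by (rule L2_lim_ip[OF uL l test_function_L2[OF test_function_partial[OF \<phi>]]])
    moreover have "(\<lambda>n. - ip (wd i (u n)) \<phi>) \<longlonglongrightarrow> - ip (g i) \<phi>"
      by (intro tendsto_minus L2_lim_ip[OF wd_L2[OF u] g test_function_L2[OF \<phi>]])
    moreover have "ip (u n) (partial i \<phi>) = - ip (wd i (u n)) \<phi>" for n
      using wpd_wd[OF u, of i n] \<phi> by (simp add: wpd_def)
    ultimately show "ip l (partial i \<phi>) = - ip (g i) \<phi>" using LIMSEQ_unique by simp
  qed
  have lH: "l \<in> H1r" using lL w by (auto simp: H1r_def)
  have "(\<lambda>n. ip (wd i (\<lambda>x. u n x - l x)) (wd i (\<lambda>x. u n x - l x))) \<longlonglongrightarrow> 0" for i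
  proof -
    have "ip (wd i (\<lambda>x. u n x - l x)) (wd i (\<lambda>x. u n x - l x)) =
       ip (\<lambda>x. wd i (u n) x - g i x) (\<lambda>x. wd i (u n) x - g i x)" for n
      unfolding ip_wd_diff[OF u lH, symmetric]
      using wd_eqI[OF lH w] L2_measurable[OF wd_L2[OF u]] L2_measurable[OF wd_L2[OF lH]] L2_measurable[OF gL]
      by (intro ip_cong_AE) auto
    then show ?thesis using g[of i] by (simp add: L2_lim_def)
  qed
  then have "(\<lambda>n. dform (\<lambda>x. u n x - l x) (\<lambda>x. u n x - l x)) \<longlonglongrightarrow> (\<Sum>i\<in>(UNIV::'d set). 0)"
    unfolding dform_def by (intro tendsto_sum)
  then have "(\<lambda>n. h1n (\<lambda>x. u n x - l x)) \<longlonglongrightarrow> 0 + 0"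
    unfolding h1n_def using l by (intro tendsto_add) (auto simp: L2_lim_def)
  then show thesis using lH l by (intro that) auto
qed

section \<open>Compactness\<close>

text \<open>The hypothesis is applied with e = 1/(n + 1) at stage n, refining the subsequence each
  time; the diagonal sequence has all these properties on its tails.\<close>

lemma Cauchy_subseq_of_precompact:
  fixes D :: "nat \<Rightarrow> nat \<Rightarrow> real"
  assumes "\<And>e s. e > 0 \<Longrightarrow> strict_mono (s::nat \<Rightarrow> nat) \<Longrightarrow> \<exists>r. strict_mono (r::nat \<Rightarrow> nat) \<and> (\<forall>i j. D (s (r i)) (s (r j)) < e)"
  obtains r :: "nat \<Rightarrow> nat" where "strict_mono r" "\<And>e. e > 0 \<Longrightarrow> \<exists>N. \<forall>i\<ge>N. \<forall>j\<ge>N. D (r i) (r j) < e"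
proof -
  define P where "P = (\<lambda>n (s::nat \<Rightarrow> nat). \<forall>i j. D (s i) (s j) < 1 / real (Suc n))"
  interpret S: subseqs P
  proof
    fix n and s :: "nat \<Rightarrow> nat" assume s: "strict_mono s"
    have "0 < 1 / real (Suc n)" by simp
    from assms[OF this s] show "\<exists>r'. strict_mono r' \<and> P n (s \<circ> r')" by (simp add: P_def)
  qed
  \<comment> \<open>Only the part of the diagonal sequence from index k + 1 on is known to lie in
    the subsequence of stage k.\<close>
  have h: "P k (S.diagseq \<circ> (+) (Suc k))" for k
    by (rule S.diagseq_holds) (auto simp: P_def)
  show thesis
  proof (rule that[OF S.subseq_diagseq])
    fix e :: real assume "e > 0"
    then obtain k where k: "1 / real (Suc k) < e" using nat_approx_posE by blast
    have "D (S.diagseq i) (S.diagseq j) < e" if "i \<ge> Suc k" "j \<ge> Suc k" for i j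
    proof -
      have "D (S.diagseq (Suc k + (i - Suc k))) (S.diagseq (Suc k + (j - Suc k))) < 1 / real (Suc k)"
        using h[of k] unfolding P_def o_def by blast
      then show ?thesis using that k by simp
    qed
    then show "\<exists>N. \<forall>i\<ge>N. \<forall>j\<ge>N. D (S.diagseq i) (S.diagseq j) < e" by blast
  qed
qed

lemma heat_op_abs_le:
  fixes u :: "'a::euclidean_space \<Rightarrow> real"
  assumes t: "t > 0" and u: "u \<in> L2"
  shows "\<bar>heat_op t u x\<bar> \<le> sqrt (heat (2 * t) (0::'a)) * sqrt (ip u u)"
  using ip_abs_le[OF heat_reflect_translate_L2[OF t, of x] u] by (simp add: heat_op_def heat_ip_self[OF t])

text \<open>The kernel centred at x depends continuously on x in L2, and u enters only through its
  norm. This is the equicontinuity that Arzela-Ascoli asks of a bounded sequence.\<close>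

lemma heat_op_modulus:
  fixes u :: "'a::euclidean_space \<Rightarrow> real"
  assumes t: "t > 0" and u: "u \<in> L2"
  shows "\<bar>heat_op t u x - heat_op t u y\<bar> \<le> sqrt (2 * (heat (2 * t) (0::'a) - heat (2 * t) (x - y))) * sqrt (ip u u)"
proof -
  let ?h = "\<lambda>x z. heat t (x - z)"
  note L = heat_reflect_translate_L2[OF t]
  have "ip (?h x) (?h y) = heat (2 * t) (x - y)"
    using heat_semigroup[OF t, of x y] by (simp add: ip_def heat_commute[of t y])
  then have "ip (\<lambda>z. ?h x z - ?h y z) (\<lambda>z. ?h x z - ?h y z) = 2 * (heat (2 * t) (0::'a) - heat (2 * t) (x - y))"
    by (simp add: ip_diff_self[OF L L] heat_ip_self[OF t])
  moreover have "heat_op t u x - heat_op t u y = ip (\<lambda>z. ?h x z - ?h y z) u"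
    by (simp add: heat_op_def ip_diff_left[OF L L u])
  ultimately show ?thesis using ip_abs_le[OF L2_diff[OF L[of x] L[of y]] u] by simp
qed

lemma heat_op_uniform_subseq:
  fixes u :: "nat \<Rightarrow> 'a::euclidean_space \<Rightarrow> real"
  assumes t: "t > 0" and u: "\<And>n. u n \<in> L2" and M: "\<And>n. ip (u n) (u n) \<le> M" and e: "e > 0"
  shows "\<exists>r. strict_mono (r::nat \<Rightarrow> nat) \<and> (\<forall>i j. \<forall>x\<in>cball 0 R. \<bar>heat_op t (u (r i)) x - heat_op t (u (r j)) x\<bar> < e)"
proof -
  have M0: "0 \<le> M" using M[of 0] ip_self_nonneg[of "u 0"] by simp
  have sM: "sqrt (ip (u n) (u n)) \<le> sqrt M" for n using M by simp
  obtain g k where k: "strict_mono (k :: nat \<Rightarrow> nat)"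
    "\<And>e. 0 < e \<Longrightarrow> \<exists>N. \<forall>n x. n \<ge> N \<and> x \<in> cball 0 R \<longrightarrow> norm (heat_op t (u (k n)) x - g x) < e"
  proof (rule Arzela_Ascoli[of "cball (0::'a) R" "\<lambda>n. heat_op t (u n)" "sqrt (heat (2 * t) (0::'a)) * sqrt M"])
    show "norm (heat_op t (u n) x) \<le> sqrt (heat (2 * t) (0::'a)) * sqrt M" for n x
    proof -
      have "sqrt (heat (2 * t) (0::'a)) * sqrt (ip (u n) (u n)) \<le> sqrt (heat (2 * t) (0::'a)) * sqrt M"
        using t by (intro mult_left_mono sM) (simp add: heat_nonneg)
      then show ?thesis using heat_op_abs_le[OF t u[of n], of x] by simp
    qed
    fix x :: 'a and e :: real assume "0 < e"
    have "isCont (\<lambda>y. sqrt (2 * (heat (2 * t) (0::'a) - heat (2 * t) (x - y))) * sqrt M) x"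
    proof -
      have "isCont (heat (2 * t)) (x - x)"
        using heat_continuous[of "2 * t", where 'a='a] by (simp add: continuous_on_eq_continuous_at)
      then have "isCont (\<lambda>y. heat (2 * t) (x - y)) x"
        by (intro isCont_o2[where g="heat (2 * t)" and f="\<lambda>y. x - y"]) (auto intro!: continuous_intros)
      then show ?thesis by (intro continuous_intros)
    qed
    from this[unfolded continuous_at_eps_delta, THEN spec, THEN mp, OF \<open>0 < e\<close>]
    obtain d where d: "d > 0" "\<forall>y. dist y x < d \<longrightarrow> dist (sqrt (2 * (heat (2 * t) (0::'a) - heat (2 * t) (x - y))) * sqrt M)
       (sqrt (2 * (heat (2 * t) (0::'a) - heat (2 * t) (x - x))) * sqrt M) < e" by (elim exE conjE)
    have "norm (heat_op t (u n) x - heat_op t (u n) y) < e" if "norm (x - y) < d" for n y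
    proof -
      have "\<bar>heat_op t (u n) x - heat_op t (u n) y\<bar> \<le> sqrt (2 * (heat (2 * t) (0::'a) - heat (2 * t) (x - y))) * sqrt (ip (u n) (u n))"
        by (rule heat_op_modulus[OF t u])
      also have "\<dots> \<le> sqrt (2 * (heat (2 * t) (0::'a) - heat (2 * t) (x - y))) * sqrt M"
        using heat_le[of "2 * t" "x - y"] t by (intro mult_left_mono sM) simp
      also have "\<dots> < e" using d(2)[THEN spec, of y] that by (simp add: dist_norm norm_minus_commute)
      finally show ?thesis by simp
    qed
    then show "\<exists>d>0. \<forall>n y. y \<in> cball 0 R \<and> norm (x - y) < d \<longrightarrow> norm (heat_op t (u n) x - heat_op t (u n) y) < e"
      using d(1) by blast
  qed (auto intro: that)
  from e have "e / 2 > 0" by simp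
  then obtain N where N: "\<And>n x. n \<ge> N \<Longrightarrow> x \<in> cball 0 R \<Longrightarrow> norm (heat_op t (u (k n)) x - g x) < e / 2"
    using k(2) by blast
  \<comment> \<open>Dropping the first N terms makes the bound hold for all pairs of indices, which
    is the form used by the diagonal argument.\<close>
  show ?thesis
  proof (intro exI[of _ "\<lambda>n. k (n + N)"] conjI allI ballI)
    show "strict_mono (\<lambda>n. k (n + N))" using k(1) by (simp add: strict_mono_def)
    fix i j x assume x: "x \<in> cball (0::'a) R"
    have "\<bar>heat_op t (u (k (i + N))) x - g x\<bar> < e / 2" "\<bar>heat_op t (u (k (j + N))) x - g x\<bar> < e / 2"
      using N[OF _ x, of "i + N"] N[OF _ x, of "j + N"] by auto
    then show "\<bar>heat_op t (u (k (i + N))) x - heat_op t (u (k (j + N))) x\<bar> < e" by linarith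
  qed
qed

lemma h1n_diff_le:
  assumes "u \<in> H1r" "v \<in> H1r" shows "h1n (\<lambda>x. u x - v x) \<le> 2 * h1n u + 2 * h1n v"
proof -
  have "0 \<le> ip (\<lambda>x. u x + v x) (\<lambda>x. u x + v x)" "0 \<le> dform (\<lambda>x. u x + v x) (\<lambda>x. u x + v x)"
    by (rule ip_self_nonneg dform_self_nonneg)+
  then show ?thesis
    using assms by (simp add: h1n_def ip_diff_self dform_diff_self ip_add_self dform_add_left dform_add_right H1r_add
        dform_commute[of v u] H1r_L2)
qed

context exponents
begin

text \<open>At each point the cut-off is eventually inactive, and |V|^p dominates: V is a bounded
  function on a ball up to an arbitrarily small error.\<close>

lemma Lpi_truncation_tendsto:
  fixes V :: "real^'d \<Rightarrow> real"
  assumes V: "V \<in> Lp p"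
  shows "(\<lambda>R::nat. Lpi p (\<lambda>x. V x * indicator {x. \<not> (\<bar>V x\<bar> \<le> R \<and> norm x \<le> R)} x)) \<longlonglongrightarrow> 0"
proof -
  have [measurable]: "V \<in> borel_measurable borel" using V by measurable
  have "(\<lambda>R::nat. LINT x|lborel. \<bar>V x * indicator {x. \<not> (\<bar>V x\<bar> \<le> R \<and> norm x \<le> R)} x\<bar> powr p) \<longlonglongrightarrow> (LINT x|(lborel :: (real^'d) measure). 0)"
  proof (rule integral_dominated_convergence[where w="\<lambda>x. \<bar>V x\<bar> powr p"])
    show "integrable lborel (\<lambda>x. \<bar>V x\<bar> powr p)" using V by (simp add: Lp_real_iff)
    show "AE x in lborel. (\<lambda>R::nat. \<bar>V x * indicator {x. \<not> (\<bar>V x\<bar> \<le> R \<and> norm x \<le> R)} x\<bar> powr p) \<longlonglongrightarrow> 0"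
    proof (intro AE_I2)
      fix x
      obtain N :: nat where N: "max \<bar>V x\<bar> (norm x) \<le> N" using real_arch_simple by blast
      have "\<bar>V x * indicator {x. \<not> (\<bar>V x\<bar> \<le> R \<and> norm x \<le> R)} x\<bar> powr p = 0" if "R \<ge> N" for R :: nat
      proof -
        have "real N \<le> real R" using that by simp
        then show ?thesis using N by (auto simp: indicator_def)
      qed
      then show "(\<lambda>R::nat. \<bar>V x * indicator {x. \<not> (\<bar>V x\<bar> \<le> R \<and> norm x \<le> R)} x\<bar> powr p) \<longlonglongrightarrow> 0"
        by (intro tendsto_eventually) (auto simp: eventually_sequentially)
    qed
    show "AE x in lborel. norm (\<bar>V x * indicator {x. \<not> (\<bar>V x\<bar> \<le> real R \<and> norm x \<le> real R)} x\<bar> powr p) \<le> \<bar>V x\<bar> powr p" for R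
      using p_gt_1 by (intro AE_I2) (auto simp: indicator_def)
  qed measurable
  then show ?thesis by (simp add: Lpi_def)
qed

text \<open>V is cut into a bounded part on a ball and a remainder that is small in Lp. The
  remainder is handled by the form bound. On the ball, w is the sum of its heat average, which is
  uniformly small, and a residual that is small in L2 for small t.\<close>

lemma potential_difference_bound:
  fixes V w :: "real^'d \<Rightarrow> real"
  assumes V: "V \<in> Lp p" and w: "w \<in> H1r" and B: "h1n w \<le> B" and \<delta>: "\<delta> > 0" and t: "t > 0"
    and \<eta>: "\<And>x. x \<in> cball 0 R \<Longrightarrow> \<bar>heat_op t w x\<bar> \<le> \<eta>" and R: "R \<ge> 0"
  shows "(LINT x|lborel. \<bar>V x\<bar> * (w x)\<^sup>2) \<le>
     \<delta> * C * B + \<delta> powr (- (p - 1)) * Lpi p (\<lambda>x. V x * indicator {x. \<not> (\<bar>V x\<bar> \<le> R \<and> norm x \<le> R)} x) * B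
     + 2 * R * (8 * 2 powr (CARD('d) / 2) * t * B) + 2 * R * \<eta>\<^sup>2 * measure lborel (cball (0::real^'d) R)"
proof -
  have wL: "w \<in> L2" by (rule H1r_L2[OF w])
  have [measurable]: "V \<in> borel_measurable borel" "w \<in> borel_measurable borel" using V wL by measurable
  define S where "S = {x. \<not> (\<bar>V x\<bar> \<le> R \<and> norm x \<le> R)}"
  have [measurable]: "S \<in> sets borel" unfolding S_def by measurable
  define V2 where "V2 = (\<lambda>x. V x * indicator S x)"
  have V2: "V2 \<in> Lp p"
  proof -
    have "integrable lborel (\<lambda>x. \<bar>V x\<bar> powr p)" using V by (simp add: Lp_real_iff)
    then have "integrable lborel (\<lambda>x. \<bar>V2 x\<bar> powr p)"
      by (rule Bochner_Integration.integrable_bound) (use p_gt_1 in \<open>auto simp: V2_def indicator_def\<close>)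
    then show ?thesis by (simp add: Lp_real_iff V2_def)
  qed
  have dB: "dform w w \<le> B" and iB: "ip w w \<le> B" and B0: "0 \<le> B"
    using B ip_self_nonneg[of w] dform_self_nonneg[of w] by (auto simp: h1n_def)
  have i2: "integrable lborel (\<lambda>x. \<bar>V2 x\<bar> * (w x)\<^sup>2)"
    using integrable_abs[OF potential_form_bound(1)[OF w V2]] by (simp add: abs_mult)
  have "(LINT x|lborel. \<bar>V2 x\<bar> * (w x)\<^sup>2) \<le> \<delta> * C * dform w w + (\<delta> * C + \<delta> powr (- (p - 1)) * Lpi p V2) * ip w w"
    by (rule potential_form_bound(2)[OF w V2 \<delta>])
  also have "\<dots> = \<delta> * C * h1n w + \<delta> powr (- (p - 1)) * Lpi p V2 * ip w w" by (simp add: h1n_def algebra_simps)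
  also have "\<dots> \<le> \<delta> * C * B + \<delta> powr (- (p - 1)) * Lpi p V2 * B"
    using \<delta> C_pos B iB Lpi_nonneg[of p V2] by (intro add_mono mult_left_mono) auto
  finally have b2: "(LINT x|lborel. \<bar>V2 x\<bar> * (w x)\<^sup>2) \<le> \<delta> * C * B + \<delta> powr (- (p - 1)) * Lpi p V2 * B" .
  define r where "r = (\<lambda>x. w x - heat_op t w x)"
  have rL: "r \<in> L2" unfolding r_def by (intro L2_diff heat_op_L2 wL t)
  have i1: "integrable lborel (\<lambda>x. 2 * R * (r x)\<^sup>2 + 2 * R * \<eta>\<^sup>2 * indicator (cball 0 R) x)"
    by (intro Bochner_Integration.integrable_add integrable_mult_right L2_sq rL integrable_real_indicator)
       (use emeasure_lborel_cball_finite in auto)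
  have pw: "\<bar>V x\<bar> * (w x)\<^sup>2 \<le> \<bar>V2 x\<bar> * (w x)\<^sup>2 + (2 * R * (r x)\<^sup>2 + 2 * R * \<eta>\<^sup>2 * indicator (cball 0 R) x)" for x
  proof (cases "x \<in> S")
    case True
    then show ?thesis using R by (simp add: V2_def)
  next
    case False
    then have x: "\<bar>V x\<bar> \<le> R" "x \<in> cball 0 R" by (auto simp: S_def)
    have "\<bar>heat_op t w x\<bar>\<^sup>2 \<le> \<eta>\<^sup>2" using \<eta>[OF x(2)] by (intro power_mono) auto
    moreover have "(w x)\<^sup>2 \<le> 2 * (r x)\<^sup>2 + 2 * (heat_op t w x)\<^sup>2"
      using sum_squares_bound[of "r x" "heat_op t w x"] power2_sum[of "r x" "heat_op t w x"] by (simp add: r_def)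
    ultimately have "(w x)\<^sup>2 \<le> 2 * (r x)\<^sup>2 + 2 * \<eta>\<^sup>2" by simp
    then have "\<bar>V x\<bar> * (w x)\<^sup>2 \<le> R * (2 * (r x)\<^sup>2 + 2 * \<eta>\<^sup>2)"
      using x(1) R by (intro mult_mono) auto
    then show ?thesis using x(2) False by (simp add: V2_def algebra_simps)
  qed
  have iV: "integrable lborel (\<lambda>x. \<bar>V x\<bar> * (w x)\<^sup>2)"
    using integrable_abs[OF potential_form_bound(1)[OF w V]] by (simp add: abs_mult)
  have "(LINT x|lborel. \<bar>V x\<bar> * (w x)\<^sup>2) \<le> (LINT x|lborel. \<bar>V2 x\<bar> * (w x)\<^sup>2 + (2 * R * (r x)\<^sup>2 + 2 * R * \<eta>\<^sup>2 * indicator (cball 0 R) x))"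
    by (rule integral_mono[OF iV Bochner_Integration.integrable_add[OF i2 i1]]) (rule pw)
  also have "\<dots> = (LINT x|lborel. \<bar>V2 x\<bar> * (w x)\<^sup>2) + (LINT x|lborel. 2 * R * (r x)\<^sup>2 + 2 * R * \<eta>\<^sup>2 * indicator (cball 0 R) x)"
    by (rule Bochner_Integration.integral_add[OF i2 i1])
  also have "(LINT x|lborel. 2 * R * (r x)\<^sup>2 + 2 * R * \<eta>\<^sup>2 * indicator (cball 0 R) x) = 2 * R * ip r r + 2 * R * \<eta>\<^sup>2 * measure lborel (cball (0::real^'d) R)"
  proof -
    have a: "integrable lborel (\<lambda>x. 2 * R * (r x)\<^sup>2)" by (intro integrable_mult_right L2_sq rL)
    have b: "integrable lborel (\<lambda>x::real^'d. 2 * R * \<eta>\<^sup>2 * indicator (cball 0 R) x)"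
      by (intro integrable_mult_right integrable_real_indicator) (use emeasure_lborel_cball_finite in auto)
    show ?thesis unfolding Bochner_Integration.integral_add[OF a b] by (simp add: ip_self)
  qed
  also have "ip r r \<le> 8 * 2 powr (CARD('d) / 2) * t * B"
  proof -
    have "ip r r \<le> 8 * 2 powr (CARD('d) / 2) * t * dform w w" unfolding r_def by (rule heat_residual_le[OF t w])
    also have "\<dots> \<le> 8 * 2 powr (CARD('d) / 2) * t * B" using t dB by (intro mult_left_mono) auto
    finally show ?thesis .
  qed
  finally show ?thesis using b2 R unfolding V2_def S_def by (simp add: mult_left_mono)
qed

lemma potential_precompact:
  fixes V :: "real^'d \<Rightarrow> real" and u :: "nat \<Rightarrow> real^'d \<Rightarrow> real"
  assumes V: "V \<in> Lp p" and u: "\<And>n. u n \<in> H1r" and M: "\<And>n. h1n (u n) \<le> M" and e: "e > 0"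
  shows "\<exists>r. strict_mono (r::nat \<Rightarrow> nat) \<and> (\<forall>i j. (LINT x|lborel. \<bar>V x\<bar> * (u (r i) x - u (r j) x)\<^sup>2) < e)"
proof -
  define B where "B = 4 * M + 1"
  have M0: "0 \<le> M" using M[of 0] h1n_nonneg[of "u 0"] by simp
  have B: "B > 0" using M0 by (simp add: B_def)
  have hB: "h1n (\<lambda>x. u i x - u j x) \<le> B" for i j
    using h1n_diff_le[OF u[of i] u[of j]] M[of i] M[of j] by (simp add: B_def)
  \<comment> \<open>The parameters are fixed in the order \<delta>, R, t, \<eta>, and the
    subsequence comes last, since each choice depends on the earlier ones. The four errors are
    bounded by e/4, e/4, e/8 and e/8.\<close>
  define \<delta> where "\<delta> = e / (4 * C * B)"
  have \<delta>: "\<delta> > 0" using e C_pos B by (simp add: \<delta>_def)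
  have \<delta>e: "\<delta> * C * B = e / 4" using C_pos B by (simp add: \<delta>_def)
  define A where "A = \<delta> powr (- (p - 1)) * B"
  have A: "A > 0" using \<delta> B by (simp add: A_def)
  let ?L = "\<lambda>R::real. Lpi p (\<lambda>x. V x * indicator {x. \<not> (\<bar>V x\<bar> \<le> R \<and> norm x \<le> R)} x)"
  have "e / (4 * A) > 0" using e A by simp
  then obtain R :: nat where "norm (?L (real R) - 0) < e / (4 * A)"
    using LIMSEQ_D[OF Lpi_truncation_tendsto[OF V]] by blast
  then have RL: "A * ?L (real R) < e / 4" using A by (simp add: Lpi_nonneg field_simps)
  define c where "c = 8 * 2 powr (CARD('d) / 2)"
  have c: "c > 0" by (simp add: c_def)
  \<comment> \<open>Replacing R by R + 1, and below m by m + 1, keeps the denominators positive when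
    the ball is degenerate.\<close>
  define R1 where "R1 = real R + 1"
  have R1: "R1 > 0" "real R / R1 \<le> 1" "real R / R1 \<ge> 0" by (auto simp: R1_def)
  define t where "t = e / (16 * R1 * c * B)"
  have t: "t > 0" using e c B R1 by (simp add: t_def)
  have tb: "2 * real R * (c * t * B) \<le> e / 8"
  proof -
    have "2 * real R * (c * t * B) = e / 8 * (real R / R1)" using c B R1(1) by (simp add: t_def field_simps)
    also have "\<dots> \<le> e / 8 * 1" using e R1 by (intro mult_left_mono) auto
    finally show ?thesis by simp
  qed
  define m where "m = measure lborel (cball (0::real^'d) (real R))"
  have m: "m \<ge> 0" by (simp add: m_def)
  define m1 where "m1 = m + 1"
  have m1: "m1 > 0" "m / m1 \<le> 1" "m / m1 \<ge> 0" using m by (auto simp: m1_def)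
  define \<eta> where "\<eta> = sqrt (e / (16 * R1 * m1))"
  have \<eta>0: "\<eta> > 0" using e m1 R1 by (simp add: \<eta>_def)
  have \<eta>b: "2 * real R * \<eta>\<^sup>2 * m \<le> e / 8"
  proof -
    have "\<eta>\<^sup>2 = e / (16 * R1 * m1)" using e m1 R1 by (simp add: \<eta>_def)
    then have "2 * real R * \<eta>\<^sup>2 * m = e / 8 * ((real R / R1) * (m / m1))" using m1(1) R1(1) by (simp add: field_simps)
    also have "\<dots> \<le> e / 8 * (1 * 1)" using e m1 R1 by (intro mult_left_mono mult_mono) auto
    finally show ?thesis by simp
  qed
  have iM: "ip (u n) (u n) \<le> M" for n using M[of n] dform_self_nonneg[of "u n"] by (simp add: h1n_def)
  obtain r :: "nat \<Rightarrow> nat" where r: "strict_mono r"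
    "\<forall>i j. \<forall>x\<in>cball 0 (real R). \<bar>heat_op t (u (r i)) x - heat_op t (u (r j)) x\<bar> < \<eta>"
    using heat_op_uniform_subseq[where u=u and R="real R", OF t H1r_L2[OF u] iM \<eta>0] by blast
  have "(LINT x|lborel. \<bar>V x\<bar> * (u (r i) x - u (r j) x)\<^sup>2) < e" for i j
  proof -
    have "(LINT x|lborel. \<bar>V x\<bar> * (u (r i) x - u (r j) x)\<^sup>2) \<le>
      \<delta> * C * B + \<delta> powr (- (p - 1)) * ?L (real R) * B + 2 * real R * (8 * 2 powr (CARD('d) / 2) * t * B) + 2 * real R * \<eta>\<^sup>2 * measure lborel (cball (0::real^'d) (real R))"
    proof (rule potential_difference_bound[OF V H1r_diff[OF u u] hB \<delta> t])
      show "\<bar>heat_op t (\<lambda>x. u (r i) x - u (r j) x) x\<bar> \<le> \<eta>" if "x \<in> cball 0 (real R)" for x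
        using r(2) that by (simp add: heat_op_diff[OF t H1r_L2[OF u] H1r_L2[OF u]] less_imp_le)
    qed simp
    also have "\<dots> = e / 4 + A * ?L (real R) + 2 * real R * (c * t * B) + 2 * real R * \<eta>\<^sup>2 * m"
      unfolding \<delta>e by (simp add: A_def c_def m_def)
    also have "\<dots> < e" using RL tb \<eta>b e by linarith
    finally show ?thesis .
  qed
  then show ?thesis using r(1) by blast
qed

theorem potential_compact:
  fixes V :: "real^'d \<Rightarrow> real" and u :: "nat \<Rightarrow> real^'d \<Rightarrow> real"
  assumes V: "V \<in> Lp p" and u: "\<And>n. u n \<in> H1r" and M: "\<And>n. h1n (u n) \<le> M"
  obtains r :: "nat \<Rightarrow> nat" where "strict_mono r"
    "\<forall>e>0. \<exists>N. \<forall>i\<ge>N. \<forall>j\<ge>N. (LINT x|lborel. \<bar>V x\<bar> * (u (r i) x - u (r j) x)\<^sup>2) < e"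
proof (rule Cauchy_subseq_of_precompact[of "\<lambda>i j. LINT x|lborel. \<bar>V x\<bar> * (u i x - u j x)\<^sup>2"])
  show "\<exists>r::nat \<Rightarrow> nat. strict_mono r \<and> (\<forall>i j. (LINT x|lborel. \<bar>V x\<bar> * (u (s (r i)) x - u (s (r j)) x)\<^sup>2) < e)"
    if "e > 0" "strict_mono s" for e and s :: "nat \<Rightarrow> nat"
    by (rule potential_precompact[OF V, of "\<lambda>n. u (s n)"]) (use u M that in auto)
qed (use that in blast)

section \<open>Existence of bound states\<close>

text \<open>The relative bound eps C = 1/2 leaves half of the kinetic energy, so bounded form values
  and bounded L2 norms bound the Sobolev norm.\<close>

lemma hform_lower_bound:
  fixes V :: "real^'d \<Rightarrow> real"
  assumes V: "V \<in> Lp p"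
  obtains K where "K \<ge> 0" "\<forall>u\<in>H1r. (LINT x|lborel. \<bar>V x\<bar> * (u x)\<^sup>2) \<le> dform u u / 2 + K * ip u u"
    "\<forall>u\<in>H1r. dform u u / 2 - K * ip u u \<le> hform V u u"
proof -
  define \<epsilon> where "\<epsilon> = 1 / (2 * C)"
  have \<epsilon>: "\<epsilon> > 0" "\<epsilon> * C = 1 / 2" using C_pos by (auto simp: \<epsilon>_def)
  define K where "K = \<epsilon> * C + \<epsilon> powr (- (p - 1)) * Lpi p V"
  have K: "K \<ge> 0" using \<epsilon> by (simp add: K_def Lpi_nonneg)
  have 1: "(LINT x|lborel. \<bar>V x\<bar> * (u x)\<^sup>2) \<le> dform u u / 2 + K * ip u u" if "u \<in> H1r" for u
    using potential_form_bound(2)[OF that V \<epsilon>(1)] unfolding K_def[symmetric] unfolding \<epsilon>(2) by simp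
  have 2: "dform u u / 2 - K * ip u u \<le> hform V u u" if "u \<in> H1r" for u
  proof -
    have "\<bar>LINT x|lborel. V x * (u x)\<^sup>2\<bar> \<le> (LINT x|lborel. \<bar>V x\<bar> * (u x)\<^sup>2)"
      using integral_abs_bound[of lborel "\<lambda>x. V x * (u x)\<^sup>2"] by (simp add: abs_mult)
    then show ?thesis using 1[OF that] unfolding hform_def power2_eq_square[symmetric] by linarith
  qed
  show thesis using K 1 2 by (intro that) auto
qed

text \<open>The form is minimised over unit vectors orthogonal to the given eigenfunctions. As the
  infimum m is negative, the form shifted by m controls the Sobolev norm up to the potential term,
  and that term is compact; a minimising sequence thus has a subsequence converging in norm. The
  limit satisfies the eigenvalue equation.\<close>

theorem eigenfunction_below:
  fixes V v0 :: "real^'d \<Rightarrow> real" and \<phi> :: "'i \<Rightarrow> real^'d \<Rightarrow> real"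
  assumes V: "V \<in> Lp p" and F: "finite F" and on: "orthonormal_on F \<phi>"
    and eig: "\<And>i. i \<in> F \<Longrightarrow> real_eigenfunction V (l i) (\<phi> i)"
    and v0: "v0 \<in> H1r" "\<And>i. i \<in> F \<Longrightarrow> ip v0 (\<phi> i) = 0" "hform V v0 v0 < - \<epsilon> * ip v0 v0" and \<epsilon>: "\<epsilon> \<ge> 0"
  obtains m w where "m < - \<epsilon>" "real_eigenfunction V m w" "ip w w = 1" "\<And>i. i \<in> F \<Longrightarrow> ip w (\<phi> i) = 0"
proof -
  obtain K where K0: "K \<ge> 0" "\<forall>u\<in>H1r. (LINT x|lborel. \<bar>V x\<bar> * (u x)\<^sup>2) \<le> dform u u / 2 + K * ip u u"
    "\<forall>u\<in>H1r. dform u u / 2 - K * ip u u \<le> hform V u u"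
    by (rule hform_lower_bound[OF V])
  note K = K0(1) bspec[OF K0(2)] bspec[OF K0(3)]
  have \<phi>L: "\<phi> i \<in> L2" and \<phi>H: "\<phi> i \<in> H1r" if "i \<in> F" for i
    using on eig that by (auto simp: orthonormal_on_def real_eigenfunction_def)
  define A where "A = {v \<in> H1r. \<forall>i\<in>F. ip v (\<phi> i) = 0}"
  have AH: "v \<in> H1r" and AL: "v \<in> L2" if "v \<in> A" for v using that by (auto simp: A_def H1r_L2)
  have A_add: "(\<lambda>x. u x + v x) \<in> A" if "u \<in> A" "v \<in> A" for u v
    using that \<phi>L by (auto simp: A_def H1r_add ip_add_left H1r_L2)
  have A_cmult: "(\<lambda>x. c * u x) \<in> A" if "u \<in> A" for u c
    using that by (auto simp: A_def H1r_cmult ip_cmult_left)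
  have A_diff: "(\<lambda>x. u x - v x) \<in> A" if "u \<in> A" "v \<in> A" for u v
    using A_add[OF that(1) A_cmult[OF that(2), of "-1"]] by simp
  define S where "S = {hform V v v |v. v \<in> A \<and> ip v v = 1}"
  have Sb: "- K \<le> s" if s: "s \<in> S" for s
  proof -
    obtain v where v: "v \<in> A" "ip v v = 1" "s = hform V v v" using s by (auto simp: S_def)
    show ?thesis using K(3)[OF AH[OF v(1)]] dform_self_nonneg[of v] v by simp
  qed
  then have bdd: "bdd_below S" by (rule bdd_belowI)
  have norm1: "(\<lambda>x. 1 / nrm v * v x) \<in> A" "ip (\<lambda>x. 1 / nrm v * v x) (\<lambda>x. 1 / nrm v * v x) = 1"
    "hform V (\<lambda>x. 1 / nrm v * v x) (\<lambda>x. 1 / nrm v * v x) = hform V v v / ip v v" if v: "v \<in> A" "ip v v > 0" for v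
  proof -
    show "(\<lambda>x. 1 / nrm v * v x) \<in> A" by (rule A_cmult[OF v(1)])
    have n: "nrm v * nrm v = ip v v" using nrm_sq[of v] by (simp add: power2_eq_square)
    show "ip (\<lambda>x. 1 / nrm v * v x) (\<lambda>x. 1 / nrm v * v x) = 1"
      unfolding ip_cmult_left ip_cmult_right using n v(2) by simp
    have "hform V (\<lambda>x. 1 / nrm v * v x) (\<lambda>x. 1 / nrm v * v x) = 1 / nrm v * (1 / nrm v * hform V v v)"
      by (subst hform_cmult_left, rule AH[OF v(1)], rule H1r_cmult[OF AH[OF v(1)]], subst hform_cmult_right) (use AH[OF v(1)] in auto)
    then show "hform V (\<lambda>x. 1 / nrm v * v x) (\<lambda>x. 1 / nrm v * v x) = hform V v v / ip v v" using n by simp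
  qed
  have v0A: "v0 \<in> A" using v0 by (simp add: A_def)
  have v0p: "ip v0 v0 > 0"
  proof (rule ccontr)
    assume "\<not> ip v0 v0 > 0"
    then have z: "ip v0 v0 = 0" using ip_self_nonneg[of v0] by simp
    then show False using K(3)[OF v0(1)] dform_self_nonneg[of v0] v0(3) by simp
  qed
  define m where "m = Inf S"
  have Sn: "S \<noteq> {}" and mS: "m \<le> hform V v0 v0 / ip v0 v0"
  proof -
    have "hform V v0 v0 / ip v0 v0 \<in> S" unfolding S_def using norm1[OF v0A v0p] by force
    then show "S \<noteq> {}" "m \<le> hform V v0 v0 / ip v0 v0" unfolding m_def using bdd by (auto intro: cInf_lower)
  qed
  have "hform V v0 v0 / ip v0 v0 < - \<epsilon>" using v0(3) v0p by (simp only: pos_divide_less_eq)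
  then have m: "m < - \<epsilon>" using mS by linarith
  have m0: "m < 0" using m \<epsilon> by simp
  \<comment> \<open>Shifting by the infimum makes the form nonnegative on A, so a parallelogram
    estimate applies to differences of near-minimisers.\<close>
  define Q where "Q = (\<lambda>u v. hform V u v - m * ip u v)"
  have Q_add_left: "Q (\<lambda>x. u x + v x) w = Q u w + Q v w" if "u \<in> H1r" "v \<in> H1r" "w \<in> H1r" for u v w
    using that V by (simp add: Q_def hform_add_left ip_add_left H1r_L2 algebra_simps)
  have Q_cmult_left: "Q (\<lambda>x. c * u x) w = c * Q u w" if "u \<in> H1r" "w \<in> H1r" for c u w
    using that V by (simp add: Q_def hform_cmult_left ip_cmult_left algebra_simps)
  have Q_commute: "Q u v = Q v u" for u v unfolding Q_def by (simp add: hform_commute[of V u v] ip_commute[of u v])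
  have Q_sq: "Q (\<lambda>x. u x + c * v x) (\<lambda>x. u x + c * v x) = Q u u + 2 * c * Q u v + c\<^sup>2 * Q v v"
    if u: "u \<in> H1r" and v: "v \<in> H1r" for u v c
  proof -
    have cv: "(\<lambda>x. c * v x) \<in> H1r" by (rule H1r_cmult[OF v])
    have s: "(\<lambda>x. u x + c * v x) \<in> H1r" by (rule H1r_add[OF u cv])
    have "Q w (\<lambda>x. u x + c * v x) = Q w u + c * Q w v" if w: "w \<in> H1r" for w
      unfolding Q_commute[of w] using Q_add_left[OF u cv w] Q_cmult_left[OF v w] by simp
    then have "Q (\<lambda>x. u x + c * v x) (\<lambda>x. u x + c * v x) = (Q u u + c * Q u v) + c * (Q v u + c * Q v v)"
      using Q_add_left[OF u cv s] Q_cmult_left[OF v s] u v by simp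
    then show ?thesis by (simp add: Q_commute[of v u] power2_eq_square algebra_simps)
  qed
  have Q0: "0 \<le> Q v v" if v: "v \<in> A" for v
  proof (cases "ip v v = 0")
    case True
    then show ?thesis using K(3)[OF AH[OF v]] dform_self_nonneg[of v] by (simp add: Q_def)
  next
    case False
    then have p: "ip v v > 0" using ip_self_nonneg[of v] by simp
    have "hform V v v / ip v v \<in> S" unfolding S_def using norm1[OF v p] by force
    then have "m \<le> hform V v v / ip v v" unfolding m_def using bdd by (rule cInf_lower)
    then show ?thesis using p by (simp add: Q_def field_simps)
  qed
  have Q_diff: "Q (\<lambda>x. u x - v x) (\<lambda>x. u x - v x) \<le> 2 * Q u u + 2 * Q v v" if u: "u \<in> A" and v: "v \<in> A" for u v
  proof -
    have "0 \<le> Q (\<lambda>x. u x + 1 * v x) (\<lambda>x. u x + 1 * v x)" using Q0[OF A_add[OF u v]] by simp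
    then show ?thesis using Q_sq[OF AH[OF u] AH[OF v], of 1] Q_sq[OF AH[OF u] AH[OF v], of "-1"] by simp
  qed
  have "\<exists>v. v \<in> A \<and> ip v v = 1 \<and> Q v v < 1 / real (Suc n)" for n
  proof -
    have "m < m + 1 / real (Suc n)" by simp
    then obtain s where "s \<in> S" "s < m + 1 / real (Suc n)"
      unfolding m_def using cInf_lessD[OF Sn] by blast
    then show ?thesis by (auto simp: S_def Q_def)
  qed
  then obtain u where u: "\<And>n. u n \<in> A" "\<And>n. ip (u n) (u n) = 1" "\<And>n. Q (u n) (u n) < 1 / real (Suc n)" by metis
  have uH: "u n \<in> H1r" for n by (rule AH[OF u(1)])
  have uB: "h1n (u n) \<le> 1 + 2 * (1 + K)" for n
  proof -
    have "1 / real (Suc n) \<le> 1" by simp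
    moreover have "hform V (u n) (u n) - m < 1 / real (Suc n)" using u(3)[of n] u(2)[of n] unfolding Q_def by simp
    ultimately have "hform V (u n) (u n) < 1" using m0 by linarith
    then show ?thesis using K(3)[OF uH[of n]] u(2)[of n] by (simp add: h1n_def)
  qed
  obtain r :: "nat \<Rightarrow> nat" where r: "strict_mono r"
    "\<forall>e>0. \<exists>N. \<forall>i\<ge>N. \<forall>j\<ge>N. (LINT x|lborel. \<bar>V x\<bar> * (u (r i) x - u (r j) x)\<^sup>2) < e"
    by (rule potential_compact[where u=u, OF V uH uB])
  \<comment> \<open>Here the sign of m matters: -m is the positive coefficient of the L2 norm in
    \<open>Q\<close>, next to the coefficient 1 of the Dirichlet form.\<close>
  define c0 where "c0 = min 1 (- m)"
  have c0: "c0 > 0" using m0 by (simp add: c0_def)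
  have h1Q: "c0 * h1n w \<le> Q w w + (LINT x|lborel. \<bar>V x\<bar> * (w x)\<^sup>2)" for w
  proof -
    have "\<bar>LINT x|lborel. V x * (w x)\<^sup>2\<bar> \<le> (LINT x|lborel. \<bar>V x\<bar> * (w x)\<^sup>2)"
      using integral_abs_bound[of lborel "\<lambda>x. V x * (w x)\<^sup>2"] by (simp add: abs_mult)
    moreover have "c0 * dform w w \<le> 1 * dform w w" "c0 * ip w w \<le> - m * ip w w"
      by (intro mult_right_mono; simp add: c0_def dform_self_nonneg ip_self_nonneg)+
    ultimately show ?thesis unfolding Q_def hform_def h1n_def power2_eq_square[symmetric] distrib_left by linarith
  qed
  have Cau: "\<exists>N. \<forall>i\<ge>N. \<forall>j\<ge>N. h1n (\<lambda>x. u (r i) x - u (r j) x) < e" if e: "e > 0" for e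
  proof -
    have e': "c0 * e / 2 > 0" using c0 e by simp
    obtain N1 where N1: "\<forall>i\<ge>N1. \<forall>j\<ge>N1. (LINT x|lborel. \<bar>V x\<bar> * (u (r i) x - u (r j) x)\<^sup>2) < c0 * e / 2"
      using r(2) e' by blast
    have "c0 * e / 8 > 0" using c0 e by simp
    then obtain N2 where N2: "1 / real (Suc N2) < c0 * e / 8" using nat_approx_posE by blast
    have "h1n (\<lambda>x. u (r i) x - u (r j) x) < e" if ij: "i \<ge> max N1 N2" "j \<ge> max N1 N2" for i j
    proof -
      have q: "Q (u (r k)) (u (r k)) < c0 * e / 8" if "k \<ge> max N1 N2" for k
      proof -
        have "r k \<ge> N2" using seq_suble[OF r(1), of k] that by simp
        then have "1 / real (Suc (r k)) \<le> 1 / real (Suc N2)" by (simp add: frac_le)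
        then show ?thesis using u(3)[of "r k"] N2 by linarith
      qed
      have "c0 * h1n (\<lambda>x. u (r i) x - u (r j) x) \<le> Q (\<lambda>x. u (r i) x - u (r j) x) (\<lambda>x. u (r i) x - u (r j) x)
         + (LINT x|lborel. \<bar>V x\<bar> * (u (r i) x - u (r j) x)\<^sup>2)" by (rule h1Q)
      also have "\<dots> < c0 * e"
      proof -
        have "Q (\<lambda>x. u (r i) x - u (r j) x) (\<lambda>x. u (r i) x - u (r j) x) \<le> 2 * Q (u (r i)) (u (r i)) + 2 * Q (u (r j)) (u (r j))"
          by (rule Q_diff[OF u(1) u(1)])
        moreover have "(LINT x|lborel. \<bar>V x\<bar> * (u (r i) x - u (r j) x)\<^sup>2) < c0 * e / 2" using N1 ij by simp
        ultimately show ?thesis using q[OF ij(1)] q[OF ij(2)] by linarith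
      qed
      finally show ?thesis using c0 by simp
    qed
    then show ?thesis by blast
  qed
  obtain w where w: "w \<in> H1r" "(\<lambda>n. h1n (\<lambda>x. u (r n) x - w x)) \<longlonglongrightarrow> 0" "L2_lim (\<lambda>n. u (r n)) w"
    by (rule H1r_complete[where u="\<lambda>n. u (r n)", OF uH Cau])
  have uL: "u n \<in> L2" for n by (rule H1r_L2[OF uH])
  have ww: "ip w w = 1"
    using L2_lim_ip_self[OF uL w(3)] by (simp add: u(2) LIMSEQ_const_iff)
  have w\<phi>: "ip w (\<phi> i) = 0" if "i \<in> F" for i
  proof -
    have "ip (u n) (\<phi> i) = 0" for n using u(1)[of n] that by (simp add: A_def)
    then show ?thesis using L2_lim_ip[OF uL w(3) \<phi>L[OF that]] by (simp add: LIMSEQ_const_iff)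
  qed
  have wA: "w \<in> A" using w(1) w\<phi> by (simp add: A_def)
  have Qw: "Q w w = 0"
  proof -
    define K2 where "K2 = 2 + K - m"
    have Qh: "Q v v \<le> K2 * h1n v" if v: "v \<in> H1r" for v
    proof -
      have "\<bar>LINT x|lborel. V x * (v x)\<^sup>2\<bar> \<le> (LINT x|lborel. \<bar>V x\<bar> * (v x)\<^sup>2)"
        using integral_abs_bound[of lborel "\<lambda>x. V x * (v x)\<^sup>2"] by (simp add: abs_mult)
      then have "Q v v \<le> 2 * dform v v + (K - m) * ip v v"
        using K(2)[OF v] dform_self_nonneg[of v] unfolding Q_def hform_def power2_eq_square[symmetric]
        by (simp add: algebra_simps)
      also have "\<dots> \<le> K2 * dform v v + K2 * ip v v"
        using K(1) m0 by (intro add_mono mult_right_mono) (auto simp: K2_def dform_self_nonneg ip_self_nonneg)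
      finally show ?thesis by (simp add: h1n_def algebra_simps)
    qed
    \<comment> \<open>Writing w as u - (u - w) lets \<open>Q_diff\<close> take the place of a
      continuity statement for the form.\<close>
    have "Q w w \<le> 2 * (1 / real (Suc (r n))) + 2 * (K2 * h1n (\<lambda>x. u (r n) x - w x))" for n
    proof -
      have d: "(\<lambda>x. u (r n) x - w x) \<in> A" by (rule A_diff[OF u(1) wA])
      have "Q (\<lambda>x. u (r n) x - (u (r n) x - w x)) (\<lambda>x. u (r n) x - (u (r n) x - w x)) \<le>
         2 * Q (u (r n)) (u (r n)) + 2 * Q (\<lambda>x. u (r n) x - w x) (\<lambda>x. u (r n) x - w x)"
        by (rule Q_diff[OF u(1) d])
      then show ?thesis using u(3)[of "r n"] Qh[OF AH[OF d]] by simp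
    qed
    moreover have "(\<lambda>n. 2 * (1 / real (Suc (r n))) + 2 * (K2 * h1n (\<lambda>x. u (r n) x - w x))) \<longlonglongrightarrow> 2 * 0 + 2 * (K2 * 0)"
    proof (intro tendsto_intros w(2))
      show "(\<lambda>n. 1 / real (Suc (r n))) \<longlonglongrightarrow> 0"
        using LIMSEQ_subseq_LIMSEQ[OF lim_1_over_n[THEN LIMSEQ_Suc] r(1)] by (simp add: o_def)
    qed
    ultimately have "Q w w \<le> 2 * 0 + 2 * (K2 * 0)" by (intro LIMSEQ_le_const) auto
    then show ?thesis using Q0[OF wA] by simp
  qed
  have QA: "Q w v = 0" if v: "v \<in> A" for v
  proof (rule ccontr)
    assume b: "Q w v \<noteq> 0"
    \<comment> \<open>The minimiser of the quadratic in s after its leading coefficient is raised by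
      1; the increase makes the division safe when \<open>Q v v\<close> is 0.\<close>
    define s where "s = - Q w v / (Q v v + 1)"
    have q: "Q v v + 1 > 0" using Q0[OF v] by simp
    have "0 \<le> Q (\<lambda>x. w x + s * v x) (\<lambda>x. w x + s * v x)" by (rule Q0[OF A_add[OF wA A_cmult[OF v]]])
    also have "\<dots> = 2 * s * Q w v + s\<^sup>2 * Q v v" using Q_sq[OF w(1) AH[OF v], of s] Qw by simp
    also have "\<dots> \<le> 2 * s * Q w v + s\<^sup>2 * (Q v v + 1)" by (simp add: mult_left_mono)
    also have "s\<^sup>2 * (Q v v + 1) = - s * Q w v" using q by (simp add: s_def power2_eq_square)
    also have "2 * s * Q w v + - s * Q w v = - (Q w v)\<^sup>2 / (Q v v + 1)" by (simp add: s_def power2_eq_square)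
    also have "\<dots> < 0" using b q by (simp add: divide_neg_pos)
    finally show False by simp
  qed
  have "Q w v = 0" if v: "v \<in> H1r" for v
  proof -
    \<comment> \<open>z collects the components along the known eigenfunctions. Each is an
      eigenfunction orthogonal to w, so \<open>Q z w\<close> vanishes and the equation extends from
      A to all test functions.\<close>
    define z where "z = (\<lambda>x. \<Sum>i\<in>F. ip v (\<phi> i) * \<phi> i x)"
    have zH: "z \<in> H1r" unfolding z_def by (intro H1r_sum H1r_cmult \<phi>H)
    have "ip z (\<phi> j) = ip v (\<phi> j)" if "j \<in> F" for j unfolding z_def by (rule ip_sum_orthonormal[OF on F that])
    then have vA: "(\<lambda>x. v x - z x) \<in> A"
      using v zH \<phi>L by (auto simp: A_def H1r_diff ip_diff_left H1r_L2)
    have Qz: "Q z w = 0"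
    proof -
      have "hform V z w = (\<Sum>i\<in>F. hform V (\<lambda>x. ip v (\<phi> i) * \<phi> i x) w)"
        unfolding z_def by (rule hform_sum_left[OF H1r_cmult[OF \<phi>H] w(1) V])
      also have "\<dots> = (\<Sum>i\<in>F. 0)"
      proof (rule sum.cong[OF refl])
        fix i assume i: "i \<in> F"
        have "hform V (\<phi> i) w = l i * ip (\<phi> i) w" using eig[OF i] w(1) by (simp add: real_eigenfunction_def)
        then show "hform V (\<lambda>x. ip v (\<phi> i) * \<phi> i x) w = 0"
          using w\<phi>[OF i] hform_cmult_left[OF \<phi>H[OF i] w(1)] by (simp add: ip_commute)
      qed
      finally have h: "hform V z w = 0" by simp
      have "ip z w = (\<Sum>i\<in>F. ip (\<lambda>x. ip v (\<phi> i) * \<phi> i x) w)"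
        unfolding z_def by (rule ip_sum_left[OF L2_cmult[OF \<phi>L] H1r_L2[OF w(1)]])
      also have "\<dots> = 0" using w\<phi> by (simp add: ip_cmult_left ip_commute)
      finally show ?thesis using h by (simp add: Q_def)
    qed
    have "Q (\<lambda>x. (v x - z x) + z x) w = Q (\<lambda>x. v x - z x) w + Q z w"
      by (rule Q_add_left[OF AH[OF vA] zH w(1)])
    then show ?thesis using Qz QA[OF vA] Q_commute[of w] by simp
  qed
  then have "real_eigenfunction V m w" using w(1) by (simp add: real_eigenfunction_def Q_def)
  then show thesis using m ww w\<phi> by (intro that)
qed

end

section \<open>Eigensystems\<close>

text \<open>Reduces an unordered sum to a sequence of partial sums. The first form includes the
  default 0 of divergent sums, so that a pointwise infinite sum of measurable functions is seen to
  be measurable everywhere; the second serves for limits.\<close>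

lemma infsum_nat_set_nonneg:
  fixes a :: "nat \<Rightarrow> real" and I :: "nat set"
  defines "s \<equiv> \<lambda>N. \<Sum>i\<in>I \<inter> {..<N}. a i"
  assumes a: "\<And>i. i \<in> I \<Longrightarrow> 0 \<le> a i"
  shows "infsum a I = (if Cauchy s then lim s else 0)" and "bdd_above (range s) \<Longrightarrow> s \<longlonglongrightarrow> infsum a I"
proof -
  have fl: "filterlim (\<lambda>N. I \<inter> {..<N}) (finite_subsets_at_top I) sequentially"
    unfolding filterlim_iff eventually_finite_subsets_at_top eventually_sequentially
  proof (intro allI impI, elim exE conjE)
    fix P X assume X: "finite X" "X \<subseteq> I" "\<forall>Y. finite Y \<and> X \<subseteq> Y \<and> Y \<subseteq> I \<longrightarrow> P Y"
    obtain N0 where N0: "X \<subseteq> {..<N0}" using X(1) finite_nat_iff_bounded by blast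
    show "\<exists>N. \<forall>n\<ge>N. P (I \<inter> {..<n})"
    proof (intro exI[of _ N0] allI impI)
      fix n assume "N0 \<le> n"
      then have "X \<subseteq> I \<inter> {..<n}" using N0 X(2) by force
      then show "P (I \<inter> {..<n})" using X(3) by simp
    qed
  qed
  have lim1: "s \<longlonglongrightarrow> infsum a I" if "a summable_on I"
  proof -
    have "(sum a \<longlongrightarrow> infsum a I) (finite_subsets_at_top I)" using has_sum_infsum[OF that] by (simp add: has_sum_def)
    then show ?thesis unfolding s_def by (rule filterlim_compose[OF _ fl])
  qed
  have summ: "a summable_on I" if bdd: "bdd_above (range s)"
  proof (rule nonneg_bdd_above_summable_on[OF a])
    obtain B where B: "\<And>N. s N \<le> B" using bdd by (auto simp: bdd_above_def)
    have "sum a F \<le> B" if F: "F \<subseteq> I" "finite F" for F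
    proof -
      obtain N where N: "F \<subseteq> {..<N}" using F(2) finite_nat_iff_bounded by blast
      have "sum a F \<le> s N" unfolding s_def using F N a by (intro sum_mono2) auto
      then show ?thesis using B[of N] by linarith
    qed
    then show "bdd_above (sum a ` {F. F \<subseteq> I \<and> finite F})" by (auto simp: bdd_above_def)
  qed
  show "s \<longlonglongrightarrow> infsum a I" if "bdd_above (range s)" by (rule lim1[OF summ[OF that]])
  show "infsum a I = (if Cauchy s then lim s else 0)"
  proof (cases "Cauchy s")
    case True
    then have "Bseq s" by (rule Cauchy_Bseq)
    then have "bdd_above (range s)" by (rule Bseq_bdd_above)
    then show ?thesis using True limI[OF lim1[OF summ]] by simp
  next
    case False
    then have "\<not> a summable_on I" using lim1 LIMSEQ_imp_Cauchy by blast
    then show ?thesis using False by (simp add: infsum_not_exists)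
  qed
qed

text \<open>Real and imaginary part of a vanishing complex combination of real functions vanish
  separately, and inner products with the family read off the coefficients.\<close>

lemma eigen_mult_ge:
  fixes f :: "nat \<Rightarrow> real^'d \<Rightarrow> real"
  assumes on: "orthonormal_on {..<n} f" and e: "\<And>k. k < n \<Longrightarrow> (\<lambda>x. complex_of_real (f k x)) \<in> eigenspace V \<mu>"
  shows "enat n \<le> eigen_mult V \<mu>"
proof -
  have "ae_independent n (\<lambda>k x. complex_of_real (f k x))"
    unfolding ae_independent_def
  proof (intro allI impI)
    fix c :: "nat \<Rightarrow> complex" and j
    assume z: "AE x in lborel. (\<Sum>k<n. c k * complex_of_real (f k x)) = 0" and j: "j < n"
    have fL: "f k \<in> L2" if "k < n" for k using orthonormal_onD[OF on] that by simp
    have *: "b j = 0" if b: "AE x in lborel. (\<Sum>k<n. b k * f k x) = 0" for b :: "nat \<Rightarrow> real"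
    proof -
      have "ip (\<lambda>x. \<Sum>k<n. b k * f k x) (f j) = ip (\<lambda>x. 0) (f j)"
        using b L2_measurable[OF L2_sum[OF L2_cmult[OF fL]], of "{..<n}"] L2_measurable[OF fL[OF j]]
        by (intro ip_cong_AE) auto
      then show ?thesis using ip_sum_orthonormal[OF on, of j b] j by simp
    qed
    have "AE x in lborel. (\<Sum>k<n. Re (c k) * f k x) = 0"
      using z
    proof eventually_elim
      case (elim x)
      then have "Re (\<Sum>k<n. c k * complex_of_real (f k x)) = 0" by simp
      then show ?case by (simp add: Re_sum)
    qed
    then have "Re (c j) = 0" by (rule *)
    moreover have "AE x in lborel. (\<Sum>k<n. Im (c k) * f k x) = 0"
      using z
    proof eventually_elim
      case (elim x)
      then have "Im (\<Sum>k<n. c k * complex_of_real (f k x)) = 0" by simp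
      then show ?case by (simp add: Im_sum)
    qed
    then have "Im (c j) = 0" by (rule *)
    ultimately show "c j = 0" by (simp add: complex_eq_iff)
  qed
  then have "enat n \<in> {enat n |n. \<exists>u. (\<forall>k<n. u k \<in> eigenspace V \<mu>) \<and> ae_independent n u}"
    using e by (intro CollectI exI[of _ n] conjI refl exI[of _ "\<lambda>k x. complex_of_real (f k x)"]) simp_all
  then show ?thesis unfolding eigen_mult_def by (rule Sup_upper)
qed

locale eigensystem = exponents \<gamma> p C T for \<gamma> p C and T :: "'d::finite itself" +
  fixes V :: "real^'d \<Rightarrow> real" and I :: "nat set" and l :: "nat \<Rightarrow> real" and \<psi> :: "nat \<Rightarrow> real^'d \<Rightarrow> real"
  assumes V: "V \<in> Lp p" and sys: "neg_eigensystem V I l \<psi>"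
begin

section \<open>Finiteness of the levels and the energy as a supremum\<close>

lemma l_neg: "i \<in> I \<Longrightarrow> l i < 0"
  using sys by (simp add: neg_eigensystem_def)

lemma eigenfunction: "i \<in> I \<Longrightarrow> real_eigenfunction V (l i) (\<psi> i)"
  using sys eigenspace_of_real_iff[OF V] by (simp add: neg_eigensystem_def)

lemma psi_H1r: "i \<in> I \<Longrightarrow> \<psi> i \<in> H1r"
  using eigenfunction by (simp add: real_eigenfunction_def)

lemma psi_orthonormal: "orthonormal_on I \<psi>"
  unfolding orthonormal_on_def
proof (intro conjI ballI)
  show L: "\<psi> i \<in> L2" if "i \<in> I" for i by (rule H1r_L2[OF psi_H1r[OF that]])
  fix i j assume i: "i \<in> I" and j: "j \<in> I"
  have "L2_inner (\<lambda>x. complex_of_real (\<psi> i x)) (\<lambda>x. complex_of_real (\<psi> j x)) = (if i = j then 1 else 0)"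
    using sys i j by (simp add: neg_eigensystem_def)
  moreover have "L2_inner (\<lambda>x. complex_of_real (\<psi> i x)) (\<lambda>x. complex_of_real (\<psi> j x)) = Complex (ip (\<psi> i) (\<psi> j)) 0"
    using L2_inner_real_left[OF L[OF i], of "\<lambda>x. complex_of_real (\<psi> j x)"] L[OF j] by (simp add: Lp_2_of_real)
  ultimately show "ip (\<psi> i) (\<psi> j) = (if i = j then 1 else 0)"
    by (auto simp: complex_eq_iff split: if_splits)
qed

abbreviation "\<kappa> \<equiv> \<lambda>i. - l i"

lemma kappa_pos: "i \<in> I \<Longrightarrow> \<kappa> i > 0" using l_neg by simp

lemma LT_bound:
  assumes F: "finite F" "F \<subseteq> I"
  shows "(\<Sum>i\<in>F. \<kappa> i powr (\<gamma> - 1) * dform (\<psi> i) (\<psi> i)) + (\<Sum>i\<in>F. \<kappa> i powr \<gamma>) = - (LINT x|lborel. V x * wdens \<gamma> F \<kappa> \<psi> x)"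
    "(\<Sum>i\<in>F. \<kappa> i powr (\<gamma> - 1) * dform (\<psi> i) (\<psi> i)) + (\<Sum>i\<in>F. \<kappa> i powr \<gamma>) \<le> LT_const * Lpi p V"
proof -
  have e: "real_eigenfunction V (- \<kappa> i) (\<psi> i)" if "i \<in> F" for i using eigenfunction F that by auto
  have k: "\<kappa> i > 0" if "i \<in> F" for i using kappa_pos F that by auto
  note * = Lieb_Thirring[where \<kappa>=\<kappa> and u=\<psi>, OF F(1) orthonormal_on_subset[OF psi_orthonormal F(2)] V e k]
  show "(\<Sum>i\<in>F. \<kappa> i powr (\<gamma> - 1) * dform (\<psi> i) (\<psi> i)) + (\<Sum>i\<in>F. \<kappa> i powr \<gamma>) = - (LINT x|lborel. V x * wdens \<gamma> F \<kappa> \<psi> x)"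
    by (rule *(1))
  show "(\<Sum>i\<in>F. \<kappa> i powr (\<gamma> - 1) * dform (\<psi> i) (\<psi> i)) + (\<Sum>i\<in>F. \<kappa> i powr \<gamma>) \<le> LT_const * Lpi p V"
    by (rule *(2))
qed

lemma eigenvalue_sum_bound:
  assumes F: "finite F" "F \<subseteq> I"
  shows "(\<Sum>i\<in>F. \<kappa> i powr \<gamma>) \<le> LT_const * Lpi p V"
proof -
  have "0 \<le> (\<Sum>i\<in>F. \<kappa> i powr (\<gamma> - 1) * dform (\<psi> i) (\<psi> i))"
    by (intro sum_nonneg mult_nonneg_nonneg dform_self_nonneg) auto
  then show ?thesis using LT_bound(2)[OF F] by linarith
qed

text \<open>Each index in the set contributes at least eps^gamma to a sum with a bound independent
  of the number of terms. Multiplicities are therefore finite, and projections onto levels below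
  -eps are finite sums.\<close>

lemma finite_levels:
  assumes "\<epsilon> > 0" shows "finite {i\<in>I. l i \<le> - \<epsilon>}"
proof (rule ccontr)
  assume inf: "infinite {i\<in>I. l i \<le> - \<epsilon>}"
  have e: "\<epsilon> powr \<gamma> > 0" using assms by simp
  obtain n :: nat where n: "LT_const * Lpi p V / \<epsilon> powr \<gamma> < real n" using reals_Archimedean2 by blast
  obtain F where F: "finite F" "card F = n" "F \<subseteq> {i\<in>I. l i \<le> - \<epsilon>}"
    using infinite_arbitrarily_large[OF inf] by blast
  have "real n * \<epsilon> powr \<gamma> = (\<Sum>i\<in>F. \<epsilon> powr \<gamma>)" by (simp add: F(2))
  also have "\<dots> \<le> (\<Sum>i\<in>F. \<kappa> i powr \<gamma>)"
    using F(3) assms gamma by (intro sum_mono powr_mono2) auto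
  also have "\<dots> \<le> LT_const * Lpi p V" using F by (intro eigenvalue_sum_bound) auto
  finally show False using n e by (simp add: divide_less_eq)
qed

lemma finite_fiber: "\<mu> < 0 \<Longrightarrow> finite {i\<in>I. l i = \<mu>}"
  by (rule finite_subset[OF _ finite_levels[of "- \<mu>"]]) auto

lemma eigen_mult_eq: "\<mu> < 0 \<Longrightarrow> eigen_mult V \<mu> = enat (card {i\<in>I. l i = \<mu>})"
  using sys finite_fiber by (simp add: neg_eigensystem_def)

text \<open>A level of finite multiplicity contributes one equal term for each listed index in its
  fibre; for a value that is not listed the fibre is empty.\<close>

lemma energy_eq_Sup: "energy \<gamma> V = (SUP M\<in>{M. finite M \<and> M \<subseteq> {..<0}}. \<Sum>\<mu>\<in>M. ennreal (\<Sum>i\<in>{i\<in>I. l i = \<mu>}. \<kappa> i powr \<gamma>))"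
proof -
  have "energy \<gamma> V = (SUP M\<in>{M. finite M \<and> M \<subseteq> {..<0}}. \<Sum>\<mu>\<in>M. ennreal_of_enat (eigen_mult V \<mu>) * ennreal (\<bar>\<mu>\<bar> powr \<gamma>))"
    unfolding energy_def by (rule nonneg_infsum_complete) simp
  also have "\<dots> = (SUP M\<in>{M. finite M \<and> M \<subseteq> {..<0}}. \<Sum>\<mu>\<in>M. ennreal (\<Sum>i\<in>{i\<in>I. l i = \<mu>}. \<kappa> i powr \<gamma>))"
  proof (rule SUP_cong[OF refl], rule sum.cong[OF refl])
    fix M \<mu> assume "M \<in> {M. finite M \<and> M \<subseteq> {..<0::real}}" "\<mu> \<in> M"
    then have \<mu>: "\<mu> < 0" by auto
    have "(\<Sum>i\<in>{i\<in>I. l i = \<mu>}. \<kappa> i powr \<gamma>) = (\<Sum>i\<in>{i\<in>I. l i = \<mu>}. \<bar>\<mu>\<bar> powr \<gamma>)"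
      using \<mu> by (intro sum.cong) auto
    then show "ennreal_of_enat (eigen_mult V \<mu>) * ennreal (\<bar>\<mu>\<bar> powr \<gamma>) = ennreal (\<Sum>i\<in>{i\<in>I. l i = \<mu>}. \<kappa> i powr \<gamma>)"
      using \<mu> by (simp add: eigen_mult_eq[OF \<mu>] ennreal_mult ennreal_of_nat_eq_real_of_nat abs_of_neg)
  qed
  finally show ?thesis .
qed

lemma energy_le:
  assumes X: "\<And>F. finite F \<Longrightarrow> F \<subseteq> I \<Longrightarrow> (\<Sum>i\<in>F. \<kappa> i powr \<gamma>) \<le> X"
  shows "energy \<gamma> V \<le> ennreal X"
  unfolding energy_eq_Sup
proof (rule SUP_least)
  fix M assume "M \<in> {M. finite M \<and> M \<subseteq> {..<0::real}}"
  then have M: "finite M" "M \<subseteq> {..<0}" by auto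
  have fin: "finite {i\<in>I. l i = \<mu>}" if "\<mu> \<in> M" for \<mu> using finite_fiber M that by auto
  have "(\<Sum>\<mu>\<in>M. ennreal (\<Sum>i\<in>{i\<in>I. l i = \<mu>}. \<kappa> i powr \<gamma>)) = ennreal (\<Sum>\<mu>\<in>M. \<Sum>i\<in>{i\<in>I. l i = \<mu>}. \<kappa> i powr \<gamma>)"
    by (rule sum_ennreal) (auto intro: sum_nonneg)
  also have "(\<Sum>\<mu>\<in>M. \<Sum>i\<in>{i\<in>I. l i = \<mu>}. \<kappa> i powr \<gamma>) = (\<Sum>i\<in>(\<Union>\<mu>\<in>M. {i\<in>I. l i = \<mu>}). \<kappa> i powr \<gamma>)"
    by (rule sum.UNION_disjoint[symmetric]) (use M fin in auto)
  also have "ennreal \<dots> \<le> ennreal X"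
    by (rule ennreal_leI[OF X]) (use M fin in auto)
  finally show "(\<Sum>\<mu>\<in>M. ennreal (\<Sum>i\<in>{i\<in>I. l i = \<mu>}. \<kappa> i powr \<gamma>)) \<le> ennreal X" .
qed

lemma energy_ge:
  assumes F: "finite F" "F \<subseteq> I"
  shows "ennreal (\<Sum>i\<in>F. \<kappa> i powr \<gamma>) \<le> energy \<gamma> V"
proof -
  \<comment> \<open>Each level met by F is filled up to its whole fibre, which can only increase the
    sum.\<close>
  define M where "M = l ` F"
  have M: "finite M" "M \<subseteq> {..<0}" using F l_neg by (auto simp: M_def)
  have fin: "finite {i\<in>I. l i = \<mu>}" if "\<mu> \<in> M" for \<mu> using finite_fiber M that by auto
  have "(\<Sum>i\<in>F. \<kappa> i powr \<gamma>) \<le> (\<Sum>i\<in>(\<Union>\<mu>\<in>M. {i\<in>I. l i = \<mu>}). \<kappa> i powr \<gamma>)"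
    by (rule sum_mono2) (use F M fin in \<open>auto simp: M_def\<close>)
  also have "\<dots> = (\<Sum>\<mu>\<in>M. \<Sum>i\<in>{i\<in>I. l i = \<mu>}. \<kappa> i powr \<gamma>)"
    by (rule sum.UNION_disjoint) (use M fin in auto)
  finally have "ennreal (\<Sum>i\<in>F. \<kappa> i powr \<gamma>) \<le> ennreal (\<Sum>\<mu>\<in>M. \<Sum>i\<in>{i\<in>I. l i = \<mu>}. \<kappa> i powr \<gamma>)"
    by (rule ennreal_leI)
  also have "\<dots> = (\<Sum>\<mu>\<in>M. ennreal (\<Sum>i\<in>{i\<in>I. l i = \<mu>}. \<kappa> i powr \<gamma>))"
    by (rule sum_ennreal[symmetric]) (auto intro: sum_nonneg)
  also have "\<dots> \<le> energy \<gamma> V" unfolding energy_eq_Sup by (rule SUP_upper) (use M in auto)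
  finally show ?thesis .
qed

section \<open>The real energy and lower bounds for the form\<close>

definition E :: real where "E = enn2real (energy \<gamma> V)"

lemma energy_finite: "energy \<gamma> V < \<infinity>"
  using le_less_trans[OF energy_le[OF eigenvalue_sum_bound] ennreal_less_top] by simp

lemma E_nonneg: "0 \<le> E" by (simp add: E_def)

lemma energy_E: "energy \<gamma> V = ennreal E"
  using energy_finite unfolding E_def by (simp add: ennreal_enn2real)

lemma LT_const_nonneg: "0 \<le> LT_const" by (simp add: LT_const_def)

lemma E_bound: "E \<le> LT_const * Lpi p V"
proof -
  have "ennreal E \<le> ennreal (LT_const * Lpi p V)" using energy_le[OF eigenvalue_sum_bound] by (simp add: energy_E)
  then show ?thesis using LT_const_nonneg Lpi_nonneg[of p V] by (simp add: ennreal_le_iff)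
qed

lemma sum_le_E: "finite F \<Longrightarrow> F \<subseteq> I \<Longrightarrow> (\<Sum>i\<in>F. \<kappa> i powr \<gamma>) \<le> E"
  using energy_ge[of F] E_nonneg by (simp add: energy_E ennreal_le_iff)

lemma E_le:
  assumes "\<And>F. finite F \<Longrightarrow> F \<subseteq> I \<Longrightarrow> (\<Sum>i\<in>F. \<kappa> i powr \<gamma>) \<le> X" "0 \<le> X"
  shows "E \<le> X"
  using energy_le[OF assms(1)] assms(2) by (simp add: energy_E ennreal_le_iff)

text \<open>A trial function with smaller form value would yield, by minimisation, an eigenfunction that is
  orthogonal to all listed ones of the same eigenvalue, which exceeds the multiplicity.\<close>

lemma form_nonneg_complement:
  assumes \<epsilon>: "\<epsilon> > 0" and v: "v \<in> H1r" "\<And>i. i \<in> I \<Longrightarrow> l i \<le> - \<epsilon> \<Longrightarrow> ip v (\<psi> i) = 0"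
  shows "- \<epsilon> * ip v v \<le> hform V v v"
proof (rule ccontr)
  assume "\<not> ?thesis"
  then have neg: "hform V v v < - \<epsilon> * ip v v" by simp
  define F where "F = {i\<in>I. l i \<le> - \<epsilon>}"
  have F: "finite F" "F \<subseteq> I" unfolding F_def using finite_levels[OF \<epsilon>] by auto
  have on: "orthonormal_on F \<psi>" by (rule orthonormal_on_subset[OF psi_orthonormal F(2)])
  have ef: "real_eigenfunction V (l i) (\<psi> i)" if "i \<in> F" for i using eigenfunction F that by auto
  have vF: "ip v (\<psi> i) = 0" if "i \<in> F" for i using v(2) that by (simp add: F_def)
  obtain m w where w: "m < - \<epsilon>" "real_eigenfunction V m w" "ip w w = 1" and wF: "\<forall>i\<in>F. ip w (\<psi> i) = 0"
    using eigenfunction_below[where V=V and F=F and \<phi>=\<psi> and l=l and ?v0.0=v and \<epsilon>=\<epsilon>, OF V F(1) on ef v(1) vF neg] \<epsilon>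
    by (metis less_imp_le)
  have m: "m < 0" using w(1) \<epsilon> by simp
  define J where "J = {i\<in>I. l i = m}"
  \<comment> \<open>Because m < -eps, the whole fibre of m lies in F, so w is orthogonal to all of
    it.\<close>
  have J: "finite J" "J \<subseteq> F" using finite_fiber[OF m] w(1) by (auto simp: J_def F_def)
  define n where "n = card J"
  obtain b where b: "bij_betw b {..<n} J"
    using ex_bij_betw_nat_finite[OF J(1)] unfolding n_def lessThan_atLeast0 by blast
  \<comment> \<open>w is appended as one more eigenfunction for m, indexed by an initial segment as
    \<open>eigen_mult\<close> counts. The fibre may be empty; then m is an eigenvalue that the list
    omits.\<close>
  define f where "f = (\<lambda>k. if k < n then \<psi> (b k) else w)"
  have bJ: "b k \<in> J" if "k < n" for k using b that by (auto simp: bij_betw_def)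
  have bI: "b k \<in> I" if "k < n" for k using bJ[OF that] by (simp add: J_def)
  have inj: "b i = b j \<longleftrightarrow> i = j" if "i < n" "j < n" for i j
    using b that unfolding bij_betw_def by (meson inj_onD lessThan_iff)
  have wL: "w \<in> L2" using w(2) by (simp add: real_eigenfunction_def H1r_L2)
  have wb: "ip w (\<psi> (b k)) = 0" if "k < n" for k using wF J(2) bJ[OF that] by auto
  have "orthonormal_on {..<Suc n} f"
    unfolding orthonormal_on_def
  proof (intro conjI ballI)
    show "f i \<in> L2" if "i \<in> {..<Suc n}" for i
      using wL H1r_L2[OF psi_H1r[OF bI]] by (simp add: f_def)
    fix i j assume "i \<in> {..<Suc n}" "j \<in> {..<Suc n}"
    then have ij: "i < n \<or> i = n" "j < n \<or> j = n" by auto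
    have "ip (\<psi> (b i)) (\<psi> (b j)) = (if i = j then 1 else 0)" if "i < n" "j < n"
      using psi_orthonormal bI[OF that(1)] bI[OF that(2)] inj[OF that] by (simp add: orthonormal_on_def)
    then show "ip (f i) (f j) = (if i = j then 1 else 0)"
      using ij wb[of i] wb[of j] w(3) ip_commute[of "\<psi> (b i)" w] by (auto simp: f_def)
  qed
  moreover have "(\<lambda>x. complex_of_real (f k x)) \<in> eigenspace V m" if "k < Suc n" for k
    unfolding eigenspace_of_real_iff[OF V]
    using eigenfunction[OF bI, of k] bJ[of k] w(2) by (auto simp: f_def J_def)
  ultimately have "enat (Suc n) \<le> eigen_mult V m" by (rule eigen_mult_ge)
  then show False by (simp add: eigen_mult_eq[OF m] J_def[symmetric] n_def[symmetric])
qed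

text \<open>The form has no mixed terms between the span of finitely many eigenfunctions and its
  complement, and on the complement it is at least -eps. Stopping at -eps keeps the sum finite
  although eigenvalues may accumulate at 0.\<close>

lemma form_lower_bound:
  assumes \<epsilon>: "\<epsilon> > 0" and u: "u \<in> H1r"
  shows "- \<epsilon> * ip u u - (\<Sum>i\<in>{i\<in>I. l i \<le> - \<epsilon>}. \<kappa> i * (ip u (\<psi> i))\<^sup>2) \<le> hform V u u"
proof -
  define G where "G = {i\<in>I. l i \<le> - \<epsilon>}"
  have G: "finite G" "G \<subseteq> I" unfolding G_def using finite_levels[OF \<epsilon>] by auto
  have on: "orthonormal_on G \<psi>" by (rule orthonormal_on_subset[OF psi_orthonormal G(2)])
  have \<psi>H: "\<psi> i \<in> H1r" if "i \<in> G" for i using psi_H1r G that by auto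
  define z where "z = (\<lambda>x. \<Sum>i\<in>G. ip u (\<psi> i) * \<psi> i x)"
  define v where "v = (\<lambda>x. u x - z x)"
  have zH: "z \<in> H1r" unfolding z_def by (intro H1r_sum H1r_cmult \<psi>H)
  have vH: "v \<in> H1r" unfolding v_def by (rule H1r_diff[OF u zH])
  have z\<psi>: "ip z (\<psi> j) = ip u (\<psi> j)" if "j \<in> G" for j
    unfolding z_def by (rule ip_sum_orthonormal[OF on G(1) that])
  have v\<psi>: "ip v (\<psi> j) = 0" if "j \<in> G" for j
    unfolding v_def using z\<psi>[OF that] u zH \<psi>H[OF that] by (simp add: ip_diff_left H1r_L2)
  have zw: "hform V z w = (\<Sum>i\<in>G. ip u (\<psi> i) * (l i * ip w (\<psi> i)))" if w: "w \<in> H1r" for w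
  proof -
    have "hform V z w = (\<Sum>i\<in>G. hform V (\<lambda>x. ip u (\<psi> i) * \<psi> i x) w)"
      unfolding z_def by (rule hform_sum_left[OF H1r_cmult[OF \<psi>H] w V])
    also have "\<dots> = (\<Sum>i\<in>G. ip u (\<psi> i) * (l i * ip w (\<psi> i)))"
    proof (rule sum.cong[OF refl])
      fix i assume i: "i \<in> G"
      have "hform V (\<psi> i) w = l i * ip (\<psi> i) w" using eigenfunction G i w by (auto simp: real_eigenfunction_def)
      then show "hform V (\<lambda>x. ip u (\<psi> i) * \<psi> i x) w = ip u (\<psi> i) * (l i * ip w (\<psi> i))"
        by (simp add: hform_cmult_left[OF \<psi>H[OF i] w] ip_commute)
    qed
    finally show ?thesis .
  qed
  have u_eq: "u = (\<lambda>x. v x + z x)" by (simp add: v_def)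
  have zv: "hform V z v = 0" using zw[OF vH] v\<psi> by simp
  have zz: "hform V z z = - (\<Sum>i\<in>G. \<kappa> i * (ip u (\<psi> i))\<^sup>2)"
    unfolding zw[OF zH] using z\<psi> by (simp add: sum_negf[symmetric] power2_eq_square mult_ac)
  have "hform V u u = hform V v u + hform V z u"
    by (subst (1) u_eq) (rule hform_add_left[OF vH zH u V])
  also have "hform V v u = hform V v v + hform V v z"
    by (subst u_eq) (rule hform_add_right[OF vH zH vH V])
  also have "hform V z u = hform V z v + hform V z z"
    by (subst u_eq) (rule hform_add_right[OF vH zH zH V])
  also have "hform V v z = 0" using zv by (simp add: hform_commute[of V v z])
  finally have huu: "hform V u u = hform V v v - (\<Sum>i\<in>G. \<kappa> i * (ip u (\<psi> i))\<^sup>2)" using zv zz by simp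
  have "ip z v = (\<Sum>i\<in>G. ip (\<lambda>x. ip u (\<psi> i) * \<psi> i x) v)"
    unfolding z_def by (rule ip_sum_left) (use \<psi>H vH in \<open>auto intro: L2_cmult H1r_L2\<close>)
  also have "\<dots> = 0" using v\<psi> by (simp add: ip_cmult_left ip_commute)
  finally have izv: "ip z v = 0" .
  have "ip u u = ip v v + 2 * ip v z + ip z z"
    by (subst (1 2) u_eq) (rule ip_add_self[OF H1r_L2[OF vH] H1r_L2[OF zH]])
  then have "ip v v \<le> ip u u" using izv ip_self_nonneg[of z] by (simp add: ip_commute)
  then have "- \<epsilon> * ip u u \<le> - \<epsilon> * ip v v" using \<epsilon> by simp
  also have "\<dots> \<le> hform V v v"
    by (rule form_nonneg_complement[OF \<epsilon> vH]) (use v\<psi> in \<open>simp add: G_def\<close>)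
  finally show ?thesis unfolding huu G_def by simp
qed

text \<open>Weighted arithmetic-geometric mean with weights 1 - 1/gamma and 1/gamma; in this version
  gamma = 1, where the conjugate exponent is infinite, is covered as well.\<close>

lemma Young_powr:
  fixes x y :: real
  assumes "x > 0" "y > 0"
  shows "x powr (\<gamma> - 1) * y \<le> (1 - 1 / \<gamma>) * x powr \<gamma> + 1 / \<gamma> * y powr \<gamma>"
proof -
  have a: "0 < x powr \<gamma>" "0 < y powr \<gamma>" using assms by simp_all
  have b: "0 \<le> 1 - 1 / \<gamma>" "0 \<le> 1 / \<gamma>" "1 - 1 / \<gamma> + 1 / \<gamma> = 1" using gamma by simp_all
  have h: "(x powr \<gamma>) powr (1 - 1 / \<gamma>) * (y powr \<gamma>) powr (1 / \<gamma>) \<le> (1 - 1 / \<gamma>) * x powr \<gamma> + 1 / \<gamma> * y powr \<gamma>"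
    by (rule Youngs_inequality_0[OF b a])
  have d: "\<gamma> * (1 - 1 / \<gamma>) = \<gamma> - 1" "\<gamma> * (1 / \<gamma>) = 1" using gamma by (simp_all add: right_diff_distrib)
  have e: "y powr 1 = y" using assms(2) by simp
  show ?thesis using h unfolding powr_powr d e .
qed

text \<open>Bounding each form value through the eigenmodes of V produces products k_j^(gamma-1)
  kappa_i weighted by squared overlaps. Young's inequality separates the factors, and by Bessel in
  both directions the overlaps have row and column sums at most 1. The family u and the weights k
  are not tied to V, so eigenfunctions of one potential can be tested in the next.\<close>

theorem trace_inequality:
  fixes u :: "'i \<Rightarrow> real^'d \<Rightarrow> real" and k :: "'i \<Rightarrow> real"
  assumes F: "finite F" and on: "orthonormal_on F u" and H: "\<And>j. j \<in> F \<Longrightarrow> u j \<in> H1r" and k: "\<And>j. j \<in> F \<Longrightarrow> k j > 0"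
  shows "- (\<Sum>j\<in>F. k j powr (\<gamma> - 1) * hform V (u j) (u j)) \<le> (1 - 1 / \<gamma>) * (\<Sum>j\<in>F. k j powr \<gamma>) + 1 / \<gamma> * E"
    (is "?L \<le> ?R")
proof -
  define s where "s = (\<Sum>j\<in>F. k j powr (\<gamma> - 1))"
  have s: "s \<ge> 0" unfolding s_def by (intro sum_nonneg) auto
  have g: "1 - 1 / \<gamma> \<ge> 0" "1 / \<gamma> \<ge> 0" using gamma by auto
  have *: "?L \<le> \<epsilon> * s + ?R" if \<epsilon>: "\<epsilon> > 0" for \<epsilon>
  proof -
    define G where "G = {i\<in>I. l i \<le> - \<epsilon>}"
    have G: "finite G" "G \<subseteq> I" unfolding G_def using finite_levels[OF \<epsilon>] by auto
    have onG: "orthonormal_on G \<psi>" by (rule orthonormal_on_subset[OF psi_orthonormal G(2)])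
    define a where "a = (\<lambda>j i. (ip (u j) (\<psi> i))\<^sup>2)"
    have uu: "ip (u j) (u j) = 1" if "j \<in> F" for j using on that by (simp add: orthonormal_on_def)
    have aj: "(\<Sum>i\<in>G. a j i) \<le> 1" if "j \<in> F" for j
      unfolding a_def using Bessel_inequality[OF onG G(1) orthonormal_onD[OF on that]] uu[OF that] by simp
    have ai: "(\<Sum>j\<in>F. a j i) \<le> 1" if "i \<in> G" for i
    proof -
      have "\<psi> i \<in> L2" "ip (\<psi> i) (\<psi> i) = 1" using onG that by (auto simp: orthonormal_on_def)
      then show ?thesis unfolding a_def using Bessel_inequality[OF on F, of "\<psi> i"] by (simp add: ip_commute)
    qed
    have "?L = (\<Sum>j\<in>F. k j powr (\<gamma> - 1) * (- hform V (u j) (u j)))" by (simp add: sum_negf)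
    also have "\<dots> \<le> (\<Sum>j\<in>F. k j powr (\<gamma> - 1) * (\<epsilon> + (\<Sum>i\<in>G. \<kappa> i * a j i)))"
    proof (intro sum_mono mult_left_mono)
      fix j assume j: "j \<in> F"
      show "- hform V (u j) (u j) \<le> \<epsilon> + (\<Sum>i\<in>G. \<kappa> i * a j i)"
        using form_lower_bound[OF \<epsilon> H[OF j]] uu[OF j] unfolding G_def a_def by simp
    qed simp
    also have "\<dots> = \<epsilon> * s + (\<Sum>j\<in>F. \<Sum>i\<in>G. (k j powr (\<gamma> - 1) * \<kappa> i) * a j i)"
      by (simp add: distrib_left sum.distrib s_def sum_distrib_left mult_ac)
    also have "(\<Sum>j\<in>F. \<Sum>i\<in>G. (k j powr (\<gamma> - 1) * \<kappa> i) * a j i) \<le>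
      (\<Sum>j\<in>F. \<Sum>i\<in>G. ((1 - 1 / \<gamma>) * k j powr \<gamma> + 1 / \<gamma> * \<kappa> i powr \<gamma>) * a j i)"
      using k kappa_pos G(2) by (intro sum_mono mult_right_mono Young_powr) (auto simp: a_def)
    also have "\<dots> = (1 - 1 / \<gamma>) * (\<Sum>j\<in>F. k j powr \<gamma> * (\<Sum>i\<in>G. a j i)) + 1 / \<gamma> * (\<Sum>i\<in>G. \<kappa> i powr \<gamma> * (\<Sum>j\<in>F. a j i))"
    proof -
      have "(\<Sum>j\<in>F. \<Sum>i\<in>G. (c * A j + d * B i) * a j i) = c * (\<Sum>j\<in>F. A j * (\<Sum>i\<in>G. a j i)) + d * (\<Sum>i\<in>G. B i * (\<Sum>j\<in>F. a j i))"
        for c d :: real and A B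
      proof -
        have "(\<Sum>j\<in>F. \<Sum>i\<in>G. B i * a j i) = (\<Sum>i\<in>G. \<Sum>j\<in>F. B i * a j i)" by (rule sum.swap)
        then show ?thesis by (simp add: distrib_right sum.distrib sum_distrib_left[symmetric] mult.assoc)
      qed
      then show ?thesis .
    qed
    also have "\<dots> \<le> (1 - 1 / \<gamma>) * (\<Sum>j\<in>F. k j powr \<gamma> * 1) + 1 / \<gamma> * (\<Sum>i\<in>G. \<kappa> i powr \<gamma> * 1)"
      using g aj ai by (intro add_mono mult_left_mono sum_mono) auto
    also have "\<dots> \<le> ?R" using mult_left_mono[OF sum_le_E[OF G] g(2)] by simp
    finally show ?thesis by simp
  qed
  \<comment> \<open>The error \<epsilon> s vanishes in the limit; dividing by s + 1 keeps the choice
    of \<epsilon> valid when s is 0.\<close>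
  show ?thesis
  proof (rule field_le_epsilon)
    fix e :: real assume e: "e > 0"
    have "?L \<le> e / (s + 1) * s + ?R" using e s by (intro *) simp
    also have "e / (s + 1) * s \<le> e" using e s by (simp add: divide_le_eq mult_left_le)
    finally show "?L \<le> ?R + e" by simp
  qed
qed

end

section \<open>One step of the algorithm\<close>

context eigensystem
begin

abbreviation "q \<equiv> p / (p - 1)"

abbreviation "\<rho> \<equiv> weighted_density \<gamma> I l \<psi>"

section \<open>Convergence and integrability of the weighted density\<close>

definition S :: "nat \<Rightarrow> real^'d \<Rightarrow> real" where
  "S N = wdens \<gamma> (I \<inter> {..<N}) \<kappa> \<psi>"

lemma q_gt_1: "q > 1" using p_gt_1 by (simp add: field_simps)

lemma psi_measurable: "i \<in> I \<Longrightarrow> \<psi> i \<in> borel_measurable borel"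
  by (rule L2_measurable[OF H1r_L2[OF psi_H1r]])

lemma S_measurable[measurable]: "S N \<in> borel_measurable borel"
  unfolding S_def by (rule wdens_measurable) (auto intro: psi_measurable)

lemma S_nonneg: "0 \<le> S N x" by (simp add: S_def wdens_nonneg)

lemma S_mono: "M \<le> N \<Longrightarrow> S M x \<le> S N x"
  unfolding S_def wdens_def by (rule sum_mono2) auto

lemma rho_eq: "\<rho> x = (if Cauchy (\<lambda>N. S N x) then lim (\<lambda>N. S N x) else 0)"
  unfolding weighted_density_def S_def wdens_def by (rule infsum_nat_set_nonneg(1)) simp

lemma rho_measurable[measurable]: "\<rho> \<in> borel_measurable borel"
proof -
  have "(\<lambda>x. if Cauchy (\<lambda>N. S N x) then lim (\<lambda>N. S N x) else 0) \<in> borel_measurable borel"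
    by measurable
  then show ?thesis by (simp add: rho_eq[abs_def])
qed

lemma rho_nonneg: "0 \<le> \<rho> x"
  unfolding weighted_density_def by (rule infsum_nonneg) simp

lemma S_integral:
  shows "integrable lborel (\<lambda>x. S N x powr q)" and "(LINT x|lborel. S N x powr q) \<le> C * (LT_const * Lpi p V)"
proof -
  have F: "finite (I \<inter> {..<N})" "I \<inter> {..<N} \<subseteq> I" by auto
  have H: "\<psi> i \<in> H1r" if "i \<in> I \<inter> {..<N}" for i using psi_H1r that by auto
  have k: "\<kappa> i > 0" if "i \<in> I \<inter> {..<N}" for i using kappa_pos that by auto
  note D = dual_Lieb_Thirring[where \<kappa>=\<kappa> and u=\<psi>, OF gamma F(1) orthonormal_on_subset[OF psi_orthonormal F(2)] H k, folded p_eq C_eq]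
  show "integrable lborel (\<lambda>x. S N x powr q)" unfolding S_def by (rule D(1))
  have "(LINT x|lborel. S N x powr q) \<le>
    C * ((\<Sum>i\<in>I \<inter> {..<N}. \<kappa> i powr (\<gamma> - 1) * dform (\<psi> i) (\<psi> i)) + (\<Sum>i\<in>I \<inter> {..<N}. \<kappa> i powr \<gamma>))"
    unfolding S_def by (rule D(2))
  also have "\<dots> \<le> C * (LT_const * Lpi p V)"
    using C_pos LT_bound(2)[OF F] by (intro mult_left_mono) auto
  finally show "(LINT x|lborel. S N x powr q) \<le> C * (LT_const * Lpi p V)" .
qed

lemma S_nn_integral: "(\<integral>\<^sup>+x. ennreal (S N x powr q) \<partial>lborel) \<le> ennreal (C * (LT_const * Lpi p V))"
  using nn_integral_eq_integral[OF S_integral(1)[of N]] S_integral(2)[of N] by (auto intro: ennreal_leI)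

text \<open>Monotone convergence gives the supremum of the powers a finite integral, so it is finite
  almost everywhere. The default value of a divergent density thus occurs only on a null
  set.\<close>

lemma S_bounded_AE: "AE x in lborel. bdd_above (range (\<lambda>N. S N x))"
proof -
  have inc: "incseq (\<lambda>N x. ennreal (S N x powr q))"
    using q_gt_1 by (auto simp: incseq_def le_fun_def intro!: ennreal_leI powr_mono2 S_mono S_nonneg)
  have "(\<integral>\<^sup>+x. (SUP N. ennreal (S N x powr q)) \<partial>lborel) = (SUP N. \<integral>\<^sup>+x. ennreal (S N x powr q) \<partial>lborel)"
    by (rule nn_integral_monotone_convergence_SUP[OF inc]) measurable
  also have "\<dots> \<le> ennreal (C * (LT_const * Lpi p V))" by (rule SUP_least) (rule S_nn_integral)
  also have "\<dots> < \<infinity>" by simp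
  finally have "(\<integral>\<^sup>+x. (SUP N. ennreal (S N x powr q)) \<partial>lborel) < \<infinity>" .
  then have "AE x in lborel. (SUP N. ennreal (S N x powr q)) \<noteq> \<infinity>"
    by (intro nn_integral_PInf_AE) auto
  then show ?thesis
  proof eventually_elim
    case (elim x)
    then obtain B where B: "(SUP N. ennreal (S N x powr q)) = ennreal B" "B \<ge> 0"
      by (cases "SUP N. ennreal (S N x powr q)") auto
    have "S N x \<le> 1 + B" for N
    proof -
      have "ennreal (S N x powr q) \<le> ennreal B" unfolding B(1)[symmetric] by (rule SUP_upper) simp
      then have s: "S N x powr q \<le> B" using B(2) by (simp add: ennreal_le_iff)
      show ?thesis
      proof (cases "S N x \<le> 1")
        case True then show ?thesis using B by simp
      next
        case False
        then have "S N x powr 1 \<le> S N x powr q" using q_gt_1 by (intro powr_mono) auto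
        then show ?thesis using s False by simp
      qed
    qed
    then show ?case by (auto simp: bdd_above_def)
  qed
qed

lemma S_tendsto_AE: "AE x in lborel. (\<lambda>N. S N x) \<longlonglongrightarrow> \<rho> x"
  using S_bounded_AE
proof eventually_elim
  case (elim x)
  then show ?case unfolding weighted_density_def S_def wdens_def
    by (intro infsum_nat_set_nonneg(2)) simp_all
qed

lemma S_le_rho_AE: "AE x in lborel. \<forall>N. S N x \<le> \<rho> x"
  using S_tendsto_AE
proof eventually_elim
  case (elim x)
  have "incseq (\<lambda>N. S N x)" by (auto simp: incseq_def intro: S_mono)
  then show ?case using incseq_le[OF _ elim] by blast
qed

lemma rho_integrable: "integrable lborel (\<lambda>x. \<rho> x powr q)"
proof (rule integrableI_nonneg)
  have "(\<integral>\<^sup>+x. ennreal (\<rho> x powr q) \<partial>lborel) \<le> (\<integral>\<^sup>+x. liminf (\<lambda>N. ennreal (S N x powr q)) \<partial>lborel)"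
  proof (rule nn_integral_mono_AE)
    show "AE x in lborel. ennreal (\<rho> x powr q) \<le> liminf (\<lambda>N. ennreal (S N x powr q))"
      using S_tendsto_AE
    proof eventually_elim
      case (elim x)
      have "(\<lambda>N. S N x powr q) \<longlonglongrightarrow> \<rho> x powr q"
        by (rule tendsto_powr'[OF elim tendsto_const]) (use q_gt_1 S_nonneg in auto)
      then have "(\<lambda>N. ennreal (S N x powr q)) \<longlonglongrightarrow> ennreal (\<rho> x powr q)" by (rule tendsto_ennrealI)
      then have "liminf (\<lambda>N. ennreal (S N x powr q)) = ennreal (\<rho> x powr q)"
        by (rule lim_imp_Liminf[OF trivial_limit_sequentially])
      then show ?case by simp
    qed
  qed
  also have "\<dots> \<le> liminf (\<lambda>N. \<integral>\<^sup>+x. ennreal (S N x powr q) \<partial>lborel)" by (rule nn_integral_liminf) measurable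
  also have "\<dots> \<le> ennreal (C * (LT_const * Lpi p V))"
    by (rule Liminf_le) (use S_nn_integral in auto)
  also have "\<dots> < \<infinity>" by simp
  finally show "(\<integral>\<^sup>+x. ennreal (\<rho> x powr q) \<partial>lborel) < \<infinity>" .
qed auto

text \<open>The normalisation K of the algorithm is \<open>R powr (- 1 / p)\<close>.\<close>

definition R :: real where "R = (LINT x|lborel. \<rho> x powr q)"

lemma R_nonneg: "0 \<le> R" by (simp add: R_def)

section \<open>Duality between the density and the potential\<close>

lemma potential_rho_integrable:
  assumes W: "W \<in> Lp p"
  shows "integrable lborel (\<lambda>x. \<bar>W x\<bar> * \<rho> x)" and "integrable lborel (\<lambda>x. W x * \<rho> x)"
proof -
  have [measurable]: "W \<in> borel_measurable borel" using W by measurable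
  have "integrable lborel (\<lambda>x. 1 * \<rho> x powr q + 1 powr (- (p - 1)) * \<bar>W x\<bar> powr p)"
    using W rho_integrable by (simp add: Lp_real_iff)
  then show i: "integrable lborel (\<lambda>x. \<bar>W x\<bar> * \<rho> x)"
  proof (rule Bochner_Integration.integrable_bound)
    show "AE x in lborel. norm (\<bar>W x\<bar> * \<rho> x) \<le> norm (1 * \<rho> x powr q + 1 powr (- (p - 1)) * \<bar>W x\<bar> powr p)"
    proof (rule AE_I2)
      fix x
      have "\<bar>W x\<bar> * \<rho> x \<le> 1 * \<rho> x powr q + 1 powr (- (p - 1)) * \<bar>W x\<bar> powr p"
        by (rule Young_eps[OF p_gt_1]) (auto simp: rho_nonneg)
      then show "norm (\<bar>W x\<bar> * \<rho> x) \<le> norm (1 * \<rho> x powr q + 1 powr (- (p - 1)) * \<bar>W x\<bar> powr p)"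
        using rho_nonneg[of x] by simp
    qed
  qed measurable
  show "integrable lborel (\<lambda>x. W x * \<rho> x)"
    by (rule Bochner_Integration.integrable_bound[OF i]) (auto simp: abs_mult)
qed

text \<open>Young's inequality after scaling the density to norm 1 in the conjugate exponent, whose
  reciprocal is (p - 1)/p. The case R = 0 is separate since the density cannot then be scaled to
  norm 1.\<close>

lemma potential_rho_Hoelder:
  assumes W: "W \<in> Lp p" and W1: "Lpi p W \<le> 1"
  shows "(LINT x|lborel. \<bar>W x\<bar> * \<rho> x) \<le> R powr ((p - 1) / p)"
proof (cases "R = 0")
  case True
  then have "AE x in lborel. \<rho> x powr q = 0"
    unfolding R_def using integral_nonneg_eq_0_iff_AE[OF rho_integrable] by simp
  then have "AE x in lborel. \<bar>W x\<bar> * \<rho> x = 0" by eventually_elim simp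
  then have "(LINT x|lborel. \<bar>W x\<bar> * \<rho> x) = 0" by (rule integral_eq_zero_AE)
  then show ?thesis by simp
next
  case False
  then have R: "R > 0" using R_nonneg by simp
  define s where "s = R powr (- ((p - 1) / p))"
  have s: "s > 0" using R by (simp add: s_def)
  have sq: "s powr q = 1 / R"
  proof -
    have e: "- ((p - 1) / p) * q = - 1" using p_gt_1 by (simp add: field_simps)
    show ?thesis unfolding s_def powr_powr e using R by (simp add: powr_minus_divide)
  qed
  have pq: "1 / p + 1 / q = 1" using p_gt_1 by (simp add: field_simps)
  have "s * (LINT x|lborel. \<bar>W x\<bar> * \<rho> x) = (LINT x|lborel. \<bar>W x\<bar> * (s * \<rho> x))" by (simp add: mult.left_commute)
  also have "\<dots> \<le> (LINT x|lborel. 1 / p * \<bar>W x\<bar> powr p + 1 / (q * R) * \<rho> x powr q)"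
  proof (rule integral_mono)
    show "integrable lborel (\<lambda>x. \<bar>W x\<bar> * (s * \<rho> x))"
      using integrable_mult_right[OF potential_rho_integrable(1)[OF W], of s] by (simp add: mult.left_commute)
    show "integrable lborel (\<lambda>x. 1 / p * \<bar>W x\<bar> powr p + 1 / (q * R) * \<rho> x powr q)"
      using W rho_integrable by (intro Bochner_Integration.integrable_add integrable_mult_right) (auto simp: Lp_real_iff)
    show "\<bar>W x\<bar> * (s * \<rho> x) \<le> 1 / p * \<bar>W x\<bar> powr p + 1 / (q * R) * \<rho> x powr q" for x
    proof -
      have "\<bar>W x\<bar> * (s * \<rho> x) \<le> \<bar>W x\<bar> powr p / p + (s * \<rho> x) powr q / q"
        by (rule Youngs_inequality[OF p_gt_1 q_gt_1 pq]) (use s rho_nonneg[of x] in auto)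
      also have "(s * \<rho> x) powr q = 1 / R * \<rho> x powr q"
        using s rho_nonneg[of x] by (simp add: powr_mult sq[symmetric])
      finally show ?thesis by (simp add: mult.commute)
    qed
  qed
  also have "\<dots> = 1 / p * Lpi p W + 1 / (q * R) * R"
    using W rho_integrable by (simp add: Lp_real_iff Lpi_def R_def)
  also have "\<dots> \<le> 1 / p * 1 + 1 / q" using W1 R p_gt_1 by (intro add_mono mult_left_mono) auto
  also have "\<dots> = 1" using pq by simp
  finally have "(LINT x|lborel. \<bar>W x\<bar> * \<rho> x) \<le> 1 / s" using s by (simp add: field_simps)
  also have "1 / s = R powr ((p - 1) / p)" using R by (simp add: s_def powr_minus_divide)
  finally show ?thesis .
qed

text \<open>The exponent 1/(p - 1) turns both |W|^p and W rho into multiples of rho^(p/(p-1)). The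
  norm is only bounded by 1, not equal to it: for R = 0 the convention for powers of 0 makes W
  vanish.\<close>

lemma next_potential:
  assumes W: "W \<in> borel_measurable borel" and WA: "AE x in lborel. W x = - (R powr (- 1 / p)) * \<rho> x powr (1 / (p - 1))"
  shows "W \<in> Lp p" "Lpi p W \<le> 1" "- (LINT x|lborel. W x * \<rho> x) = R powr ((p - 1) / p)"
proof -
  have [measurable]: "W \<in> borel_measurable borel" by fact
  have AE1: "AE x in lborel. \<bar>W x\<bar> powr p = R powr (- 1) * \<rho> x powr q"
    using WA
  proof eventually_elim
    case (elim x)
    have "\<bar>W x\<bar> = R powr (- 1 / p) * \<rho> x powr (1 / (p - 1))" by (simp add: elim abs_mult)
    then have "\<bar>W x\<bar> powr p = (R powr (- 1 / p)) powr p * (\<rho> x powr (1 / (p - 1))) powr p"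
      by (simp add: powr_mult)
    then show ?case using p_gt_1 by (simp add: powr_powr)
  qed
  have i: "integrable lborel (\<lambda>x. R powr (- 1) * \<rho> x powr q)" by (intro integrable_mult_right rho_integrable)
  have iW: "integrable lborel (\<lambda>x. \<bar>W x\<bar> powr p)"
    by (rule integrable_cong_AE_imp[OF i]) (use AE1 in \<open>auto elim: eventually_mono\<close>)
  show "W \<in> Lp p" using iW by (simp add: Lp_real_iff)
  have "Lpi p W = (LINT x|lborel. R powr (- 1) * \<rho> x powr q)"
    unfolding Lpi_def by (rule integral_cong_AE) (use AE1 in auto)
  also have "\<dots> = R powr (- 1) * R" by (simp add: R_def)
  also have "\<dots> \<le> 1" using R_nonneg by (cases "R = 0") (auto simp: powr_minus_divide)
  finally show "Lpi p W \<le> 1" .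
  have "AE x in lborel. W x * \<rho> x = - (R powr (- 1 / p)) * \<rho> x powr q"
    using WA
  proof eventually_elim
    case (elim x)
    have "\<rho> x * \<rho> x powr (1 / (p - 1)) = \<rho> x powr (1 + 1 / (p - 1))" by (rule powr_mult_base[OF rho_nonneg])
    also have "1 + 1 / (p - 1) = q" using p_gt_1 by (simp add: field_simps)
    finally show ?case by (simp add: elim mult_ac)
  qed
  then have "(LINT x|lborel. W x * \<rho> x) = (LINT x|lborel. - (R powr (- 1 / p)) * \<rho> x powr q)"
    by (intro integral_cong_AE) auto
  also have "\<dots> = - (R powr (- 1 / p)) * R" by (simp add: R_def)
  finally have "- (LINT x|lborel. W x * \<rho> x) = R * R powr (- 1 / p)" by simp
  also have "\<dots> = R powr (1 + - 1 / p)" by (rule powr_mult_base[OF R_nonneg])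
  also have "1 + - 1 / p = (p - 1) / p" using p_gt_1 by (simp add: field_simps)
  finally show "- (LINT x|lborel. W x * \<rho> x) = R powr ((p - 1) / p)" .
qed

text \<open>The density dominates its own partial sums, and its product with |W| is
  integrable.\<close>

lemma potential_S_tendsto:
  assumes W: "W \<in> Lp p"
  shows "(\<lambda>N. LINT x|lborel. W x * S N x) \<longlonglongrightarrow> (LINT x|lborel. W x * \<rho> x)"
proof (rule integral_dominated_convergence[where w="\<lambda>x. \<bar>W x\<bar> * \<rho> x"])
  have Wm[measurable]: "W \<in> borel_measurable borel" using W by measurable
  show "(\<lambda>x. W x * \<rho> x) \<in> borel_measurable lborel" "(\<lambda>x. W x * S N x) \<in> borel_measurable lborel" for N
    by measurable
  show "integrable lborel (\<lambda>x. \<bar>W x\<bar> * \<rho> x)" by (rule potential_rho_integrable(1)[OF W])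
  show "AE x in lborel. (\<lambda>N. W x * S N x) \<longlonglongrightarrow> W x * \<rho> x"
    using S_tendsto_AE by eventually_elim (intro tendsto_intros)
  show "AE x in lborel. norm (W x * S N x) \<le> \<bar>W x\<bar> * \<rho> x" for N
    using S_le_rho_AE
  proof eventually_elim
    case (elim x)
    have "\<bar>W x\<bar> * S N x \<le> \<bar>W x\<bar> * \<rho> x" using elim by (intro mult_left_mono) auto
    then show ?case by (simp add: abs_mult abs_of_nonneg[OF S_nonneg])
  qed
qed

text \<open>On partial sums the kinetic terms for V and W are the same and cancel, leaving only
  potential terms to be passed to the limit. The result is E <= (1 - 1/gamma) E + E'/gamma.\<close>

lemma E_le_if_trace_bound:
  assumes W: "W \<in> Lp p" and E': "E' \<ge> 0"
    and tr: "\<And>F. finite F \<Longrightarrow> F \<subseteq> I \<Longrightarrow>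
      - (\<Sum>i\<in>F. \<kappa> i powr (\<gamma> - 1) * hform W (\<psi> i) (\<psi> i)) \<le> (1 - 1 / \<gamma>) * (\<Sum>i\<in>F. \<kappa> i powr \<gamma>) + 1 / \<gamma> * E'"
    and le: "(LINT x|lborel. W x * \<rho> x) \<le> (LINT x|lborel. V x * \<rho> x)"
  shows "E \<le> E'"
proof -
  define Y where "Y = (1 - 1 / \<gamma>) * E + 1 / \<gamma> * E'"
  have g: "1 - 1 / \<gamma> \<ge> 0" "1 / \<gamma> > 0" using gamma by auto
  have Y0: "0 \<le> Y" unfolding Y_def using g E' E_nonneg by (intro add_nonneg_nonneg mult_nonneg_nonneg) auto
  have N: "(\<Sum>i\<in>I \<inter> {..<N}. \<kappa> i powr \<gamma>) + (LINT x|lborel. V x * S N x) - (LINT x|lborel. W x * S N x) \<le> Y" for N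
  proof -
    let ?F = "I \<inter> {..<N}"
    have F: "finite ?F" "?F \<subseteq> I" by auto
    have "(LINT x|lborel. W x * S N x) = (LINT x|lborel. (\<Sum>i\<in>?F. \<kappa> i powr (\<gamma> - 1) * (W x * (\<psi> i x * \<psi> i x))))"
      unfolding S_def wdens_def by (simp add: sum_distrib_left power2_eq_square mult_ac)
    also have "\<dots> = (\<Sum>i\<in>?F. \<kappa> i powr (\<gamma> - 1) * (LINT x|lborel. W x * (\<psi> i x * \<psi> i x)))"
      using potential_integrable[OF psi_H1r psi_H1r W] by (subst Bochner_Integration.integral_sum) auto
    finally have "(\<Sum>i\<in>?F. \<kappa> i powr (\<gamma> - 1) * hform W (\<psi> i) (\<psi> i)) =
       (\<Sum>i\<in>?F. \<kappa> i powr (\<gamma> - 1) * dform (\<psi> i) (\<psi> i)) + (LINT x|lborel. W x * S N x)"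
      by (simp add: hform_def distrib_left sum.distrib)
    moreover have "(\<Sum>i\<in>?F. \<kappa> i powr (\<gamma> - 1) * dform (\<psi> i) (\<psi> i)) + (\<Sum>i\<in>?F. \<kappa> i powr \<gamma>) = - (LINT x|lborel. V x * S N x)"
      unfolding S_def by (rule LT_bound(1)[OF F])
    moreover have "(1 - 1 / \<gamma>) * (\<Sum>i\<in>?F. \<kappa> i powr \<gamma>) \<le> (1 - 1 / \<gamma>) * E"
      by (intro mult_left_mono sum_le_E F g)
    ultimately show ?thesis using tr[OF F] unfolding Y_def by linarith
  qed
  have "(\<Sum>i\<in>F. \<kappa> i powr \<gamma>) \<le> Y" if F: "finite F" "F \<subseteq> I" for F
  proof -
    obtain M where M: "F \<subseteq> {..<M}" using F(1) finite_nat_iff_bounded by blast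
    have "(\<lambda>N. (LINT x|lborel. V x * S N x) - (LINT x|lborel. W x * S N x)) \<longlonglongrightarrow>
       (LINT x|lborel. V x * \<rho> x) - (LINT x|lborel. W x * \<rho> x)"
      by (intro tendsto_diff potential_S_tendsto V W)
    moreover have "\<exists>N0. \<forall>N\<ge>N0. (LINT x|lborel. V x * S N x) - (LINT x|lborel. W x * S N x) \<le> Y - (\<Sum>i\<in>F. \<kappa> i powr \<gamma>)"
    proof (intro exI[of _ M] allI impI)
      fix N assume "M \<le> N"
      then have "(\<Sum>i\<in>F. \<kappa> i powr \<gamma>) \<le> (\<Sum>i\<in>I \<inter> {..<N}. \<kappa> i powr \<gamma>)"
        using M F by (intro sum_mono2) force+
      then show "(LINT x|lborel. V x * S N x) - (LINT x|lborel. W x * S N x) \<le> Y - (\<Sum>i\<in>F. \<kappa> i powr \<gamma>)"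
        using N[of N] by linarith
    qed
    ultimately have "(LINT x|lborel. V x * \<rho> x) - (LINT x|lborel. W x * \<rho> x) \<le> Y - (\<Sum>i\<in>F. \<kappa> i powr \<gamma>)"
      by (rule LIMSEQ_le_const2)
    then show ?thesis using le by linarith
  qed
  then have "E \<le> Y" using Y0 by (rule E_le)
  \<comment> \<open>\<open>E\<close> is a finite real number, so (1 - 1/gamma) E may be subtracted
    from both sides.\<close>
  then have "1 / \<gamma> * E \<le> 1 / \<gamma> * E'" unfolding Y_def by (simp add: algebra_simps)
  then show ?thesis using g(2) by (simp only: mult_le_cancel_left_pos)
qed

end

text \<open>Hoelder's inequality with its equality case shows that \<open>W\<close> minimises the potential energy of \<open>\<rho>\<close>.\<close>

lemma energy_step_mono:
  fixes V W :: "real^'d \<Rightarrow> real"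
  assumes A: "eigensystem \<gamma> p C V I l \<psi>" and B: "eigensystem \<gamma> p C W I' l' \<psi>'"
    and V1: "Lpi p V \<le> 1"
    and W: "W \<in> borel_measurable borel"
    and WA: "AE x in lborel. W x = - ((LINT x|lborel. weighted_density \<gamma> I l \<psi> x powr (p / (p - 1))) powr (- 1 / p)) *
      weighted_density \<gamma> I l \<psi> x powr (1 / (p - 1))"
  shows "enn2real (energy \<gamma> V) \<le> enn2real (energy \<gamma> W)"
proof -
  interpret A: eigensystem \<gamma> p C "TYPE('d)" V I l \<psi> by (rule A)
  interpret B: eigensystem \<gamma> p C "TYPE('d)" W I' l' \<psi>' by (rule B)
  have WA': "AE x in lborel. W x = - (A.R powr (- 1 / p)) * weighted_density \<gamma> I l \<psi> x powr (1 / (p - 1))"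
    using WA unfolding A.R_def .
  have "A.E \<le> B.E"
  proof (rule A.E_le_if_trace_bound[OF B.V B.E_nonneg])
    fix F assume F: "finite F" "F \<subseteq> I"
    show "- (\<Sum>i\<in>F. (- l i) powr (\<gamma> - 1) * hform W (\<psi> i) (\<psi> i)) \<le> (1 - 1 / \<gamma>) * (\<Sum>i\<in>F. (- l i) powr \<gamma>) + 1 / \<gamma> * B.E"
    proof (rule B.trace_inequality[OF F(1) orthonormal_on_subset[OF A.psi_orthonormal F(2)]])
      show "\<psi> j \<in> H1r" if "j \<in> F" for j using A.psi_H1r F(2) that by auto
      show "0 < - l j" if "j \<in> F" for j using A.l_neg F(2) that by auto
    qed
  next
    have "- (LINT x|lborel. V x * weighted_density \<gamma> I l \<psi> x) \<le> (LINT x|lborel. \<bar>V x\<bar> * weighted_density \<gamma> I l \<psi> x)"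
      using integral_abs_bound[of lborel "\<lambda>x. V x * weighted_density \<gamma> I l \<psi> x"]
      by (simp add: abs_mult abs_of_nonneg[OF A.rho_nonneg])
    also have "\<dots> \<le> A.R powr ((p - 1) / p)" by (rule A.potential_rho_Hoelder[OF A.V V1])
    also have "\<dots> = - (LINT x|lborel. W x * weighted_density \<gamma> I l \<psi> x)" by (rule A.next_potential(3)[OF W WA', symmetric])
    finally show "(LINT x|lborel. W x * weighted_density \<gamma> I l \<psi> x) \<le> (LINT x|lborel. V x * weighted_density \<gamma> I l \<psi> x)"
      by simp
  qed
  then show ?thesis by (simp add: A.E_def B.E_def)
qed

text \<open>The finiteness clause excludes the value 0 that \<open>enn2real\<close> assigns to
  infinity, so the real sequence carries the true energies.\<close>

theorem mainTheorem1:
  fixes \<gamma> :: real and V :: "nat \<Rightarrow> real^'d \<Rightarrow> real"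
  assumes "\<gamma> \<ge> 1"
    and "V 0 \<in> Lp (\<gamma> + real CARD('d) / 2)"
    and "(LINT x|lborel. \<bar>V 0 x\<bar> powr (\<gamma> + real CARD('d) / 2)) = 1"
    and "\<And>n. algorithm_step \<gamma> (V n) (V (Suc n))"
  shows "(\<forall>n. energy \<gamma> (V n) < \<infinity>) \<and>
    (\<forall>n. enn2real (energy \<gamma> (V (Suc n))) powr (1 / \<gamma>) \<ge> enn2real (energy \<gamma> (V n)) powr (1 / \<gamma>)) \<and>
    incseq (\<lambda>n. enn2real (energy \<gamma> (V n))) \<and>
    (\<exists>C. \<forall>n. enn2real (energy \<gamma> (V n)) \<le> C) \<and>
    convergent (\<lambda>n. enn2real (energy \<gamma> (V n)))"
proof -
  define p where "p = \<gamma> + real CARD('d) / 2"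
  define C where "C = dual_const TYPE('d) \<gamma>"
  interpret exponents \<gamma> p C "TYPE('d)"
    by standard (use assms(1) in \<open>simp_all add: p_def C_def\<close>)
  define next_pot where "next_pot = (\<lambda>n I l \<psi>. V (Suc n) \<in> borel_measurable borel \<and>
     (AE x in lborel. V (Suc n) x = - ((LINT x|lborel. weighted_density \<gamma> I l \<psi> x powr (p / (p - 1))) powr (- 1 / p)) *
       weighted_density \<gamma> I l \<psi> x powr (1 / (p - 1))))"
  have "\<exists>I l \<psi>. neg_eigensystem (V n) I l \<psi> \<and> next_pot n I l \<psi>" for n
    using assms(4)[of n] by (simp add: algorithm_step_def Let_def p_def next_pot_def)
  then obtain I l \<psi> where sys: "\<And>n. neg_eigensystem (V n) (I n) (l n) (\<psi> n)" and np: "\<And>n. next_pot n (I n) (l n) (\<psi> n)"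
    by metis
  have step: "neg_eigensystem (V n) (I n) (l n) (\<psi> n)" "V (Suc n) \<in> borel_measurable borel"
    "AE x in lborel. V (Suc n) x = - ((LINT x|lborel. weighted_density \<gamma> (I n) (l n) (\<psi> n) x powr (p / (p - 1))) powr (- 1 / p)) *
       weighted_density \<gamma> (I n) (l n) (\<psi> n) x powr (1 / (p - 1))" for n
    using sys[of n] np[of n] unfolding next_pot_def by blast+
  have es: "eigensystem \<gamma> p C (V n) (I n) (l n) (\<psi> n)" if "V n \<in> Lp p" for n
    by unfold_locales (use that step(1) in auto)
  \<comment> \<open>The invariant is a bound by 1 rather than equality, so that it survives a step
    from a potential without negative eigenvalues.\<close>
  have P: "V n \<in> Lp p \<and> Lpi p (V n) \<le> 1" for n
  proof (induction n)
    case 0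
    show ?case using assms(2,3) by (simp add: p_def Lpi_def)
  next
    case (Suc n)
    then interpret A: eigensystem \<gamma> p C "TYPE('d)" "V n" "I n" "l n" "\<psi> n" by (intro es) simp
    show ?case using A.next_potential(1,2)[OF step(2), of n] step(3)[of n] by (simp add: A.R_def)
  qed
  define e where "e = (\<lambda>n. enn2real (energy \<gamma> (V n)))"
  have fin: "energy \<gamma> (V n) < \<infinity>" and bd: "e n \<le> LT_const" for n
  proof -
    interpret A: eigensystem \<gamma> p C "TYPE('d)" "V n" "I n" "l n" "\<psi> n" by (rule es) (use P in simp)
    show "energy \<gamma> (V n) < \<infinity>" by (rule A.energy_finite)
    have "A.E \<le> LT_const * Lpi p (V n)" by (rule A.E_bound)
    also have "\<dots> \<le> LT_const * 1" using P[of n] A.LT_const_nonneg by (intro mult_left_mono) auto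
    finally show "e n \<le> LT_const" by (simp add: A.E_def e_def)
  qed
  have mono: "e n \<le> e (Suc n)" for n
    unfolding e_def using energy_step_mono[OF es es _ step(2,3)] P by blast
  have inc: "incseq e" by (rule incseq_SucI) (rule mono)
  have conv: "convergent e"
    using incseq_convergent[OF inc, of LT_const] bd unfolding convergent_def by blast
  have "e n powr (1 / \<gamma>) \<le> e (Suc n) powr (1 / \<gamma>)" for n
    using mono[of n] assms(1) by (intro powr_mono2) (auto simp: e_def)
  then show ?thesis using fin bd inc conv unfolding e_def by blast
qed

end
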